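(* Let $X=(x_n)_{n\ge1}$ be a sequence of positive real numbers such that there is a constant $c>0$ with $x_{n+1}-x_n\ge c$ for all $n$, and suppose $E^{*}(X,N)=N^{2+o(1)}$. Suppose that for some $\kappa\ge2$ and some $m(\kappa)$ the Riemann zeta function satisfies, for every $\varepsilon>0$, $$\frac1T\int_0^T\big|\zeta(\tfrac12+it)\big|^{\kappa}\,dt\ll T^{m(\kappa)+\varepsilon}.$$ Then for almost every $\alpha\in\mathbb{R}$, $$\delta_{\min}^{\alpha}(N)<\frac{1}{N^{\frac{2\kappa-4}{\kappa+4m(\kappa)}-o(1)}},$$ where the rate of decay of the $o(1)$ term depends on $\alpha$.
   Context: For $x\in\mathbb{R}$, $\|x\|=\min_{k\in\mathbb{Z}}|x-k|$. For $\alpha\in\mathbb{R}$, $\delta_{\min}^{\alpha}(N)=\min\{\|\alpha x_m-\alpha x_n\| : 1\le m,n\le N,\ m\ne n\}$. The additive energy is $E^{*}(X,N)=\#\{(n_1,n_2,n_3,n_4)\in[1,N]^4 : |x_{n_1}+x_{n_2}-x_{n_3}-x_{n_4}|<1\}$; $E^{*}(X,N)=N^{2+o(1)}$ means $E^*(X,N)\ll_\varepsilon N^{2+\varepsilon}$ for every $\varepsilon>0$. The notation $\frac{1}{N^{\kappa'-o(1)}}$ means $N^{-(\kappa'-f_\alpha(N))}$ for some function $f_\alpha(N)\to0$, the inequality holding for all sufficiently large $N$. *)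

theory Defs
  imports "HOL-Analysis.Analysis"
begin

definition dist_int :: "real \<Rightarrow> real" where
  "dist_int x = Inf {\<bar>x - real_of_int k\<bar> | k. True}"

definition delta_min :: "(nat \<Rightarrow> real) \<Rightarrow> real \<Rightarrow> nat \<Rightarrow> real" where
  "delta_min x \<alpha> N = Min {dist_int (\<alpha> * x m - \<alpha> * x n) | m n.
       m \<in> {1..N} \<and> n \<in> {1..N} \<and> m \<noteq> n}"

definition add_energy :: "(nat \<Rightarrow> real) \<Rightarrow> nat \<Rightarrow> nat" where
  "add_energy x N = card {(n1, n2, n3, n4). n1 \<in> {1..N} \<and> n2 \<in> {1..N} \<and>
       n3 \<in> {1..N} \<and> n4 \<in> {1..N} \<and> \<bar>x n1 + x n2 - x n3 - x n4\<bar> < 1}"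

text \<open>Dirichlet eta function (convergent for Re s > 0) and the Riemann zeta function
  in the half plane Re s > 0 via  zeta(s) = eta(s) / (1 - 2^(1-s)).\<close>
definition dirichlet_eta :: "complex \<Rightarrow> complex" where
  "dirichlet_eta s = (\<Sum>n. (-1) ^ n / (of_nat (Suc n)) powr s)"

definition riemann_zeta :: "complex \<Rightarrow> complex" where
  "riemann_zeta s = dirichlet_eta s / (1 - 2 powr (1 - s))"

end

theory Submission
  imports Defs "HOL-Probability.Probability" "HOL-Real_Asymp.Real_Asymp"
begin

text \<open>
  Fix \<open>\<theta>\<close> below the claimed exponent and let \<open>d\<close> run through the differences \<open>x m - x n > 0\<close>, \<open>m, n \<le> N\<close>;
  the energy bound lets us discard those below \<open>N powr (2 - 3 * \<epsilon>)\<close>. If no \<open>\<alpha> * d\<close> is within \<open>N powr (- \<theta>)\<close>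
  of an integer, then a trigonometric polynomial in \<open>\<alpha>\<close> with frequencies \<open>k * d\<close>, \<open>k\<close> up to about \<open>N powr \<theta>\<close>, is as
  large as the number of differences. By a second moment estimate against a wide Gaussian, the set of such \<open>\<alpha>\<close>
  is small once the number of solutions of \<open>\<bar>k\<^sub>1 * d\<^sub>1 - k\<^sub>2 * d\<^sub>2\<bar> < 1\<close> with \<open>k\<^sub>1, k\<^sub>2\<close> in a dyadic block
  \<open>[J, 2 * J)\<close> is \<open>O(N powr (4 - \<epsilon>))\<close>; Borel-Cantelli along \<open>N = 2 ^ i\<close> then finishes the proof.

  For the count, group the \<open>d\<close> into cells of logarithmic width \<open>1 / T\<close> with \<open>T = J\<^sup>2 * N powr \<epsilon>\<close>, and give a cell
  the square root of the number of its pairs with \<open>\<bar>d - d'\<bar> < 1\<close> as coefficient. With \<open>P(t)\<close> the resulting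
  exponential sum and \<open>D(t)\<close> a smoothed sum of \<open>k powr (-1/2 - i * t)\<close> over \<open>k\<close> near \<open>J\<close>, the count is at most a
  constant times \<open>J / T\<close> times the integral of \<open>\<bar>D(t) * P(t)\<bar>\<^sup>2 * exp (- t\<^sup>2 / (2 * T\<^sup>2))\<close>. Here \<open>D\<close> is a Gaussian
  average of zeta on the critical line plus a contribution of the pole at \<open>1\<close>; splitting according to \<open>\<bar>zeta\<bar> \<le> A\<close>
  brings in the moment hypothesis, and no analytic continuation is needed because both sides are compared through
  \<open>zeta(s) = lim (\<Sum>k\<le>n. k powr (- s)) - n powr (1 - s) / (1 - s)\<close>.
\<close>

subsection \<open>Gaussian quadratic forms\<close>

text \<open>The exponent is a balance of two losses. With J near N^\<theta>, the range |zeta| <= A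
  costs J * A^2 times the energy N^2, so A^2 may be nearly N^(2-\<theta>). The range |zeta| > A
  costs J * N^4 * A^(2-\<kappa>) * T^m with T near J^2. Up to \<epsilon>, both stay below N^4 when
  \<theta> * (1 + 2m) < (\<kappa> - 2) * (2 - \<theta>) / 2, which is \<theta> < (2\<kappa> - 4) /
  (\<kappa> + 4m). T is squeezed from two sides. The pole contributes J^2 * N^4 / T, which pushes T
  above J^2. An additive error 1 in k * d is below the logarithmic resolution 1/T only if k * d >=
  T, so d must exceed J slightly: this is why small differences are removed. The square roots fit
  Cauchy-Schwarz, which bounds the coincidences between two cells by the product of their
  coefficients. The squares sum to at most the energy, the coefficients themselves to at most the
  number of differences. Gaussian weights are used because their Fourier transform is positive: with
  nonnegative coefficients, terms of an expanded square may be dropped in a lower bound.\<close>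

abbreviation gauss_measure :: "real measure" ("\<gamma>") where
  "\<gamma> \<equiv> std_normal_distribution"

text \<open>This is the characteristic function of the standard normal law, transported by the
  substitution t = s * v.\<close>

lemma gauss_fourier:
  fixes s x :: real
  assumes s: "s > 0"
  shows "has_bochner_integral lborel (\<lambda>t. exp (- t\<^sup>2 / (2 * s\<^sup>2)) *\<^sub>R iexp (x * t))
           (of_real (s * sqrt (2 * pi) * exp (- (s * x)\<^sup>2 / 2)))"
proof -
  have int: "integrable lborel (\<lambda>v. std_normal_density v *\<^sub>R iexp (s * x * v))"
    by (rule Bochner_Integration.integrable_bound[OF integrable_normal_density[of 1 0]])
       (auto simp: normal_density_def)
  have "char \<gamma> (s * x) = of_real (exp (- (s * x)\<^sup>2 / 2))"
    by (simp add: char_std_normal_distribution)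
  hence "(\<integral>v. std_normal_density v *\<^sub>R iexp (s * x * v) \<partial>lborel) = of_real (exp (- (s * x)\<^sup>2 / 2))"
    unfolding char_def by (subst (asm) integral_density) auto
  hence "has_bochner_integral lborel (\<lambda>v. std_normal_density v *\<^sub>R iexp (s * x * v))
       (of_real (exp (- (s * x)\<^sup>2 / 2)))"
    using int by (simp add: has_bochner_integral_iff)
  hence "has_bochner_integral lborel (\<lambda>v. sqrt (2 * pi) *\<^sub>R (std_normal_density v *\<^sub>R iexp (s * x * v)))
       (sqrt (2 * pi) *\<^sub>R of_real (exp (- (s * x)\<^sup>2 / 2)))"
    by (rule has_bochner_integral_scaleR_right)
  hence "has_bochner_integral lborel (\<lambda>v. exp (- (0 + s * v)\<^sup>2 / (2 * s\<^sup>2)) *\<^sub>R iexp (x * (0 + s * v)))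
       (sqrt (2 * pi) *\<^sub>R of_real (exp (- (s * x)\<^sup>2 / 2)))"
    using s by (simp add: normal_density_def power_mult_distrib mult_ac)
  thus ?thesis
    using s by (subst lborel_has_bochner_integral_real_affine_iff[where c=s and t=0])
       (auto simp: scaleR_conv_of_real field_simps)
qed

lemma integrable_gauss:
  fixes s :: real
  assumes "s > 0"
  shows "integrable lborel (\<lambda>t::real. exp (- t\<^sup>2 / (2 * s\<^sup>2)))"
proof -
  have "integrable lborel (\<lambda>t. exp (- t\<^sup>2 / (2 * s\<^sup>2)) *\<^sub>R iexp (0 * t))"
    using gauss_fourier[OF assms, of 0] by (rule integrable.intros)
  from integrable_Re[OF this] show ?thesis by simp
qed

lemma integral_gauss:
  fixes s :: real
  assumes "s > 0"
  shows "(\<integral>t. exp (- t\<^sup>2 / (2 * s\<^sup>2)) \<partial>lborel) = s * sqrt (2 * pi)"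
proof -
  have "(\<integral>t. exp (- t\<^sup>2 / (2 * s\<^sup>2)) *\<^sub>R iexp (0 * t) \<partial>lborel) = of_real (s * sqrt (2 * pi))"
    using has_bochner_integral_integral_eq[OF gauss_fourier[OF assms, of 0]] by simp
  hence "(\<integral>t. of_real (exp (- t\<^sup>2 / (2 * s\<^sup>2))) \<partial>lborel) = (of_real (s * sqrt (2 * pi)) :: complex)"
    by (simp add: scaleR_conv_of_real)
  thus ?thesis unfolding integral_complex_of_real of_real_eq_iff .
qed

text \<open>An exact identity, because it is used in both directions: for nonnegative coefficients
  pairs may be dropped to get a lower bound, while the decay of the kernel in s times the frequency
  gap gives upper bounds.\<close>

lemma gauss_quadratic_form:
  fixes a :: "'i \<Rightarrow> complex" and \<theta> :: "'i \<Rightarrow> real"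
  assumes s: "s > 0" and fin: "finite I"
  defines "F \<equiv> \<lambda>t. (cmod (\<Sum>i\<in>I. a i * iexp (\<theta> i * t)))\<^sup>2 * exp (- t\<^sup>2 / (2 * s\<^sup>2))"
  shows "integrable lborel F"
    and "integral\<^sup>L lborel F = s * sqrt (2 * pi) *
           (\<Sum>i\<in>I. \<Sum>j\<in>I. Re (a i * cnj (a j)) * exp (- (s * (\<theta> i - \<theta> j))\<^sup>2 / 2))"
proof -
  have eq: "of_real (F t) = (\<Sum>i\<in>I. \<Sum>j\<in>I. (a i * cnj (a j)) *
      (exp (- t\<^sup>2 / (2 * s\<^sup>2)) *\<^sub>R iexp ((\<theta> i - \<theta> j) * t)))" for t
  proof -
    have "of_real ((cmod (\<Sum>i\<in>I. a i * iexp (\<theta> i * t)))\<^sup>2)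
        = (\<Sum>i\<in>I. a i * iexp (\<theta> i * t)) * cnj (\<Sum>j\<in>I. a j * iexp (\<theta> j * t))"
      by (rule complex_norm_square)
    also have "\<dots> = (\<Sum>i\<in>I. \<Sum>j\<in>I. (a i * cnj (a j)) * iexp ((\<theta> i - \<theta> j) * t))"
      by (simp add: cnj_sum sum_product exp_cnj algebra_simps exp_diff exp_minus divide_inverse)
    finally show ?thesis
      by (simp add: F_def sum_distrib_right sum_distrib_left scaleR_conv_of_real mult_ac)
  qed
  have hb: "has_bochner_integral lborel (\<lambda>t. of_real (F t) :: complex)
     (\<Sum>i\<in>I. \<Sum>j\<in>I. (a i * cnj (a j)) * of_real (s * sqrt (2 * pi) * exp (- (s * (\<theta> i - \<theta> j))\<^sup>2 / 2)))"
    unfolding eq by (intro has_bochner_integral_sum has_bochner_integral_mult_right gauss_fourier s)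
  have "integrable lborel (\<lambda>t. Re (of_real (F t)))"
    using hb by (intro integrable_Re) (auto simp: has_bochner_integral_iff)
  thus int: "integrable lborel F" by simp
  have "of_real (integral\<^sup>L lborel F) = (\<Sum>i\<in>I. \<Sum>j\<in>I. (a i * cnj (a j)) * of_real (s * sqrt (2 * pi) * exp (- (s * (\<theta> i - \<theta> j))\<^sup>2 / 2)))"
    using has_bochner_integral_integral_eq[OF hb] by simp
  hence "Re (of_real (integral\<^sup>L lborel F)) = Re (\<Sum>i\<in>I. \<Sum>j\<in>I. (a i * cnj (a j)) * of_real (s * sqrt (2 * pi) * exp (- (s * (\<theta> i - \<theta> j))\<^sup>2 / 2)))"
    by simp
  thus "integral\<^sup>L lborel F = s * sqrt (2 * pi) *
           (\<Sum>i\<in>I. \<Sum>j\<in>I. Re (a i * cnj (a j)) * exp (- (s * (\<theta> i - \<theta> j))\<^sup>2 / 2))"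
    by (simp add: sum_distrib_left algebra_simps)
qed

subsection \<open>The zeta function on the critical line\<close>

abbreviation zeta_abs :: "real \<Rightarrow> real" where
  "zeta_abs t \<equiv> cmod (riemann_zeta (Complex (1/2) t))"

text \<open>The subtracted term is the antiderivative of \<open>u powr (- s)\<close> at n. Without
  it the partial sums would diverge on the critical line.\<close>

definition zeta_approx :: "nat \<Rightarrow> complex \<Rightarrow> complex" where
  "zeta_approx n s = (\<Sum>k=1..n. of_nat k powr (- s)) - of_nat n powr (1 - s) / (1 - s)"

text \<open>Mean value inequality on a segment of length 1; the modulus of the derivative is largest
  at the left end.\<close>

lemma powr_diff_bound:
  fixes s z :: complex and n :: nat
  assumes n: "n \<ge> 1" and s: "Re s \<ge> 0" and z: "z \<in> closed_segment (of_nat n) (of_nat (Suc n))"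
  shows "cmod (z powr (- s) - of_nat (Suc n) powr (- s)) \<le> cmod s * real n powr (- Re s - 1)"
proof -
  define S :: "complex set" where "S = closed_segment (of_nat n) (of_nat (Suc n))"
  have zS: "\<exists>x. z = of_real x \<and> real n \<le> x \<and> x \<le> real n + 1" if "z \<in> S" for z
  proof -
    from that obtain u where u: "z = (1 - u) *\<^sub>R of_nat n + u *\<^sub>R of_nat (Suc n)" "0 \<le> u" "u \<le> 1"
      by (auto simp: S_def closed_segment_def)
    hence "z = of_real (real n + u)"
      by (simp add: scaleR_conv_of_real algebra_simps)
    thus ?thesis using u by (intro exI[of _ "real n + u"]) auto
  qed
  have "cmod (z powr (- s) - of_nat (Suc n) powr (- s)) \<le> (cmod s * real n powr (- Re s - 1)) * cmod (z - of_nat (Suc n))"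
  proof (rule field_differentiable_bound[where S = S and f' = "\<lambda>z. - s * z powr (- s - 1)"])
    show "convex S" by (simp add: S_def)
    show "z \<in> S" "of_nat (Suc n) \<in> S" using z by (simp_all add: S_def)
    fix w assume "w \<in> S"
    then obtain x where x: "w = of_real x" "real n \<le> x" "x \<le> real n + 1" using zS by blast
    have "x > 0" using x(2) n by simp
    hence w: "w \<notin> \<real>\<^sub>\<le>\<^sub>0" unfolding x(1) nonpos_Reals_of_real_iff not_le .
    show "((\<lambda>z. z powr (- s)) has_field_derivative - s * w powr (- s - 1)) (at w within S)"
      by (rule has_field_derivative_at_within[OF has_field_derivative_powr[OF w]])
    have "cmod (w powr (- s - 1)) = x powr (- Re s - 1)"
      unfolding x(1) using x(2) n by (subst norm_powr_real_powr) simp_all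
    also have "\<dots> \<le> real n powr (- Re s - 1)"
      using x(2) n s by (intro powr_mono2') simp_all
    finally show "cmod (- s * w powr (- s - 1)) \<le> cmod s * real n powr (- Re s - 1)"
      by (simp add: norm_mult mult_left_mono)
  qed
  also have "cmod (z - of_nat (Suc n)) \<le> 1"
  proof -
    obtain x where "z = of_real x" "real n \<le> x" "x \<le> real n + 1" using zS z by (auto simp: S_def)
    hence "z - of_nat (Suc n) = of_real (x - real (Suc n))" "\<bar>x - real (Suc n)\<bar> \<le> 1" by auto
    thus ?thesis by (simp only: norm_of_real)
  qed
  finally show ?thesis by (simp add: mult_left_mono mult_left_le)
qed

text \<open>The increment is, up to sign, that of a function \<open>h\<close> over [n, n + 1] whose
  derivative is the difference estimated in \<open>powr_diff_bound\<close>. The factor 1/n gained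
  over the size of a single term makes the increments summable on the critical line.\<close>

lemma zeta_approx_Suc_diff:
  fixes s :: complex and n :: nat
  assumes n: "n \<ge> 1" and s: "Re s \<ge> 0" "s \<noteq> 1"
  shows "cmod (zeta_approx (Suc n) s - zeta_approx n s) \<le> cmod s * real n powr (- Re s - 1)"
proof -
  define S :: "complex set" where "S = closed_segment (of_nat n) (of_nat (Suc n))"
  define h where "h = (\<lambda>z::complex. z powr (1 - s) / (1 - s) - z * of_nat (Suc n) powr (- s))"
  have "cmod (h (of_nat (Suc n)) - h (of_nat n)) 
     \<le> (cmod s * real n powr (- Re s - 1)) * cmod (of_nat (Suc n) - of_nat n :: complex)"
  proof (rule field_differentiable_bound[where S = S and f' = "\<lambda>z. z powr (- s) - of_nat (Suc n) powr (- s)"])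
    show "convex S" by (simp add: S_def)
    show "of_nat n \<in> S" "of_nat (Suc n) \<in> S" by (simp_all add: S_def)
    fix w assume w: "w \<in> S"
    show "cmod (w powr (- s) - of_nat (Suc n) powr (- s)) \<le> cmod s * real n powr (- Re s - 1)"
      using powr_diff_bound[of n s w] w n s by (simp add: S_def)
    from w obtain u where u: "w = (1 - u) *\<^sub>R of_nat n + u *\<^sub>R of_nat (Suc n)" "0 \<le> u" "u \<le> 1"
      by (auto simp: S_def closed_segment_def)
    hence "w = of_real (real n + u)"
      by (simp add: scaleR_conv_of_real algebra_simps)
    moreover have "real n + u > 0" using u(2) n by simp
    ultimately have w: "w \<notin> \<real>\<^sub>\<le>\<^sub>0" by (simp only: nonpos_Reals_of_real_iff not_le)
    have d: "((\<lambda>z. z powr (1 - s)) has_field_derivative (1 - s) * w powr (1 - s - 1)) (at w within S)"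
      by (rule has_field_derivative_at_within[OF has_field_derivative_powr[OF w]])
    show "(h has_field_derivative w powr (- s) - of_nat (Suc n) powr (- s)) (at w within S)"
      using DERIV_diff[OF DERIV_cdivide[OF d, of "1 - s"] DERIV_cmult_right[OF DERIV_ident, of "of_nat (Suc n) powr (- s)"]] s
      unfolding h_def by (simp del: of_nat_Suc)
  qed
  moreover have "zeta_approx (Suc n) s - zeta_approx n s = - (h (of_nat (Suc n)) - h (of_nat n))"
    unfolding zeta_approx_def h_def by (simp add: ring_distribs)
  ultimately show ?thesis by (simp add: norm_minus_commute)
qed

text \<open>The increments are at most (1 + |t|) * n^(-3/2), so they sum to a limit. The linear
  growth in t, uniform in n, later permits dominated convergence against a Gaussian.\<close>

lemma zeta_approx_critical:
  obtains K Z where "K > 0"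
    "\<And>t. (\<lambda>n. zeta_approx n (Complex (1/2) t)) \<longlonglongrightarrow> Z t"
    "\<And>n t. cmod (zeta_approx (Suc n) (Complex (1/2) t)) \<le> K * (1 + \<bar>t\<bar>)"
proof -
  define b where "b = (\<lambda>n. real (Suc n) powr (- 3 / 2))"
  have "summable (\<lambda>n. real n powr (- 3 / 2))"
    by (subst summable_real_powr_iff) auto
  hence sb: "summable b" unfolding b_def by (subst summable_Suc_iff)
  define \<Delta> where "\<Delta> = (\<lambda>t n. zeta_approx (Suc (Suc n)) (Complex (1/2) t) - zeta_approx (Suc n) (Complex (1/2) t))"
  have \<Delta>: "cmod (\<Delta> t n) \<le> (1 + \<bar>t\<bar>) * b n" for t n
  proof -
    have "cmod (\<Delta> t n) \<le> cmod (Complex (1/2) t) * b n"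
      using zeta_approx_Suc_diff[of "Suc n" "Complex (1/2) t"] 
      by (auto simp: \<Delta>_def b_def complex_eq_iff)
    also have "cmod (Complex (1/2) t) \<le> 1 + \<bar>t\<bar>"
      using cmod_le[of "Complex (1/2) t"] by simp
    finally show ?thesis by (simp add: b_def mult_right_mono)
  qed
  have s\<Delta>: "summable (\<Delta> t)" for t
    by (rule summable_comparison_test'[OF summable_mult[OF sb, of "1 + \<bar>t\<bar>"]]) (use \<Delta> in auto)
  have tele: "(\<Sum>k<n. \<Delta> t k) = zeta_approx (Suc n) (Complex (1/2) t) - zeta_approx 1 (Complex (1/2) t)" for n t
    unfolding \<Delta>_def by (subst sum_lessThan_telescope) simp
  define Z where "Z = (\<lambda>t. suminf (\<Delta> t) + zeta_approx 1 (Complex (1/2) t))"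
  have "(\<lambda>n. zeta_approx (Suc n) (Complex (1/2) t)) \<longlonglongrightarrow> Z t" for t
    using tendsto_add[OF summable_LIMSEQ[OF s\<Delta>[of t]] tendsto_const[of "zeta_approx 1 (Complex (1/2) t)"]]
    by (simp add: tele Z_def)
  hence lim: "(\<lambda>n. zeta_approx n (Complex (1/2) t)) \<longlonglongrightarrow> Z t" for t
    by (subst (asm) filterlim_sequentially_Suc)
  have "cmod (zeta_approx (Suc n) (Complex (1/2) t)) \<le> (suminf b + 3) * (1 + \<bar>t\<bar>)" for n t
  proof -
    have "cmod (\<Sum>k<n. \<Delta> t k) \<le> (\<Sum>k<n. (1 + \<bar>t\<bar>) * b k)"
      by (rule order_trans[OF norm_sum]) (intro sum_mono \<Delta>)
    also have "\<dots> \<le> (1 + \<bar>t\<bar>) * suminf b"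
      unfolding sum_distrib_left[symmetric] 
      by (intro mult_left_mono sum_le_suminf sb) (auto simp: b_def)
    finally have 1: "cmod (\<Sum>k<n. \<Delta> t k) \<le> (1 + \<bar>t\<bar>) * suminf b" .
    \<comment> \<open>Distance from the pole: |1 - s| >= Re (1 - s) = 1/2. The first term 1 and a
      pole part of at most 2 give the 3 in the constant.\<close>
    have "1/2 \<le> cmod (1 - Complex (1/2) t)"
      using abs_Re_le_cmod[of "1 - Complex (1/2) t"] by simp
    hence "1 / cmod (1 - Complex (1/2) t) \<le> 1 / (1/2)"
      by (intro divide_left_mono) auto
    hence "cmod (1 / (1 - Complex (1/2) t)) \<le> 2"
      by (simp add: norm_divide)
    hence 2: "cmod (zeta_approx 1 (Complex (1/2) t)) \<le> 3"
      unfolding zeta_approx_def using norm_triangle_ineq4[of 1 "1 / (1 - Complex (1/2) t)"] by simp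
    have "cmod (zeta_approx (Suc n) (Complex (1/2) t)) \<le> (1 + \<bar>t\<bar>) * suminf b + 3"
      using norm_triangle_ineq[of "\<Sum>k<n. \<Delta> t k" "zeta_approx 1 (Complex (1/2) t)"] 1 2 by (simp add: tele)
    also have "\<dots> \<le> (suminf b + 3) * (1 + \<bar>t\<bar>)" by (simp add: algebra_simps)
    finally show ?thesis .
  qed
  moreover have "suminf b \<ge> 0" by (rule suminf_nonneg[OF sb]) (simp add: b_def)
  ultimately show ?thesis using that[of "suminf b + 3" Z] lim by auto
qed

text \<open>The terms with even index are subtracted twice, and 2 * (2k)^(-s) = 2^(1-s) * k^(-s).
  The pole corrections cancel because (2n)^(1-s) = 2^(1-s) * n^(1-s), so there is no error
  term.\<close>

lemma eta_partial_even:
  assumes "s \<noteq> 1" "n \<ge> 1"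
  shows "(\<Sum>i<2*n. (-1) ^ i / (of_nat (Suc i)) powr s) = zeta_approx (2 * n) s - 2 powr (1 - s) * zeta_approx n s"
proof -
  have mul: "of_nat (2 * n) powr z = 2 powr z * of_nat n powr z" for n :: nat and z :: complex
    using powr_times_real[of 2 "of_nat n" z] by simp
  have "(\<Sum>i<2*n. (-1) ^ i / (of_nat (Suc i)) powr s) = 
     (\<Sum>k=1..2*n. of_nat k powr (- s)) - 2 powr (1 - s) * (\<Sum>k=1..n. of_nat k powr (- s))"
  proof (induction n)
    case (Suc n)
    have "2 powr (1 - s) * of_nat (Suc n) powr (- s) = 2 * (of_nat (2 * Suc n) powr (- s))"
      by (subst mul) (simp add: powr_diff powr_minus field_simps)
    hence e: "2 powr (1 - s) * of_nat (Suc n) powr (- s) = 2 * (of_nat (Suc (Suc (2 * n))) powr (- s))"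
      by simp
    have "(\<Sum>i<2 * Suc n. (-1) ^ i / (of_nat (Suc i)) powr s) = 
       (\<Sum>i<2 * n. (-1) ^ i / (of_nat (Suc i)) powr s) + 
       (of_nat (Suc (2 * n)) powr (- s) - of_nat (Suc (Suc (2 * n))) powr (- s))"
      by (simp add: powr_minus divide_inverse)
    also have "\<dots> = ((\<Sum>k=1..2*n. of_nat k powr (- s)) - 2 powr (1 - s) * (\<Sum>k=1..n. of_nat k powr (- s)))
       + (of_nat (Suc (2 * n)) powr (- s) + of_nat (Suc (Suc (2 * n))) powr (- s)
           - 2 powr (1 - s) * of_nat (Suc n) powr (- s))"
      unfolding Suc e by simp
    also have "\<dots> = (\<Sum>k=1..2*Suc n. of_nat k powr (- s)) - 2 powr (1 - s) * (\<Sum>k=1..Suc n. of_nat k powr (- s))"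
      by (simp add: ring_distribs)
    finally show ?case .
  qed simp
  thus ?thesis
    unfolding zeta_approx_def by (simp only: mul right_diff_distrib) simp
qed

lemma LIMSEQ_even_oddI:
  fixes f :: "nat \<Rightarrow> 'a::metric_space"
  assumes e: "(\<lambda>n. f (2 * n)) \<longlonglongrightarrow> L" and o: "(\<lambda>n. f (Suc (2 * n))) \<longlonglongrightarrow> L"
  shows "f \<longlonglongrightarrow> L"
proof (rule metric_LIMSEQ_I)
  fix r :: real assume "r > 0"
  from metric_LIMSEQ_D[OF e this] metric_LIMSEQ_D[OF o this] obtain M N where
    M: "\<And>n. n \<ge> M \<Longrightarrow> dist (f (2 * n)) L < r" and N: "\<And>n. n \<ge> N \<Longrightarrow> dist (f (Suc (2 * n))) L < r" by blast
  show "\<exists>no. \<forall>n\<ge>no. dist (f n) L < r"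
  proof (intro exI[of _ "2 * M + 2 * N + 1"] allI impI)
    fix n assume n: "n \<ge> 2 * M + 2 * N + 1"
    show "dist (f n) L < r"
    proof (cases "even n")
      case True
      with M[of "n div 2"] n show ?thesis by (auto elim!: evenE)
    next
      case False
      with N[of "n div 2"] n show ?thesis by (auto elim!: oddE)
    qed
  qed
qed

text \<open>\<open>dirichlet_eta\<close> is a \<open>suminf\<close> and can be evaluated only once
  all its partial sums converge. The even ones come from the approximants, and the odd ones differ
  from them by a term of modulus (2n + 1)^(-1/2).\<close>

lemma zeta_approx_tendsto_zeta:
  "(\<lambda>n. zeta_approx n (Complex (1/2) t)) \<longlonglongrightarrow> riemann_zeta (Complex (1/2) t)"
proof -
  define s where "s = Complex (1/2) t"
  have s1: "s \<noteq> 1" by (auto simp: s_def complex_eq_iff)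
  obtain Z where Z: "(\<lambda>n. zeta_approx n s) \<longlonglongrightarrow> Z"
    using zeta_approx_critical unfolding s_def by metis
  define p where "p = (\<lambda>n. \<Sum>i<n. (-1) ^ i / (of_nat (Suc i)) powr s :: complex)"
  have "(\<lambda>n. zeta_approx (2 * n) s) \<longlonglongrightarrow> Z"
    by (rule LIMSEQ_subseq_LIMSEQ[OF Z, unfolded o_def]) (auto simp: strict_mono_def)
  hence "(\<lambda>n. zeta_approx (2 * n) s - 2 powr (1 - s) * zeta_approx n s) \<longlonglongrightarrow> Z - 2 powr (1 - s) * Z"
    by (intro tendsto_intros Z)
  hence pe: "(\<lambda>n. p (2 * n)) \<longlonglongrightarrow> Z - 2 powr (1 - s) * Z"
    by (rule Lim_transform_eventually)
       (use eta_partial_even[OF s1] in \<open>auto simp: p_def eventually_at_top_linorder intro!: exI[of _ 1]\<close>)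
  have "(\<lambda>n. real (Suc (2 * n)) powr (-1/2)) \<longlonglongrightarrow> 0"
    by (rule tendsto_neg_powr, simp, rule filterlim_at_top_mono[OF filterlim_real_sequentially]) simp
  moreover have "cmod ((-1) ^ (2 * n) / (of_nat (Suc (2 * n))) powr s) = real (Suc (2 * n)) powr (-1/2)" for n
  proof -
    have "cmod (of_nat (Suc (2 * n)) powr s) = real (Suc (2 * n)) powr (1/2)"
      by (subst norm_powr_real_powr) (simp_all add: s_def del: of_nat_Suc)
    thus ?thesis
      using powr_minus_divide[of "real (Suc (2 * n))" "1/2"] by (simp add: norm_divide norm_power del: of_nat_Suc)
  qed
  ultimately have "(\<lambda>n. (-1) ^ (2 * n) / (of_nat (Suc (2 * n))) powr s) \<longlonglongrightarrow> 0"
    by (subst tendsto_norm_zero_iff[symmetric]) simp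
  from tendsto_add[OF pe this] have po: "(\<lambda>n. p (Suc (2 * n))) \<longlonglongrightarrow> Z - 2 powr (1 - s) * Z"
    by (simp add: p_def)
  from pe po have "p \<longlonglongrightarrow> Z - 2 powr (1 - s) * Z" by (rule LIMSEQ_even_oddI)
  hence "(\<lambda>i. (-1) ^ i / (of_nat (Suc i)) powr s) sums (Z - 2 powr (1 - s) * Z)"
    unfolding sums_def p_def .
  hence "dirichlet_eta s = Z * (1 - 2 powr (1 - s))"
    unfolding dirichlet_eta_def by (simp add: sums_iff algebra_simps)
  \<comment> \<open>The zeros of this factor lie on Re s = 1; here 2^(1-s) has modulus sqrt
    2.\<close>
  moreover have "1 - 2 powr (1 - s) \<noteq> 0"
  proof
    assume "1 - 2 powr (1 - s) = 0"
    hence "cmod (2 powr (1 - s)) = 1" by simp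
    moreover have "cmod (2 powr (1 - s)) = 2 powr (1/2)"
      by (subst norm_powr_real_powr) (auto simp: s_def)
    ultimately show False by simp
  qed
  ultimately show ?thesis using Z by (simp add: riemann_zeta_def s_def)
qed

lemma zeta_approx_bound:
  obtains K where "K > 0" "\<And>n t. cmod (zeta_approx (Suc n) (Complex (1/2) t)) \<le> K * (1 + \<bar>t\<bar>)"
    "\<And>t. zeta_abs t \<le> K * (1 + \<bar>t\<bar>)"
proof -
  obtain K where K: "K > 0" "\<And>n t. cmod (zeta_approx (Suc n) (Complex (1/2) t)) \<le> K * (1 + \<bar>t\<bar>)"
    using zeta_approx_critical by metis
  have "zeta_abs t \<le> K * (1 + \<bar>t\<bar>)" for t
    using tendsto_norm[OF LIMSEQ_Suc[OF zeta_approx_tendsto_zeta]]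
    by (rule LIMSEQ_le_const2) (use K in auto)
  with K that show ?thesis by blast
qed

section \<open>Explicit exponentials on the critical line and measurability\<close>

lemma of_nat_powr_critical:
  assumes "k \<ge> 1"
  shows "of_nat k powr (- Complex (1/2) t) = of_real (real k powr (-1/2)) * iexp (- ln (real k) * t)"
proof -
  have "of_real (real k powr (-1/2)) = exp (of_real (- ln (real k) / 2) :: complex)"
    using assms by (simp add: powr_def exp_of_real[symmetric])
  moreover have "- Complex (1/2) t * of_real (ln (real k)) = of_real (- ln (real k) / 2) + \<i> * of_real (- ln (real k) * t)"
    by (simp add: complex_eq_iff)
  hence "of_nat k powr (- Complex (1/2) t) = exp (of_real (- ln (real k) / 2) + \<i> * of_real (- ln (real k) * t))"
    using assms by (simp add: powr_def)
  ultimately show ?thesis by (simp only: exp_add)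
qed

lemma of_nat_powr_critical':
  assumes "k \<ge> 1"
  shows "of_nat k powr (1 - Complex (1/2) t) = of_real (sqrt (real k)) * iexp (- ln (real k) * t)"
proof -
  have "(1 - Complex (1/2) t) * of_real (ln (real k)) = of_real (ln (real k) / 2) + \<i> * of_real (- ln (real k) * t)"
    by (simp add: complex_eq_iff)
  hence "of_nat k powr (1 - Complex (1/2) t) = exp (of_real (ln (real k) / 2) + \<i> * of_real (- ln (real k) * t))"
    using assms by (simp add: powr_def)
  also have "\<dots> = of_real (exp (ln (real k) / 2)) * iexp (- ln (real k) * t)"
    by (simp only: exp_add exp_of_real)
  also have "exp (ln (real k) / 2) = sqrt (real k)"
    using assms by (simp add: powr_half_sqrt[symmetric] powr_def)
  finally show ?thesis .
qed

lemma zeta_approx_critical_eq: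
  assumes "n \<ge> 1"
  shows "zeta_approx n (Complex (1/2) t) = (\<Sum>k=1..n. of_real (real k powr (-1/2)) * iexp (- ln (real k) * t))
     - of_real (sqrt (real n)) * iexp (- ln (real n) * t) / (1/2 - \<i> * of_real t)"
proof -
  have "1 - Complex (1/2) t = 1/2 - \<i> * of_real t" by (simp add: complex_eq_iff)
  moreover have "(\<Sum>k=1..n. of_nat k powr (- Complex (1/2) t)) = (\<Sum>k=1..n. of_real (real k powr (-1/2)) * iexp (- ln (real k) * t))"
    by (intro sum.cong of_nat_powr_critical) auto
  ultimately show ?thesis
    unfolding zeta_approx_def of_nat_powr_critical'[OF assms] by simp
qed

lemma zeta_approx_measurable:
  assumes "n \<ge> 1"
  shows "(\<lambda>t. zeta_approx n (Complex (1/2) t)) \<in> borel_measurable borel"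
  unfolding zeta_approx_critical_eq[OF assms] by measurable

lemma zeta_critical_measurable [measurable]:
  "(\<lambda>t. riemann_zeta (Complex (1/2) t)) \<in> borel_measurable borel"
  by (rule borel_measurable_LIMSEQ_metric[OF zeta_approx_measurable LIMSEQ_Suc[OF zeta_approx_tendsto_zeta]]) auto

subsection \<open>Smoothed Dirichlet polynomials\<close>

lemma prob_space_std_normal: "prob_space \<gamma>"
  using real_dist_normal_dist by (simp add: real_distribution_def)

lemma integrable_exp_half_atMost:
  "integrable lborel (\<lambda>y::real. indicator {..L} y * exp (y / 2))"
proof -
  have "(\<integral>\<^sup>+z. ennreal (exp (- z / 2)) * indicator {0 ..} z \<partial>lborel) = ennreal (0 - (- 2 * exp (- 0 / 2)))"
  proof (rule nn_integral_FTC_atLeast)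
    have "((\<lambda>x::real. exp (- (x / 2))) \<longlongrightarrow> 0) at_top"
      by (intro filterlim_compose[OF exp_at_bot] filterlim_compose[OF filterlim_uminus_at_bot_at_top]
          filterlim_tendsto_pos_mult_at_top[of "\<lambda>_. 1/2" "1/2", simplified] filterlim_ident)
    thus "((\<lambda>x::real. - 2 * exp (- x / 2)) \<longlongrightarrow> 0) at_top"
      by (intro tendsto_mult_right_zero) simp
  qed (auto intro!: derivative_eq_intros)
  also have "(\<lambda>z. ennreal (exp (- z / 2)) * indicator {0 ..} z) = (\<lambda>z. ennreal (norm (indicator {0..} z * exp (- z / 2))))"
    by (auto simp: indicator_def)
  finally have "integrable lborel (\<lambda>z::real. indicator {0..} z * exp (- z / 2))"
    by (subst integrable_iff_bounded) auto
  hence "integrable lborel (\<lambda>y. indicator {0..} (L + (- 1) * y) * exp (- (L + (- 1) * y) / 2))"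
    by (rule lborel_integrable_real_affine) simp
  hence "integrable lborel (\<lambda>y. exp (L / 2) * (indicator {0..} (L + (- 1) * y) * exp (- (L + (- 1) * y) / 2)))"
    by (rule integrable_mult_right)
  also have "(\<lambda>y. exp (L / 2) * (indicator {0..} (L + (- 1) * y) * exp (- (L + (- 1) * y) / 2))) =
     (\<lambda>y::real. indicator {..L} y * exp (y / 2))"
    by (auto simp: indicator_def exp_add[symmetric] field_simps)
  finally show ?thesis .
qed

text \<open>For L = ln n the right-hand side is the pole correction inside
  \<open>zeta_approx n\<close>. As a Fourier integral it no longer has u in a denominator, so its
  Gaussian average in u follows from Fubini.\<close>

lemma integral_exp_atMost:
  "(\<integral>y. indicator {..L} y *\<^sub>R (exp (y / 2) *\<^sub>R iexp (- u * y)) \<partial>lborel) = 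
     of_real (exp (L / 2)) * iexp (- L * u) / (1/2 - \<i> * of_real u)"
proof -
  define w where "w = 1/2 - \<i> * complex_of_real u"
  have w: "w \<noteq> 0" by (auto simp: w_def complex_eq_iff)
  define F where "F = (\<lambda>y::real. exp (of_real y * w) / w)"
  define f where "f = (\<lambda>y::real. exp (y / 2) *\<^sub>R iexp (- u * y))"
  have fF: "f y = exp (of_real y * w)" for y
    by (simp add: f_def w_def scaleR_conv_of_real exp_of_real[symmetric] exp_add[symmetric] algebra_simps)
  \<comment> \<open>The fundamental theorem is applied on [L - i, L]; the passage i -> infinity is
    dominated by exp (y / 2).\<close>
  have I: "has_bochner_integral lborel (\<lambda>y. indicator {L - real i..L} y *\<^sub>R f y) (F L - F (L - real i))" for i
  proof (rule has_bochner_integral_FTC_Icc)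
    fix y
    have "((\<lambda>z. exp (z * w) / w) has_field_derivative exp (of_real y * w)) (at (of_real y))"
      using w by (auto intro!: derivative_eq_intros)
    hence "((\<lambda>y. exp (of_real y * w) / w) has_vector_derivative exp (of_real y * w)) (at y within {L - real i..L})"
      using has_vector_derivative_real_field[of "\<lambda>z. exp (z * w) / w"] by auto
    thus "(F has_vector_derivative f y) (at y within {L - real i..L})"
      by (simp add: F_def fF)
  qed (auto simp: f_def intro!: continuous_intros)
  have "(\<lambda>i. \<integral>y. indicator {L - real i..L} y *\<^sub>R f y \<partial>lborel) \<longlonglongrightarrow> (\<integral>y. indicator {..L} y *\<^sub>R f y \<partial>lborel)"
  proof (rule integral_dominated_convergence[where w = "\<lambda>y. indicator {..L} y * exp (y / 2)"])
    show "AE y in lborel. (\<lambda>i. indicator {L - real i..L} y *\<^sub>R f y) \<longlonglongrightarrow> indicator {..L} y *\<^sub>R f y"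
    proof (intro AE_I2 tendsto_eventually)
      fix y
      obtain i0 where "real i0 \<ge> L - y" using real_arch_simple by blast
      hence "indicator {L - real i..L} y *\<^sub>R f y = indicator {..L} y *\<^sub>R f y" if "i \<ge> i0" for i
        using that by (auto simp: indicator_def)
      thus "\<forall>\<^sub>F i in sequentially. indicator {L - real i..L} y *\<^sub>R f y = indicator {..L} y *\<^sub>R f y"
        by (auto simp: eventually_at_top_linorder)
    qed
  qed (use integrable_exp_half_atMost[of L] in \<open>auto simp: f_def indicator_def\<close>)
  moreover have "(\<integral>y. indicator {L - real i..L} y *\<^sub>R f y \<partial>lborel) = F L - F (L - real i)" for i
    using I by (rule has_bochner_integral_integral_eq)
  ultimately have lim1: "(\<lambda>i. F L - F (L - real i)) \<longlonglongrightarrow> (\<integral>y. indicator {..L} y *\<^sub>R f y \<partial>lborel)"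
    by simp
  have "(\<lambda>i. cmod (F (L - real i))) \<longlonglongrightarrow> 0"
  proof -
    have eq: "cmod (F (L - real i)) = exp (L / 2) / cmod w * exp (- 1 / 2) ^ i" for i
      by (simp add: F_def norm_divide w_def exp_of_nat_mult[symmetric] exp_add[symmetric] algebra_simps)
         (simp add: field_simps)
    have "(\<lambda>i. exp (- 1 / 2 :: real) ^ i) \<longlonglongrightarrow> 0" by (rule LIMSEQ_realpow_zero) auto
    thus ?thesis unfolding eq by (intro tendsto_mult_right_zero)
  qed
  hence "(\<lambda>i. F (L - real i)) \<longlonglongrightarrow> 0" by (rule tendsto_norm_zero_cancel)
  hence "(\<lambda>i. F L - F (L - real i)) \<longlonglongrightarrow> F L - 0" by (intro tendsto_intros)
  with lim1 have "(\<integral>y. indicator {..L} y *\<^sub>R f y \<partial>lborel) = F L"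
    using LIMSEQ_unique by fastforce
  moreover have "F L = of_real (exp (L / 2)) * iexp (- L * u) / (1/2 - \<i> * of_real u)"
    unfolding F_def fF[symmetric] by (simp add: f_def w_def scaleR_conv_of_real mult_ac)
  ultimately show ?thesis unfolding f_def by simp
qed

lemma integral_normal_iexp:
  "(\<integral>v. iexp (a * v) \<partial>\<gamma>) = of_real (exp (- a\<^sup>2 / 2))"
  using char_std_normal_distribution by (simp add: char_def fun_eq_iff)

lemma integrable_normal_iexp [simp]: "integrable \<gamma> (\<lambda>v. iexp (a * v))"
proof -
  interpret prob_space \<gamma> by (rule prob_space_std_normal)
  show ?thesis by (rule integrable_const_bound[of _ 1]) auto
qed

text \<open>The Gaussian factor is what remains of k^(-1/2 - i(t+v)) after the twist by J^(iv) and
  averaging over normal v. It confines k to a bounded multiplicative range around J.\<close>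

definition log_gauss :: "real \<Rightarrow> real \<Rightarrow> real" where
  "log_gauss J x = x powr (-1/2) * exp (- (ln x - ln J)\<^sup>2 / 2)"

definition dirichlet_smooth :: "nat \<Rightarrow> real \<Rightarrow> real \<Rightarrow> complex" where
  "dirichlet_smooth n J t = (\<Sum>k=1..n. of_real (log_gauss J (real k)) * iexp (- ln (real k) * t))"

text \<open>Gaussian average of the pole correction, with L = ln n: exp (y / 2) stems from its
  integral representation, the Gaussian from averaging over v.\<close>

definition pole_term :: "real \<Rightarrow> real \<Rightarrow> real \<Rightarrow> complex" where
  "pole_term L J t = (\<integral>y. indicator {..L} y *\<^sub>R (exp (y / 2 - (y - ln J)\<^sup>2 / 2) *\<^sub>R iexp (- t * y)) \<partial>lborel)"

lemma pole_term_eq: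
  fixes t :: real
  assumes n: "n \<ge> 1"
  defines "u \<equiv> \<lambda>v. t + v"
  shows "integrable \<gamma> (\<lambda>v. of_real (sqrt (real n)) * iexp (- ln (real n) * u v) / (1/2 - \<i> * of_real (u v)) * iexp (ln J * v))"
    "(\<integral>v. of_real (sqrt (real n)) * iexp (- ln (real n) * u v) / (1/2 - \<i> * of_real (u v)) * iexp (ln J * v) \<partial>\<gamma>)
      = pole_term (ln (real n)) J t"
proof -
  define L where "L = ln (real n)"
  have L: "sqrt (real n) = exp (L / 2)"
    using n by (simp add: powr_half_sqrt[symmetric] powr_def L_def)
  interpret N: prob_space \<gamma> by (rule prob_space_std_normal)
  interpret P: pair_sigma_finite lborel \<gamma>
    by (intro pair_sigma_finite.intro) unfold_locales
  define f where "f = (\<lambda>y v. indicator {..L} y *\<^sub>R (exp (y / 2) *\<^sub>R iexp (- u v * y)) * iexp (ln J * v))"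
  have norm_f: "norm (f y v) = indicator {..L} y * exp (y / 2)" for y v
    by (simp add: f_def norm_mult)
  have int: "integrable (lborel \<Otimes>\<^sub>M \<gamma>) (case_prod f)"
  proof (rule P.Fubini_integrable)
    show "case_prod f \<in> borel_measurable (lborel \<Otimes>\<^sub>M \<gamma>)"
      unfolding f_def u_def by measurable
    have "(\<integral>v. norm (case_prod f (y, v)) \<partial>\<gamma>) = indicator {..L} y * exp (y / 2)" for y
      using N.prob_space by (simp add: norm_f)
    thus "integrable lborel (\<lambda>y. \<integral>v. norm (case_prod f (y, v)) \<partial>\<gamma>)"
      by (simp add: integrable_exp_half_atMost)
    have "integrable \<gamma> (\<lambda>v. f y v)" for y
    proof (rule N.integrable_const_bound[of _ "exp (y / 2)"])
      show "AE v in \<gamma>. norm (f y v) \<le> exp (y / 2)"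
        by (simp add: norm_f indicator_def)
      show "f y \<in> borel_measurable \<gamma>"
        unfolding f_def u_def by measurable
    qed
    thus "AE y in lborel. integrable \<gamma> (\<lambda>v. case_prod f (y, v))" by simp
  qed
  have inner1: "(\<integral>y. f y v \<partial>lborel) = of_real (sqrt (real n)) * iexp (- ln (real n) * u v) / (1/2 - \<i> * of_real (u v)) * iexp (ln J * v)" for v
    unfolding f_def integral_mult_left_zero integral_exp_atMost L by (simp add: L_def)
  have inner2: "(\<integral>v. f y v \<partial>\<gamma>) = indicator {..L} y *\<^sub>R (exp (y / 2 - (y - ln J)\<^sup>2 / 2) *\<^sub>R iexp (- t * y))" for y
  proof -
    have eq: "f y v = (indicator {..L} y *\<^sub>R (exp (y / 2) *\<^sub>R iexp (- t * y))) * iexp ((ln J - y) * v)" for v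
      by (simp add: f_def u_def exp_add[symmetric] scaleR_conv_of_real algebra_simps)
    have "exp (y / 2 - (y - ln J)\<^sup>2 / 2) = exp (y / 2) * exp (- (ln J - y)\<^sup>2 / 2)"
      by (simp add: exp_add[symmetric] power2_commute)
    thus ?thesis
      unfolding eq integral_mult_right_zero integral_normal_iexp by (simp add: scaleR_conv_of_real mult_ac)
  qed
  show "integrable \<gamma> (\<lambda>v. of_real (sqrt (real n)) * iexp (- ln (real n) * u v) / (1/2 - \<i> * of_real (u v)) * iexp (ln J * v))"
    using P.integrable_snd[OF int] by (simp add: inner1)
  show "(\<integral>v. of_real (sqrt (real n)) * iexp (- ln (real n) * u v) / (1/2 - \<i> * of_real (u v)) * iexp (ln J * v) \<partial>\<gamma>)
      = pole_term (ln (real n)) J t"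
    using P.Fubini_integral[OF int] unfolding inner1 inner2 pole_term_def L_def .
qed

text \<open>The factor \<open>iexp (ln J * v)\<close> recentres the frequencies at ln J: the k-th
  term picks up the characteristic function at ln J - ln k, which is the Gaussian in
  \<open>log_gauss\<close>.\<close>

lemma zeta_approx_gauss_integral:
  assumes n: "n \<ge> 1"
  shows "(\<integral>v. zeta_approx n (Complex (1/2) (t + v)) * iexp (ln J * v) \<partial>\<gamma>)
     = dirichlet_smooth n J t - pole_term (ln (real n)) J t"
proof -
  have eq: "of_real (real k powr (-1/2)) * iexp (- ln (real k) * (t + v)) * iexp (ln J * v)
     = of_real (real k powr (-1/2)) * iexp (- ln (real k) * t) * iexp ((ln J - ln (real k)) * v)" for k v
    by (simp add: exp_add[symmetric] algebra_simps)
  have I: "(\<integral>v. (\<Sum>k=1..n. of_real (real k powr (-1/2)) * iexp (- ln (real k) * (t + v)) * iexp (ln J * v)) \<partial>\<gamma>)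
     = dirichlet_smooth n J t"
  proof -
    have "(\<integral>v. (\<Sum>k=1..n. of_real (real k powr (-1/2)) * iexp (- ln (real k) * (t + v)) * iexp (ln J * v)) \<partial>\<gamma>)
      = (\<Sum>k=1..n. \<integral>v. of_real (real k powr (-1/2)) * iexp (- ln (real k) * t) * iexp ((ln J - ln (real k)) * v) \<partial>\<gamma>)"
      unfolding eq by (intro Bochner_Integration.integral_sum integrable_mult_right integrable_normal_iexp)
    thus ?thesis
      unfolding integral_mult_right_zero integral_normal_iexp dirichlet_smooth_def log_gauss_def
      by (simp add: power2_commute mult_ac)
  qed
  have J: "integrable \<gamma> (\<lambda>v. (\<Sum>k=1..n. of_real (real k powr (-1/2)) * iexp (- ln (real k) * (t + v)) * iexp (ln J * v)))"
    unfolding eq by (intro Bochner_Integration.integrable_sum integrable_mult_right integrable_normal_iexp)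
  have "(\<integral>v. zeta_approx n (Complex (1/2) (t + v)) * iexp (ln J * v) \<partial>\<gamma>)
     = (\<integral>v. (\<Sum>k=1..n. of_real (real k powr (-1/2)) * iexp (- ln (real k) * (t + v)) * iexp (ln J * v))
         - of_real (sqrt (real n)) * iexp (- ln (real n) * (t + v)) / (1/2 - \<i> * of_real (t + v)) * iexp (ln J * v) \<partial>\<gamma>)"
    unfolding zeta_approx_critical_eq[OF n] by (simp add: left_diff_distrib sum_distrib_right)
  also have "\<dots> = dirichlet_smooth n J t - pole_term (ln (real n)) J t"
    using Bochner_Integration.integral_diff[OF J pole_term_eq(1)[OF n, of t J]] pole_term_eq(2)[OF n, of t J] I
    by simp
  finally show ?thesis .
qed

text \<open>The decay in t is the point: the pole matters only for bounded t, where its size is sqrt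
  J. Its mean square is therefore O(J) independently of T.\<close>

lemma pole_term_full:
  assumes J: "J > 0"
  defines "h \<equiv> \<lambda>y. exp (y / 2 - (y - ln J)\<^sup>2 / 2)"
  shows "integrable lborel h"
    "cmod (\<integral>y. h y *\<^sub>R iexp (- t * y) \<partial>lborel) = sqrt J * exp (1/8) * sqrt (2 * pi) * exp (- t\<^sup>2 / 2)"
proof -
  \<comment> \<open>Completing the square: y/2 - (y - ln J)^2/2 = ln J / 2 + 1/8 - (y -
    c)^2/2.\<close>
  define c where "c = ln J + 1/2"
  define K where "K = exp (ln J / 2 + 1/8)"
  have h: "h y = K * exp (- (- c + 1 * y)\<^sup>2 / (2 * 1\<^sup>2))" for y
    by (simp add: h_def K_def c_def exp_add[symmetric] power2_eq_square field_simps)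
  have "integrable lborel (\<lambda>y. exp (- (- c + 1 * y)\<^sup>2 / (2 * 1\<^sup>2)))"
    by (rule lborel_integrable_real_affine[OF integrable_gauss]) auto
  thus "integrable lborel h" unfolding h by (rule integrable_mult_right)
  have "has_bochner_integral lborel (\<lambda>y. exp (- (- c + 1 * y)\<^sup>2 / (2 * 1\<^sup>2)) *\<^sub>R iexp (- t * (- c + 1 * y)))
           (of_real (1 * sqrt (2 * pi) * exp (- (1 * (- t))\<^sup>2 / 2)))"
    using iffD1[OF lborel_has_bochner_integral_real_affine_iff[where c=1 and t="- c"] gauss_fourier[of 1 "- t"]]
    by (simp only: abs_one inverse_1 scaleR_one zero_less_one one_neq_zero not_False_eq_True)
  from has_bochner_integral_mult_right[OF this, of "of_real K * iexp (- t * c)"]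
  have "has_bochner_integral lborel (\<lambda>y. h y *\<^sub>R iexp (- t * y))
     (of_real K * iexp (- t * c) * of_real (sqrt (2 * pi) * exp (- t\<^sup>2 / 2)))"
  proof (rule has_bochner_integral_cong[THEN iffD1, rotated -1])
    fix y
    have "iexp (- t * y) = iexp (- t * c) * iexp (- t * (- c + 1 * y))"
      by (simp add: exp_add[symmetric] algebra_simps)
    thus "of_real K * iexp (- t * c) * (exp (- (- c + 1 * y)\<^sup>2 / (2 * 1\<^sup>2)) *\<^sub>R iexp (- t * (- c + 1 * y))) = h y *\<^sub>R iexp (- t * y)"
      unfolding h by (simp add: scaleR_conv_of_real mult_ac)
  qed auto
  hence "(\<integral>y. h y *\<^sub>R iexp (- t * y) \<partial>lborel) = of_real K * iexp (- t * c) * of_real (sqrt (2 * pi) * exp (- t\<^sup>2 / 2))"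
    by (rule has_bochner_integral_integral_eq)
  moreover have "K = sqrt J * exp (1/8)"
    using J by (simp add: K_def exp_add powr_half_sqrt[symmetric] powr_def)
  ultimately show "cmod (\<integral>y. h y *\<^sub>R iexp (- t * y) \<partial>lborel) = sqrt J * exp (1/8) * sqrt (2 * pi) * exp (- t\<^sup>2 / 2)"
    using J by (simp add: norm_mult)
qed

lemma pole_term_tendsto:
  assumes J: "J > 0"
  shows "(\<lambda>n. pole_term (ln (real n)) J t) \<longlonglongrightarrow> (\<integral>y. exp (y / 2 - (y - ln J)\<^sup>2 / 2) *\<^sub>R iexp (- t * y) \<partial>lborel)"
  unfolding pole_term_def
proof (rule integral_dominated_convergence[where w = "\<lambda>y. exp (y / 2 - (y - ln J)\<^sup>2 / 2)"])
  show "AE y in lborel. (\<lambda>n. indicator {..ln (real n)} y *\<^sub>R (exp (y / 2 - (y - ln J)\<^sup>2 / 2) *\<^sub>R iexp (- t * y)))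
      \<longlonglongrightarrow> exp (y / 2 - (y - ln J)\<^sup>2 / 2) *\<^sub>R iexp (- t * y)"
  proof (intro AE_I2 tendsto_eventually)
    fix y :: real
    have "\<forall>\<^sub>F n in sequentially. ln (real n) \<ge> y"
      using filterlim_compose[OF ln_at_top filterlim_real_sequentially] by (simp add: filterlim_at_top)
    thus "\<forall>\<^sub>F n in sequentially. indicator {..ln (real n)} y *\<^sub>R (exp (y / 2 - (y - ln J)\<^sup>2 / 2) *\<^sub>R iexp (- t * y))
        = exp (y / 2 - (y - ln J)\<^sup>2 / 2) *\<^sub>R iexp (- t * y)"
      by eventually_elim (auto simp: indicator_def)
  qed
qed (use pole_term_full(1)[OF J] in \<open>auto simp: indicator_def\<close>)

lemma integrable_normal_zeta:
  "integrable \<gamma> (\<lambda>v. zeta_abs (t + v))"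
  "integrable \<gamma> (\<lambda>v. 1 + \<bar>t\<bar> + \<bar>v\<bar>)"
proof -
  interpret N: prob_space \<gamma> by (rule prob_space_std_normal)
  have "integrable \<gamma> (\<lambda>v. \<bar>v\<bar>)"
    using integrable_std_normal_moment_abs[of 1] by (subst integrable_density) auto
  thus i: "integrable \<gamma> (\<lambda>v. 1 + \<bar>t\<bar> + \<bar>v\<bar>)" by simp
  obtain K where K: "K > 0" "\<And>t. zeta_abs t \<le> K * (1 + \<bar>t\<bar>)"
    using zeta_approx_bound by metis
  have b: "zeta_abs (t + v) \<le> K * (1 + \<bar>t\<bar> + \<bar>v\<bar>)" for v
    using K(2)[of "t + v"] mult_left_mono[of "1 + \<bar>t + v\<bar>" "1 + \<bar>t\<bar> + \<bar>v\<bar>" K] K(1) by linarith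
  show "integrable \<gamma> (\<lambda>v. zeta_abs (t + v))"
    by (rule Bochner_Integration.integrable_bound[OF integrable_mult_right[OF i, of K]])
       (use b K(1) in \<open>auto simp: abs_mult intro!: AE_I2 order_trans[OF b]\<close>)
qed

text \<open>Dominated convergence removes the truncation from both sides of
  \<open>zeta_approx_gauss_integral\<close>. The twist has modulus 1 and disappears from the
  bound.\<close>

lemma dirichlet_smooth_limit_bound:
  assumes J: "J > 0"
  obtains Dlim where "\<And>t. (\<lambda>n. dirichlet_smooth n J t) \<longlonglongrightarrow> Dlim t"
    "\<And>t. cmod (Dlim t) \<le> (\<integral>v. zeta_abs (t + v) \<partial>\<gamma>)
        + sqrt J * exp (1/8) * sqrt (2 * pi) * exp (- t\<^sup>2 / 2)"
proof -
  obtain K where K: "K > 0" "\<And>n t. cmod (zeta_approx (Suc n) (Complex (1/2) t)) \<le> K * (1 + \<bar>t\<bar>)"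
    using zeta_approx_bound by metis
  define V where "V = (\<lambda>t. \<integral>v. riemann_zeta (Complex (1/2) (t + v)) * iexp (ln J * v) \<partial>\<gamma>)"
  define R where "R = (\<lambda>t. \<integral>y. exp (y / 2 - (y - ln J)\<^sup>2 / 2) *\<^sub>R iexp (- t * y) \<partial>lborel)"
  have V: "(\<lambda>n. \<integral>v. zeta_approx (Suc n) (Complex (1/2) (t + v)) * iexp (ln J * v) \<partial>\<gamma>) \<longlonglongrightarrow> V t" for t
    unfolding V_def
  proof (rule integral_dominated_convergence[where w = "\<lambda>v. K * (1 + \<bar>t\<bar> + \<bar>v\<bar>)"])
    have m: "(\<lambda>v. zeta_approx (Suc n) (Complex (1/2) (t + v))) \<in> borel_measurable borel" for n
      by (rule measurable_compose[OF _ zeta_approx_measurable]) auto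
    show "(\<lambda>v. zeta_approx (Suc n) (Complex (1/2) (t + v)) * iexp (ln J * v)) \<in> borel_measurable \<gamma>" for n
      using m[of n] by measurable
    show "(\<lambda>v. riemann_zeta (Complex (1/2) (t + v)) * iexp (ln J * v)) \<in> borel_measurable \<gamma>"
      by measurable
    show "integrable \<gamma> (\<lambda>v. K * (1 + \<bar>t\<bar> + \<bar>v\<bar>))"
      by (intro integrable_mult_right integrable_normal_zeta)
    show "AE v in \<gamma>. (\<lambda>n. zeta_approx (Suc n) (Complex (1/2) (t + v)) * iexp (ln J * v))
        \<longlonglongrightarrow> riemann_zeta (Complex (1/2) (t + v)) * iexp (ln J * v)"
      by (intro AE_I2 tendsto_mult LIMSEQ_Suc[OF zeta_approx_tendsto_zeta] tendsto_const)
    have "cmod (zeta_approx (Suc n) (Complex (1/2) (t + v))) \<le> K * (1 + \<bar>t\<bar> + \<bar>v\<bar>)" for n v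
      using K(2)[of n "t + v"] mult_left_mono[of "1 + \<bar>t + v\<bar>" "1 + \<bar>t\<bar> + \<bar>v\<bar>" K] K(1) by linarith
    thus "AE v in \<gamma>. cmod (zeta_approx (Suc n) (Complex (1/2) (t + v)) * iexp (ln J * v)) \<le> K * (1 + \<bar>t\<bar> + \<bar>v\<bar>)" for n
      by (simp add: norm_mult)
  qed
  have "(\<lambda>n. dirichlet_smooth (Suc n) J t) \<longlonglongrightarrow> V t + R t" for t
  proof -
    have "(\<lambda>n. dirichlet_smooth (Suc n) J t - pole_term (ln (real (Suc n))) J t) \<longlonglongrightarrow> V t"
      using V[of t] zeta_approx_gauss_integral[of "Suc n" t J for n] by simp
    hence "(\<lambda>n. (dirichlet_smooth (Suc n) J t - pole_term (ln (real (Suc n))) J t) + pole_term (ln (real (Suc n))) J t) \<longlonglongrightarrow> V t + R t"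
      unfolding R_def by (rule tendsto_add[OF _ LIMSEQ_Suc[OF pole_term_tendsto[OF J, of t]]])
    thus ?thesis by simp
  qed
  hence "(\<lambda>n. dirichlet_smooth n J t) \<longlonglongrightarrow> V t + R t" for t
    by (subst (asm) filterlim_sequentially_Suc)
  moreover have "cmod (V t + R t) \<le> (\<integral>v. zeta_abs (t + v) \<partial>\<gamma>)
        + sqrt J * exp (1/8) * sqrt (2 * pi) * exp (- t\<^sup>2 / 2)" for t
  proof -
    have "cmod (V t) \<le> (\<integral>v. cmod (riemann_zeta (Complex (1/2) (t + v)) * iexp (ln J * v)) \<partial>\<gamma>)"
      unfolding V_def by (rule integral_norm_bound)
    hence "cmod (V t) \<le> (\<integral>v. zeta_abs (t + v) \<partial>\<gamma>)"
      by (simp add: norm_mult)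
    moreover have "cmod (R t) = sqrt J * exp (1/8) * sqrt (2 * pi) * exp (- t\<^sup>2 / 2)"
      unfolding R_def by (rule pole_term_full(2)[OF J])
    ultimately show ?thesis using norm_triangle_ineq[of "V t" "R t"] by linarith
  qed
  ultimately show ?thesis using that[of "\<lambda>t. V t + R t"] by blast
qed

section \<open>Truncation uniform in t\<close>

lemma summable_log_gauss:
  assumes J: "J > 0"
  shows "summable (\<lambda>k. log_gauss J (real k))"
proof (rule summable_comparison_test'[where N = 1])
  show "summable (\<lambda>k. exp (2 * ln J + 2) * real k powr (-2))"
    by (intro summable_mult) (subst summable_real_powr_iff, simp)
  fix k :: nat assume k: "k \<ge> 1"
  \<comment> \<open>Expanding (ln k - ln J - 2)^2 >= 0 trades the Gaussian for the power
    k^(-2).\<close>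
  have "- (ln (real k) - ln J)\<^sup>2 / 2 \<le> - 2 * ln (real k) + (2 * ln J + 2)"
  proof -
    have "(- 2 * ln (real k) + (2 * ln J + 2)) - (- (ln (real k) - ln J)\<^sup>2 / 2) = (ln (real k) - ln J - 2)\<^sup>2 / 2"
      by (simp add: power2_eq_square field_simps)
    thus ?thesis using zero_le_power2[of "ln (real k) - ln J - 2"] by linarith
  qed
  hence "exp (- (ln (real k) - ln J)\<^sup>2 / 2) \<le> exp (2 * ln J + 2) * real k powr (-2)"
    using k by (simp add: powr_def exp_add[symmetric] add.commute)
  moreover have "real k powr (-1/2) \<le> 1"
    using k powr_mono[of "-1/2" 0 "real k"] by simp
  ultimately show "norm (log_gauss J (real k)) \<le> exp (2 * ln J + 2) * real k powr (-2)"
    using mult_mono[of "real k powr (-1/2)" 1 "exp (- (ln (real k) - ln J)\<^sup>2 / 2)" "exp (2 * ln J + 2) * real k powr (-2)"]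
    by (simp add: log_gauss_def)
qed

text \<open>One n has to serve all t, since the bound will be integrated. It exists because the tail
  is dominated by the tail of the nonnegative weights, which do not involve t. The lower bound n0
  guarantees that a whole dyadic block lies inside the sum.\<close>

lemma dirichlet_smooth_bound:
  assumes J: "J > 0" and \<delta>: "\<delta> > 0"
  obtains n where "n \<ge> n0" "\<And>t. cmod (dirichlet_smooth n J t) \<le> (\<integral>v. zeta_abs (t + v) \<partial>\<gamma>)
        + sqrt J * exp (1/8) * sqrt (2 * pi) * exp (- t\<^sup>2 / 2) + \<delta>"
proof -
  from summable_log_gauss[OF J, unfolded summable_Cauchy] \<delta> obtain N where
    N: "\<And>m n. m \<ge> N \<Longrightarrow> norm (\<Sum>k=m..<n. log_gauss J (real k)) < \<delta>" by blast
  define n where "n = max N n0"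
  obtain Dlim where D: "\<And>t. (\<lambda>n. dirichlet_smooth n J t) \<longlonglongrightarrow> Dlim t"
    "\<And>t. cmod (Dlim t) \<le> (\<integral>v. zeta_abs (t + v) \<partial>\<gamma>)
        + sqrt J * exp (1/8) * sqrt (2 * pi) * exp (- t\<^sup>2 / 2)" using dirichlet_smooth_limit_bound[OF J] by metis
  have "cmod (dirichlet_smooth m J t - dirichlet_smooth n J t) \<le> \<delta>" if "m \<ge> n" for m t
  proof -
    have "{1..m} = {1..n} \<union> {Suc n..<Suc m}" "{1..n} \<inter> {Suc n..<Suc m} = {}" using that by auto
    hence "dirichlet_smooth m J t - dirichlet_smooth n J t = (\<Sum>k=Suc n..<Suc m. of_real (log_gauss J (real k)) * iexp (- ln (real k) * t))"
      unfolding dirichlet_smooth_def by (simp add: sum.union_disjoint)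
    also have "cmod \<dots> \<le> (\<Sum>k=Suc n..<Suc m. log_gauss J (real k))"
      by (rule sum_norm_le) (simp add: norm_mult log_gauss_def)
    also have "\<dots> \<le> \<delta>" using N[of "Suc n" "Suc m"] n_def unfolding real_norm_def by linarith
    finally show ?thesis .
  qed
  hence "cmod (Dlim t - dirichlet_smooth n J t) \<le> \<delta>" for t
    by (intro LIMSEQ_le_const2[OF tendsto_norm[OF tendsto_diff[OF D(1) tendsto_const]]]) auto
  hence "cmod (dirichlet_smooth n J t) \<le> cmod (Dlim t) + \<delta>" for t
    using norm_triangle_ineq4[of "Dlim t" "Dlim t - dirichlet_smooth n J t"] by (smt (verit) diff_diff_eq2 add_diff_cancel_left')
  hence "cmod (dirichlet_smooth n J t) \<le> (\<integral>v. zeta_abs (t + v) \<partial>\<gamma>)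
        + sqrt J * exp (1/8) * sqrt (2 * pi) * exp (- t\<^sup>2 / 2) + \<delta>" for t
    using D(2)[of t] by (smt (verit))
  thus ?thesis using that[of n] by (simp add: n_def)
qed

subsection \<open>Gaussian-weighted moments of zeta\<close>

text \<open>Moments are given on [0, T] only, whereas Gaussian averages see both signs of t.\<close>

lemma zeta_critical_uminus:
  "riemann_zeta (Complex (1/2) (- t)) = cnj (riemann_zeta (Complex (1/2) t))"
proof -
  have "cnj (1/2 - \<i> * of_real t) = 1/2 - \<i> * of_real (- t)" by (simp add: complex_eq_iff)
  hence "zeta_approx (Suc n) (Complex (1/2) (- t)) = cnj (zeta_approx (Suc n) (Complex (1/2) t))" for n
    by (simp add: zeta_approx_critical_eq cnj_sum exp_cnj del: of_nat_Suc sum.cl_ivl_Suc)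
  hence "(\<lambda>n. cnj (zeta_approx (Suc n) (Complex (1/2) t))) \<longlonglongrightarrow> riemann_zeta (Complex (1/2) (- t))"
    using LIMSEQ_Suc[OF zeta_approx_tendsto_zeta[of "- t"]] by simp
  moreover have "(\<lambda>n. cnj (zeta_approx (Suc n) (Complex (1/2) t))) \<longlonglongrightarrow> cnj (riemann_zeta (Complex (1/2) t))"
    by (intro tendsto_cnj LIMSEQ_Suc[OF zeta_approx_tendsto_zeta])
  ultimately show ?thesis by (rule LIMSEQ_unique)
qed

lemma zeta_moment_nn_integral:
  fixes \<kappa> :: real
  assumes \<kappa>: "\<kappa> \<ge> 0" and T: "T \<ge> 0"
  shows "(\<integral>\<^sup>+u. ennreal (zeta_abs u powr \<kappa>) * indicator {-T..T} u \<partial>lborel)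
     \<le> ennreal (2 * integral {0..T} (\<lambda>t. zeta_abs t powr \<kappa>))"
proof -
  define f where "f = (\<lambda>t. zeta_abs t powr \<kappa>)"
  have [measurable]: "f \<in> borel_measurable borel" unfolding f_def by measurable
  obtain K where K: "K > 0" "\<And>t. zeta_abs t \<le> K * (1 + \<bar>t\<bar>)"
    using zeta_approx_bound by metis
  have "set_integrable lborel {0..T} f"
    unfolding set_integrable_def
  proof (rule integrableI_bounded_set_indicator[where B = "(K * (1 + T)) powr \<kappa>"])
    have "norm (f u) \<le> (K * (1 + T)) powr \<kappa>" if "u \<in> {0..T}" for u
      using that K order_trans[OF K(2)[of u], of "K * (1 + T)"] \<kappa> by (auto simp: f_def intro!: powr_mono2)
    thus "AE u in lborel. u \<in> {0..T} \<longrightarrow> norm (f u) \<le> (K * (1 + T)) powr \<kappa>" by auto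
  qed (use T in auto)
  from set_borel_integral_eq_integral[OF this] this have I: "integral {0..T} f = (LINT u:{0..T}|lborel. f u)"
    "integrable lborel (\<lambda>u. indicator {0..T} u *\<^sub>R f u)"
    by (auto simp: set_integrable_def)
  have pos: "(\<integral>\<^sup>+u. ennreal (f u) * indicator {0..T} u \<partial>lborel) = ennreal (integral {0..T} f)"
    unfolding I(1) set_lebesgue_integral_def
    by (subst nn_integral_eq_integral[OF I(2), symmetric]) (auto simp: f_def indicator_def intro!: nn_integral_cong)
  have "(\<integral>\<^sup>+u. ennreal (f u) * indicator {-T..0} u \<partial>lborel) = (\<integral>\<^sup>+u. ennreal (f (0 + (-1) * u)) * indicator {-T..0} (0 + (-1) * u) \<partial>lborel)"
    by (subst nn_integral_real_affine[where c="-1" and t=0]) auto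
  also have "\<dots> = (\<integral>\<^sup>+u. ennreal (f u) * indicator {0..T} u \<partial>lborel)"
    by (intro nn_integral_cong) (auto simp: f_def zeta_critical_uminus indicator_def)
  finally have neg: "(\<integral>\<^sup>+u. ennreal (f u) * indicator {-T..0} u \<partial>lborel) = ennreal (integral {0..T} f)"
    using pos by simp
  have "(\<integral>\<^sup>+u. ennreal (f u) * indicator {-T..T} u \<partial>lborel) 
     \<le> (\<integral>\<^sup>+u. ennreal (f u) * indicator {-T..0} u + ennreal (f u) * indicator {0..T} u \<partial>lborel)"
    by (intro nn_integral_mono) (auto simp: indicator_def)
  also have "\<dots> = ennreal (integral {0..T} f) + ennreal (integral {0..T} f)"
    by (subst nn_integral_add) (auto simp: pos neg)
  also have "\<dots> = ennreal (2 * integral {0..T} f)"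
  proof -
    have "integral {0..T} f \<ge> 0"
      unfolding I(1) set_lebesgue_integral_def by (intro integral_nonneg_AE) (auto simp: f_def)
    thus ?thesis by (subst ennreal_plus[symmetric]) auto
  qed
  finally show ?thesis unfolding f_def .
qed

text \<open>Cut the line into shells iT <= |u| < (i+1)T. The weight, at most exp (-i^2/4) on the
  i-th shell, beats the growth (i+1)^a of the moments, so only a constant is lost.\<close>

lemma gauss_weighted_zeta_moment:
  fixes \<kappa> a :: real
  assumes \<kappa>: "\<kappa> \<ge> 0"
    and mom: "\<And>T. T \<ge> T0 \<Longrightarrow> integral {0..T} (\<lambda>t. zeta_abs t powr \<kappa>) \<le> C * T powr a"
    and C: "C \<ge> 0" and T0: "T0 > 0"
  obtains C' where "C' \<ge> 0"
    "\<And>T. T \<ge> T0 \<Longrightarrow> (\<integral>\<^sup>+u. ennreal (exp (- u\<^sup>2 / (4 * T\<^sup>2)) * zeta_abs u powr \<kappa>) \<partial>lborel)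
        \<le> ennreal (C' * T powr a)"
proof -
  define f where "f = (\<lambda>t. zeta_abs t powr \<kappa>)"
  have [measurable]: "f \<in> borel_measurable borel" unfolding f_def by measurable
  have f0: "f u \<ge> 0" for u by (simp add: f_def)
  define b where "b = (\<lambda>i. exp (- (real i)\<^sup>2 / 4) * (real i + 1) powr a)"
  have "b \<in> O(\<lambda>i. 1 / real i ^ 2)" unfolding b_def by real_asymp
  moreover have "summable (\<lambda>i. norm (1 / real i ^ 2))"
    using inverse_power_summable[of 2, where 'a=real] by (simp add: field_simps)
  ultimately have sb: "summable b" by (rule summable_comparison_test_bigo[rotated])
  have b0: "b i \<ge> 0" for i by (simp add: b_def)
  have "(\<integral>\<^sup>+u. ennreal (exp (- u\<^sup>2 / (4 * T\<^sup>2)) * f u) \<partial>lborel) \<le> ennreal (2 * C * suminf b * T powr a)" if T: "T \<ge> T0" for T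
  proof -
    from T T0 have T': "T > 0" by simp
    define g where "g = (\<lambda>i u. ennreal (exp (- (real i)\<^sup>2 / 4)) * (ennreal (f u) * indicator {- ((real i + 1) * T)..(real i + 1) * T} u))"
    have "ennreal (exp (- u\<^sup>2 / (4 * T\<^sup>2)) * f u) \<le> (\<Sum>i. g i u)" for u
    proof -
      define i where "i = nat \<lfloor>\<bar>u\<bar> / T\<rfloor>"
      have "real i \<le> \<bar>u\<bar> / T" "\<bar>u\<bar> / T < real i + 1"
        using T' by (auto simp: i_def of_nat_nat)
      hence i: "real i * T \<le> \<bar>u\<bar>" "\<bar>u\<bar> < (real i + 1) * T"
        using T' by (auto simp: field_simps)
      hence "(real i * T)\<^sup>2 \<le> u\<^sup>2" using T' by (metis abs_le_square_iff abs_of_nonneg mult_nonneg_nonneg of_nat_0_le_iff less_imp_le)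
      hence "- u\<^sup>2 / (4 * T\<^sup>2) \<le> - (real i)\<^sup>2 / 4" using T' by (simp add: field_simps power_mult_distrib)
      hence "exp (- u\<^sup>2 / (4 * T\<^sup>2)) * f u \<le> exp (- (real i)\<^sup>2 / 4) * f u"
        using f0 by (intro mult_right_mono) auto
      hence "ennreal (exp (- u\<^sup>2 / (4 * T\<^sup>2)) * f u) \<le> g i u"
        unfolding g_def using i f0[of u] by (auto simp: indicator_def abs_le_iff abs_less_iff ennreal_mult'[symmetric] ennreal_leI)
      also have "g i u \<le> (\<Sum>i. g i u)"
        using sum_le_suminf[of "\<lambda>i. g i u" "{i}"] by simp
      finally show ?thesis .
    qed
    hence "(\<integral>\<^sup>+u. ennreal (exp (- u\<^sup>2 / (4 * T\<^sup>2)) * f u) \<partial>lborel) \<le> (\<integral>\<^sup>+u. (\<Sum>i. g i u) \<partial>lborel)"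
      by (intro nn_integral_mono)
    also have "\<dots> = (\<Sum>i. \<integral>\<^sup>+u. g i u \<partial>lborel)"
      by (intro nn_integral_suminf) (auto simp: g_def)
    also have "\<dots> \<le> (\<Sum>i. ennreal (2 * C * T powr a * b i))"
    proof (intro suminf_le summableI)
      fix i
      have "(\<integral>\<^sup>+u. g i u \<partial>lborel) = ennreal (exp (- (real i)\<^sup>2 / 4)) * (\<integral>\<^sup>+u. ennreal (f u) * indicator {- ((real i + 1) * T)..(real i + 1) * T} u \<partial>lborel)"
        unfolding g_def by (subst nn_integral_cmult) auto
      also have "\<dots> \<le> ennreal (exp (- (real i)\<^sup>2 / 4)) * ennreal (2 * integral {0..(real i + 1) * T} f)"
        using zeta_moment_nn_integral[OF \<kappa>, of "(real i + 1) * T"] T' by (intro mult_left_mono) (auto simp: f_def)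
      also have "\<dots> \<le> ennreal (exp (- (real i)\<^sup>2 / 4)) * ennreal (2 * (C * ((real i + 1) * T) powr a))"
      proof (intro mult_left_mono ennreal_leI)
        have "1 * T \<le> (real i + 1) * T" using T' by (intro mult_right_mono) auto
        hence "T0 \<le> (real i + 1) * T" using T by simp
        thus "integral {0..(real i + 1) * T} f \<le> C * ((real i + 1) * T) powr a"
          using mom unfolding f_def by blast
      qed auto
      also have "\<dots> = ennreal (2 * C * T powr a * b i)"
        using T' C by (simp add: b_def powr_mult ennreal_mult'[symmetric] mult_ac)
      finally show "(\<integral>\<^sup>+u. g i u \<partial>lborel) \<le> ennreal (2 * C * T powr a * b i)" .
    qed
    also have "\<dots> = ennreal (\<Sum>i. 2 * C * T powr a * b i)"
      using C b0 sb by (intro suminf_ennreal2 summable_mult) auto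
    also have "(\<Sum>i. 2 * C * T powr a * b i) = 2 * C * suminf b * T powr a"
      using suminf_mult[OF sb] by simp
    finally show ?thesis .
  qed
  moreover have "2 * C * suminf b \<ge> 0" using C suminf_nonneg[OF sb] b0 by simp
  ultimately show ?thesis using that unfolding f_def by blast
qed

text \<open>After exchanging the integrals, the shift by v is absorbed by doubling the variance of
  the weight, at the price of exp (v^2 / 4), whose normal expectation is sqrt 2.\<close>

lemma gauss_smoothed_zeta_moment:
  fixes f :: "real \<Rightarrow> real"
  assumes [measurable]: "f \<in> borel_measurable borel" and f0: "\<And>u. f u \<ge> 0" and T: "T\<^sup>2 \<ge> 2"
  shows "(\<integral>\<^sup>+t. ennreal (exp (- t\<^sup>2 / (2 * T\<^sup>2))) * (\<integral>\<^sup>+v. ennreal (f (t + v)) \<partial>\<gamma>) \<partial>lborel)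
     \<le> ennreal (sqrt 2) * (\<integral>\<^sup>+u. ennreal (exp (- u\<^sup>2 / (4 * T\<^sup>2)) * f u) \<partial>lborel)"
proof -
  interpret N: prob_space \<gamma> by (rule prob_space_std_normal)
  interpret P: pair_sigma_finite lborel \<gamma>
    by (intro pair_sigma_finite.intro) unfold_locales
  define W where "W = (\<integral>\<^sup>+u. ennreal (exp (- u\<^sup>2 / (4 * T\<^sup>2)) * f u) \<partial>lborel)"
  have "(\<integral>\<^sup>+t. ennreal (exp (- t\<^sup>2 / (2 * T\<^sup>2))) * (\<integral>\<^sup>+v. ennreal (f (t + v)) \<partial>\<gamma>) \<partial>lborel)
    = (\<integral>\<^sup>+t. (\<integral>\<^sup>+v. ennreal (exp (- t\<^sup>2 / (2 * T\<^sup>2))) * ennreal (f (t + v)) \<partial>\<gamma>) \<partial>lborel)"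
    by (subst nn_integral_cmult) auto
  also have "\<dots> = (\<integral>\<^sup>+v. (\<integral>\<^sup>+t. ennreal (exp (- t\<^sup>2 / (2 * T\<^sup>2))) * ennreal (f (t + v)) \<partial>lborel) \<partial>\<gamma>)"
    by (rule P.Fubini'[symmetric]) measurable
  also have "\<dots> \<le> (\<integral>\<^sup>+v. ennreal (exp (v\<^sup>2 / 4)) * W \<partial>\<gamma>)"
  proof (intro nn_integral_mono)
    fix v
    have "(\<integral>\<^sup>+t. ennreal (exp (- t\<^sup>2 / (2 * T\<^sup>2))) * ennreal (f (t + v)) \<partial>lborel)
      = (\<integral>\<^sup>+u. ennreal (exp (- (- v + 1 * u)\<^sup>2 / (2 * T\<^sup>2))) * ennreal (f ((- v + 1 * u) + v)) \<partial>lborel)"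
      by (subst nn_integral_real_affine[where c=1 and t="- v"]) auto
    also have "\<dots> \<le> (\<integral>\<^sup>+u. ennreal (exp (v\<^sup>2 / 4)) * ennreal (exp (- u\<^sup>2 / (4 * T\<^sup>2)) * f u) \<partial>lborel)"
    proof (intro nn_integral_mono)
      fix u
      \<comment> \<open>This square yields (u - v)^2 >= u^2/2 - v^2; the assumption T^2 >= 2 then
        turns v^2/(2T^2) into v^2/4.\<close>
      have "0 \<le> (u - 2 * v)\<^sup>2" by simp
      hence "u\<^sup>2 / 2 - v\<^sup>2 \<le> (- v + 1 * u)\<^sup>2" by (simp add: power2_eq_square algebra_simps)
      hence "- (- v + 1 * u)\<^sup>2 / (2 * T\<^sup>2) \<le> (v\<^sup>2 - u\<^sup>2 / 2) / (2 * T\<^sup>2)"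
        by (intro divide_right_mono) auto
      also have "\<dots> = v\<^sup>2 / (2 * T\<^sup>2) + - u\<^sup>2 / (4 * T\<^sup>2)" by (simp add: diff_divide_distrib)
      also have "v\<^sup>2 / (2 * T\<^sup>2) \<le> v\<^sup>2 / 4" using T by (intro divide_left_mono) auto
      finally have "exp (- (- v + 1 * u)\<^sup>2 / (2 * T\<^sup>2)) \<le> exp (v\<^sup>2 / 4) * exp (- u\<^sup>2 / (4 * T\<^sup>2))"
        by (simp add: exp_add[symmetric])
      from mult_right_mono[OF this f0[of u]]
      show "ennreal (exp (- (- v + 1 * u)\<^sup>2 / (2 * T\<^sup>2))) * ennreal (f ((- v + 1 * u) + v)) \<le> ennreal (exp (v\<^sup>2 / 4)) * ennreal (exp (- u\<^sup>2 / (4 * T\<^sup>2)) * f u)"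
        using f0[of u] by (simp add: ennreal_mult'[symmetric] ennreal_leI mult_ac)
    qed
    also have "\<dots> = ennreal (exp (v\<^sup>2 / 4)) * W"
      unfolding W_def by (subst nn_integral_cmult) auto
    finally show "(\<integral>\<^sup>+t. ennreal (exp (- t\<^sup>2 / (2 * T\<^sup>2))) * ennreal (f (t + v)) \<partial>lborel) \<le> ennreal (exp (v\<^sup>2 / 4)) * W" .
  qed
  also have "\<dots> = (\<integral>\<^sup>+v. ennreal (exp (v\<^sup>2 / 4)) \<partial>\<gamma>) * W"
    by (subst nn_integral_multc) auto
  also have "(\<integral>\<^sup>+v. ennreal (exp (v\<^sup>2 / 4)) \<partial>\<gamma>) = ennreal (sqrt 2)"
  proof -
    have eq: "std_normal_density v * exp (v\<^sup>2 / 4) = 1 / sqrt (2 * pi) * exp (- v\<^sup>2 / (2 * (sqrt 2)\<^sup>2))" for v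
      by (simp add: normal_density_def exp_add[symmetric])
    have "(\<integral>\<^sup>+v. ennreal (exp (v\<^sup>2 / 4)) \<partial>\<gamma>) = (\<integral>\<^sup>+v. ennreal (std_normal_density v * exp (v\<^sup>2 / 4)) \<partial>lborel)"
      by (subst nn_integral_density) (auto simp: ennreal_mult'[symmetric])
    also have "\<dots> = ennreal (\<integral>v. 1 / sqrt (2 * pi) * exp (- v\<^sup>2 / (2 * (sqrt 2)\<^sup>2)) \<partial>lborel)"
      unfolding eq by (intro nn_integral_eq_integral integrable_mult_right integrable_gauss) auto
    also have "(\<integral>v. 1 / sqrt (2 * pi) * exp (- v\<^sup>2 / (2 * (sqrt 2)\<^sup>2)) \<partial>lborel) = sqrt 2"
      by (subst Bochner_Integration.integral_mult_right_zero, subst integral_gauss) auto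
    finally show ?thesis .
  qed
  finally show ?thesis unfolding W_def .
qed

subsection \<open>The resonance sum\<close>

lemma sum_int_geometric_le:
  fixes q :: real
  assumes q: "0 < q" "q < 1" and fin: "finite I"
  shows "(\<Sum>l\<in>I. q ^ nat \<bar>l - l0\<bar>) \<le> 2 / (1 - q)"
proof -
  define N where "N = Suc (Max (insert 0 ((\<lambda>l. nat \<bar>l - l0\<bar>) ` I)))"
  have N: "nat \<bar>l - l0\<bar> < N" if "l \<in> I" for l
    using that fin by (auto simp: N_def less_Suc_eq_le intro!: Max_ge)
  have geo: "(\<Sum>n<N. q ^ n) \<le> 1 / (1 - q)"
    using sum_le_suminf[OF summable_geometric[of q], of "{..<N}"] suminf_geometric[of q] q by simp
  have "(\<Sum>l\<in>I. q ^ nat \<bar>l - l0\<bar>) \<le> (\<Sum>l\<in>(\<lambda>n. l0 + int n) ` {..<N} \<union> (\<lambda>n. l0 - int n) ` {..<N}. q ^ nat \<bar>l - l0\<bar>)"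
  proof (rule sum_mono2)
    show "I \<subseteq> (\<lambda>n. l0 + int n) ` {..<N} \<union> (\<lambda>n. l0 - int n) ` {..<N}"
    proof
      fix l assume l: "l \<in> I"
      show "l \<in> (\<lambda>n. l0 + int n) ` {..<N} \<union> (\<lambda>n. l0 - int n) ` {..<N}"
      proof (cases "l \<ge> l0")
        case True
        hence "l = l0 + int (nat \<bar>l - l0\<bar>)" by simp
        thus ?thesis using N[OF l] by blast
      next
        case False
        hence "l = l0 - int (nat \<bar>l - l0\<bar>)" by simp
        thus ?thesis using N[OF l] by blast
      qed
    qed
  qed (use q in auto)
  also have "\<dots> \<le> (\<Sum>l\<in>(\<lambda>n. l0 + int n) ` {..<N}. q ^ nat \<bar>l - l0\<bar>) + (\<Sum>l\<in>(\<lambda>n. l0 - int n) ` {..<N}. q ^ nat \<bar>l - l0\<bar>)"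
    using q by (subst sum.union_inter[symmetric]) (auto intro!: sum_nonneg)
  also have "\<dots> = 2 * (\<Sum>n<N. q ^ n)"
    by (subst sum.reindex, force simp: inj_on_def, subst sum.reindex) (auto simp: inj_on_def)
  also have "\<dots> \<le> 2 / (1 - q)" using geo by simp
  finally show ?thesis .
qed

text \<open>Schur test: a product of coefficients is at most the mean of their squares, and each row
  of the kernel is dominated by a two-sided geometric series of ratio exp (-1/2), because the square
  of an integer is at least its modulus.\<close>

lemma sum_gauss_shifts_le:
  assumes fin: "finite I" and c: "\<And>l. l \<in> I \<Longrightarrow> c l \<ge> (0::real)"
  shows "(\<Sum>l\<in>I. \<Sum>l'\<in>I. c l * c l' * exp (- (real_of_int (l - l'))\<^sup>2 / 2)) \<le> 2 / (1 - exp (- 1 / 2)) * (\<Sum>l\<in>I. (c l)\<^sup>2)"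
proof -
  define e where "e = (\<lambda>l l'. exp (- (real_of_int (l - l'))\<^sup>2 / 2))"
  have e0: "e l l' \<ge> 0" for l l' by (simp add: e_def)
  have sym: "e l l' = e l' l" for l l' by (simp add: e_def power2_commute)
  have bound: "(\<Sum>l'\<in>I. e l l') \<le> 2 / (1 - exp (- 1 / 2))" for l
  proof -
    have "e l l' \<le> exp (- 1 / 2) ^ nat \<bar>l' - l\<bar>" for l'
    proof -
      have "\<bar>l' - l\<bar> \<le> \<bar>l' - l\<bar> * \<bar>l' - l\<bar>"
        using mult_left_mono[of 1 "\<bar>l' - l\<bar>" "\<bar>l' - l\<bar>"] by (cases "l' = l") auto
      hence "\<bar>l' - l\<bar> \<le> (l - l')\<^sup>2" by (simp add: power2_eq_square abs_mult_self_eq algebra_simps)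
      hence "real_of_int \<bar>l' - l\<bar> \<le> (real_of_int (l - l'))\<^sup>2"
        by (subst of_int_power[symmetric], subst of_int_le_iff)
      thus ?thesis by (simp add: e_def exp_of_nat_mult[symmetric] of_nat_nat)
    qed
    hence "(\<Sum>l'\<in>I. e l l') \<le> (\<Sum>l'\<in>I. exp (- 1 / 2) ^ nat \<bar>l' - l\<bar>)" by (intro sum_mono)
    also have "\<dots> \<le> 2 / (1 - exp (- 1 / 2))" by (intro sum_int_geometric_le fin) auto
    finally show ?thesis .
  qed
  have "(\<Sum>l\<in>I. \<Sum>l'\<in>I. c l * c l' * e l l') \<le> (\<Sum>l\<in>I. \<Sum>l'\<in>I. ((c l)\<^sup>2 + (c l')\<^sup>2) / 2 * e l l')"
  proof (intro sum_mono mult_right_mono e0)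
    fix l l'
    show "c l * c l' \<le> ((c l)\<^sup>2 + (c l')\<^sup>2) / 2"
      using sum_squares_bound[of "c l" "c l'"] by simp
  qed
  also have "\<dots> = (\<Sum>l\<in>I. \<Sum>l'\<in>I. (c l)\<^sup>2 / 2 * e l l') + (\<Sum>l\<in>I. \<Sum>l'\<in>I. (c l')\<^sup>2 / 2 * e l l')"
    by (simp add: add_divide_distrib distrib_right sum.distrib)
  also have "(\<Sum>l\<in>I. \<Sum>l'\<in>I. (c l')\<^sup>2 / 2 * e l l') = (\<Sum>l\<in>I. \<Sum>l'\<in>I. (c l)\<^sup>2 / 2 * e l l')"
    by (subst sum.swap) (simp add: sym)
  also have "(\<Sum>l\<in>I. \<Sum>l'\<in>I. (c l)\<^sup>2 / 2 * e l l') + (\<Sum>l\<in>I. \<Sum>l'\<in>I. (c l)\<^sup>2 / 2 * e l l') = (\<Sum>l\<in>I. (c l)\<^sup>2 * (\<Sum>l'\<in>I. e l l'))"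
    unfolding sum_distrib_left sum.distrib[symmetric] by (intro sum.cong refl) (simp add: field_simps)
  also have "\<dots> \<le> (\<Sum>l\<in>I. (c l)\<^sup>2 * (2 / (1 - exp (- 1 / 2))))"
    by (intro sum_mono mult_left_mono bound) auto
  finally show ?thesis unfolding e_def sum_distrib_right[symmetric] by (simp only: mult.commute)
qed

text \<open>Jensen moves the square inside the mean, and where z > A one has z^2 <= A^(2-\<kappa>) *
  z^\<kappa> because \<kappa> > 2. The threshold A stays free for the final balance.\<close>

lemma zeta_smoothed_square_le:
  assumes \<kappa>: "\<kappa> > 2" and A: "A > 0"
  shows "ennreal ((\<integral>v. zeta_abs (t + v) \<partial>\<gamma>)\<^sup>2)
    \<le> ennreal (A\<^sup>2) + ennreal (A powr (2 - \<kappa>)) * (\<integral>\<^sup>+v. ennreal (zeta_abs (t + v) powr \<kappa>) \<partial>\<gamma>)"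
proof -
  interpret N: prob_space \<gamma> by (rule prob_space_std_normal)
  define z where "z = (\<lambda>v. zeta_abs (t + v))"
  have [measurable]: "z \<in> borel_measurable borel" unfolding z_def by measurable
  have z0: "z v \<ge> 0" for v by (simp add: z_def)
  have pw: "(z v)\<^sup>2 \<le> A\<^sup>2 + A powr (2 - \<kappa>) * z v powr \<kappa>" for v
  proof (cases "z v \<le> A")
    case True
    hence "(z v)\<^sup>2 \<le> A\<^sup>2" using z0 by (intro power_mono) auto
    thus ?thesis by (simp add: add_increasing2)
  next
    case False
    hence zA: "z v > A" "z v > 0" using A by auto
    have "(z v)\<^sup>2 = z v powr (2 - \<kappa>) * z v powr \<kappa>"
      using zA by (simp add: powr_add[symmetric] powr_numeral)
    also have "\<dots> \<le> A powr (2 - \<kappa>) * z v powr \<kappa>"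
      using zA A \<kappa> by (intro mult_right_mono powr_mono2') auto
    finally show ?thesis by (simp add: add_increasing)
  qed
  obtain K where K: "K > 0" "\<And>t. zeta_abs t \<le> K * (1 + \<bar>t\<bar>)"
    using zeta_approx_bound by metis
  have b: "z v \<le> K * (1 + \<bar>t\<bar> + \<bar>v\<bar>)" for v
    unfolding z_def using K(2)[of "t + v"] mult_left_mono[of "1 + \<bar>t + v\<bar>" "1 + \<bar>t\<bar> + \<bar>v\<bar>" K] K(1) by linarith
  have "integrable \<gamma> (\<lambda>v. \<bar>v\<bar>)" "integrable \<gamma> (\<lambda>v. v\<^sup>2)"
    using integrable_std_normal_moment_abs[of 1] integrable_std_normal_moment[of 2] by (subst integrable_density; auto)+
  hence "integrable \<gamma> (\<lambda>v. (K * (1 + \<bar>t\<bar>))\<^sup>2 + 2 * K\<^sup>2 * (1 + \<bar>t\<bar>) * \<bar>v\<bar> + K\<^sup>2 * v\<^sup>2)"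
    by (intro Bochner_Integration.integrable_add integrable_mult_right) auto
  also have "(\<lambda>v. (K * (1 + \<bar>t\<bar>))\<^sup>2 + 2 * K\<^sup>2 * (1 + \<bar>t\<bar>) * \<bar>v\<bar> + K\<^sup>2 * v\<^sup>2) = (\<lambda>v. (K * (1 + \<bar>t\<bar> + \<bar>v\<bar>))\<^sup>2)"
    by (auto simp: power2_eq_square algebra_simps fun_eq_iff)
  finally have i2: "integrable \<gamma> (\<lambda>v. (z v)\<^sup>2)"
    by (rule Bochner_Integration.integrable_bound) (use b z0 in \<open>auto intro!: AE_I2 power_mono\<close>)
  have i1: "integrable \<gamma> z"
    unfolding z_def by (rule integrable_normal_zeta)
  \<comment> \<open>Jensen for the square is the nonnegativity of a variance; its integrability
    conditions come from the linear bound for zeta.\<close>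
  have "0 \<le> N.variance z" by (rule N.variance_positive)
  hence "(\<integral>v. z v \<partial>\<gamma>)\<^sup>2 \<le> (\<integral>v. (z v)\<^sup>2 \<partial>\<gamma>)"
    using N.variance_eq[OF i1 i2] by simp
  hence "ennreal ((\<integral>v. z v \<partial>\<gamma>)\<^sup>2) \<le> ennreal (\<integral>v. (z v)\<^sup>2 \<partial>\<gamma>)"
    by (rule ennreal_leI)
  also have "\<dots> = (\<integral>\<^sup>+v. ennreal ((z v)\<^sup>2) \<partial>\<gamma>)"
    by (intro nn_integral_eq_integral[symmetric] i2) auto
  also have "\<dots> \<le> (\<integral>\<^sup>+v. ennreal (A\<^sup>2) + ennreal (A powr (2 - \<kappa>)) * ennreal (z v powr \<kappa>) \<partial>\<gamma>)"
  proof (intro nn_integral_mono)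
    fix v
    show "ennreal ((z v)\<^sup>2) \<le> ennreal (A\<^sup>2) + ennreal (A powr (2 - \<kappa>)) * ennreal (z v powr \<kappa>)"
      using ennreal_leI[OF pw[of v]] by (simp add: ennreal_mult'[symmetric])
  qed
  also have "\<dots> = (\<integral>\<^sup>+v. ennreal (A\<^sup>2) \<partial>\<gamma>) + (\<integral>\<^sup>+v. ennreal (A powr (2 - \<kappa>)) * ennreal (z v powr \<kappa>) \<partial>\<gamma>)"
    by (rule nn_integral_add) measurable
  also have "\<dots> = ennreal (A\<^sup>2) + ennreal (A powr (2 - \<kappa>)) * (\<integral>\<^sup>+v. ennreal (z v powr \<kappa>) \<partial>\<gamma>)"
    using N.emeasure_space_1 by (subst nn_integral_cmult) auto
  finally show ?thesis unfolding z_def .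
qed

text \<open>A pair (k, l) stands for k times a difference from the cell with index l, on a
  logarithmic scale of unit 1/T. The tolerance 2 is 1 for the near coincidence of two products plus
  1 for rounding to cells.\<close>

definition resonance_sum :: "real \<Rightarrow> nat \<Rightarrow> int set \<Rightarrow> (int \<Rightarrow> real) \<Rightarrow> real" where
  "resonance_sum T J I c = (\<Sum>p\<in>{J..<2*J} \<times> I. \<Sum>q\<in>{J..<2*J} \<times> I.
     if \<bar>T * ln (real (fst p)) + real_of_int (snd p) - T * ln (real (fst q)) - real_of_int (snd q)\<bar> \<le> 2
     then c (snd p) * c (snd q) else 0)"

text \<open>All terms of the expanded square are nonnegative, so only k in [J, 2J) is kept. There ln
  k - ln J <= 1 makes each weight at least (2J)^(-1/2) * exp (-1/2), and the tolerance 2 makes the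
  kernel at least exp (-2); together these give exp (-3) / (2J).\<close>

lemma resonance_sum_le_integral:
  fixes J n :: nat
  assumes T: "T > 0" and J: "J \<ge> 1" and n: "n \<ge> 2 * J" and fin: "finite I" and c: "\<And>l. c l \<ge> 0"
  defines "P \<equiv> \<lambda>t. \<Sum>l\<in>I. of_real (c l) * iexp (- (real_of_int l / T) * t)"
  defines "F \<equiv> \<lambda>t. (cmod (dirichlet_smooth n (real J) t * P t))\<^sup>2 * exp (- t\<^sup>2 / (2 * T\<^sup>2))"
  shows "integrable lborel F" "T * sqrt (2 * pi) * exp (- 3) / (2 * real J) * resonance_sum T J I c \<le> integral\<^sup>L lborel F"
proof -
  define \<Omega> where "\<Omega> = {1..n} \<times> I"
  define a where "a = (\<lambda>p. log_gauss (real J) (real (fst p)) * c (snd p))"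
  define \<theta> where "\<theta> = (\<lambda>p. - (ln (real (fst p)) + real_of_int (snd p) / T))"
  have "dirichlet_smooth n (real J) t * P t = (\<Sum>p\<in>\<Omega>. of_real (a p) * iexp (\<theta> p * t))" for t
    unfolding dirichlet_smooth_def P_def \<Omega>_def sum_product sum.cartesian_product
    by (intro sum.cong) (auto simp: a_def \<theta>_def exp_add[symmetric] ring_distribs mult_ac)
  hence F: "F = (\<lambda>t. (cmod (\<Sum>p\<in>\<Omega>. of_real (a p) * iexp (\<theta> p * t)))\<^sup>2 * exp (- t\<^sup>2 / (2 * T\<^sup>2)))"
    by (simp add: F_def)
  have fin\<Omega>: "finite \<Omega>" using fin by (simp add: \<Omega>_def)
  show "integrable lborel F"
    unfolding F by (rule gauss_quadratic_form(1)[OF T fin\<Omega>])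
  have int: "integral\<^sup>L lborel F = T * sqrt (2 * pi) * (\<Sum>p\<in>\<Omega>. \<Sum>q\<in>\<Omega>. a p * a q * exp (- (T * (\<theta> p - \<theta> q))\<^sup>2 / 2))"
    unfolding F gauss_quadratic_form(2)[OF T fin\<Omega>] by simp
  have a0: "a p \<ge> 0" for p using c by (simp add: a_def log_gauss_def)
  define S where "S = {J..<2*J} \<times> I"
  have S: "S \<subseteq> \<Omega>" "finite S" using J n fin by (auto simp: S_def \<Omega>_def)
  have lg: "log_gauss (real J) (real k) \<ge> (2 * real J) powr (-1/2) * exp (- 1 / 2)" if "k \<in> {J..<2*J}" for k
  proof -
    have k: "real J \<le> real k" "real k \<le> 2 * real J" "real J > 0" "real k > 0" using that J by auto
    have "0 \<le> ln (real k) - ln (real J)" using k by simp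
    moreover have "ln (real k) \<le> ln (2 * real J)" using k by (subst ln_le_cancel_iff) auto
    hence "ln (real k) - ln (real J) \<le> 1" using k ln_2_less_1 by (simp add: ln_mult)
    ultimately have "(ln (real k) - ln (real J))\<^sup>2 \<le> 1\<^sup>2" by (intro power_mono)
    hence "exp (- 1 / 2) \<le> exp (- (ln (real k) - ln (real J))\<^sup>2 / 2)" by simp
    moreover have "(2 * real J) powr (-1/2) \<le> real k powr (-1/2)" using k by (intro powr_mono2') auto
    ultimately show ?thesis unfolding log_gauss_def by (intro mult_mono) auto
  qed
  have "exp (- 3) / (2 * real J) * resonance_sum T J I c = (\<Sum>p\<in>S. \<Sum>q\<in>S. exp (- 3) / (2 * real J) * (if \<bar>T * ln (real (fst p)) + real_of_int (snd p) - T * ln (real (fst q)) - real_of_int (snd q)\<bar> \<le> 2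
     then c (snd p) * c (snd q) else 0))"
    by (simp only: resonance_sum_def S_def sum_distrib_left)
  also have "\<dots> \<le> (\<Sum>p\<in>S. \<Sum>q\<in>S. a p * a q * exp (- (T * (\<theta> p - \<theta> q))\<^sup>2 / 2))"
  proof (intro sum_mono)
    fix p q assume pq: "p \<in> S" "q \<in> S"
    define d where "d = T * ln (real (fst p)) + real_of_int (snd p) - T * ln (real (fst q)) - real_of_int (snd q)"
    have \<theta>: "T * (\<theta> p - \<theta> q) = - d" using T by (simp add: \<theta>_def d_def field_simps)
    show "exp (- 3) / (2 * real J) * (if \<bar>T * ln (real (fst p)) + real_of_int (snd p) - T * ln (real (fst q)) - real_of_int (snd q)\<bar> \<le> 2
     then c (snd p) * c (snd q) else 0) \<le> a p * a q * exp (- (T * (\<theta> p - \<theta> q))\<^sup>2 / 2)"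
    proof (cases "\<bar>d\<bar> \<le> 2")
      case True
      hence "d\<^sup>2 \<le> 2\<^sup>2" by (metis abs_le_square_iff abs_numeral)
      hence e: "exp (- 2) \<le> exp (- (T * (\<theta> p - \<theta> q))\<^sup>2 / 2)" unfolding \<theta> by simp
      define w where "w = (2 * real J) powr (-1/2) * exp (- 1 / 2)"
      have w0: "w \<ge> 0" by (simp add: w_def)
      have ww: "w * w = exp (- 1) / (2 * real J)"
      proof -
        have "w * w = ((2 * real J) powr (-1/2) * (2 * real J) powr (-1/2)) * (exp (- 1 / 2) * exp (- 1 / 2))" by (simp add: w_def)
        also have "\<dots> = (2 * real J) powr (-1) * exp (- 1)" by (simp only: powr_add[symmetric] exp_add[symmetric]) simp
        finally show ?thesis using J by (simp add: powr_minus_divide)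
      qed
      have "w * c (snd p) \<le> a p" "w * c (snd q) \<le> a q"
        using lg[of "fst p"] lg[of "fst q"] pq c unfolding a_def w_def S_def by (auto intro!: mult_right_mono)
      hence "(w * c (snd p)) * (w * c (snd q)) \<le> a p * a q"
        by (rule mult_mono) (use w0 c a0 in auto)
      hence "((w * c (snd p)) * (w * c (snd q))) * exp (- 2) \<le> a p * a q * exp (- (T * (\<theta> p - \<theta> q))\<^sup>2 / 2)"
        by (rule mult_mono[OF _ e]) (use a0 in auto)
      also have "((w * c (snd p)) * (w * c (snd q))) * exp (- 2) = (w * w) * exp (- 2) * (c (snd p) * c (snd q))" by simp
      also have "\<dots> = exp (- 3) / (2 * real J) * (c (snd p) * c (snd q))"
        unfolding ww by (simp add: exp_add[symmetric])
      finally show ?thesis using True by (simp add: d_def)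
    next
      case False
      thus ?thesis using a0 by (simp add: d_def)
    qed
  qed
  also have "\<dots> \<le> (\<Sum>p\<in>\<Omega>. \<Sum>q\<in>S. a p * a q * exp (- (T * (\<theta> p - \<theta> q))\<^sup>2 / 2))"
    using S fin\<Omega> a0 by (intro sum_mono2) (auto intro!: sum_nonneg)
  also have "\<dots> \<le> (\<Sum>p\<in>\<Omega>. \<Sum>q\<in>\<Omega>. a p * a q * exp (- (T * (\<theta> p - \<theta> q))\<^sup>2 / 2))"
    using S fin\<Omega> a0 by (intro sum_mono sum_mono2) auto
  finally have "T * sqrt (2 * pi) * (exp (- 3) / (2 * real J) * resonance_sum T J I c) \<le> integral\<^sup>L lborel F"
    unfolding int using T by (intro mult_left_mono) auto
  thus "T * sqrt (2 * pi) * exp (- 3) / (2 * real J) * resonance_sum T J I c \<le> integral\<^sup>L lborel F"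
    by (simp add: mult_ac)
qed

text \<open>P is estimated in two ways. Where zeta is at most A, its mean square costs only the sum
  of the squares of c. Against large values of zeta and against the pole it is bounded trivially by
  the sum of c, so the moment of zeta is needed without any twist by P.\<close>

lemma resonance_sum_bound:
  obtains C0 where "C0 > 0"
    "\<And>\<kappa> T J I c A B. \<lbrakk>\<kappa> > 2; T > 0; J \<ge> 1; finite I; \<And>l. c l \<ge> 0; A > 0; B \<ge> 0;
       (\<integral>\<^sup>+t. ennreal (exp (- t\<^sup>2 / (2 * T\<^sup>2))) *
           (\<integral>\<^sup>+v. ennreal (zeta_abs (t + v) powr \<kappa>) \<partial>\<gamma>) \<partial>lborel)
         \<le> ennreal (T * B)\<rbrakk> \<Longrightarrow>
     resonance_sum T J I c \<le> C0 * real J * (A\<^sup>2 * (\<Sum>l\<in>I. (c l)\<^sup>2) + (\<Sum>l\<in>I. c l)\<^sup>2 * (A powr (2 - \<kappa>) * B + real J / T))"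
proof -
  define C3 where "C3 = 2 / (1 - exp (- 1 / 2) :: real)"
  have C3: "C3 > 0" by (simp add: C3_def)
  define C4 where "C4 = (exp (1/8) * sqrt (2 * pi))\<^sup>2 * sqrt (2 * pi)"
  define C5 where "C5 = sqrt (2 * pi) * C3"
  have C45: "C4 > 0" "C5 > 0" using C3 by (simp_all add: C4_def C5_def)
  define C0 where "C0 = 6 * (C4 + C5 + 1) * exp 3 / sqrt (2 * pi)"
  have C0: "C0 > 0" using C45 by (simp add: C0_def)
  have main: "resonance_sum T J I c \<le> C0 * real J * (A\<^sup>2 * (\<Sum>l\<in>I. (c l)\<^sup>2) + (\<Sum>l\<in>I. c l)\<^sup>2 * (A powr (2 - \<kappa>) * B + real J / T))"
    if \<kappa>: "\<kappa> > 2" and T: "T > 0" and J: "J \<ge> 1" and fin: "finite I" and c: "\<And>l. c l \<ge> 0" and A: "A > 0" and B: "B \<ge> 0"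
      and mom: "(\<integral>\<^sup>+t. ennreal (exp (- t\<^sup>2 / (2 * T\<^sup>2))) *
           (\<integral>\<^sup>+v. ennreal (zeta_abs (t + v) powr \<kappa>) \<partial>\<gamma>) \<partial>lborel)
         \<le> ennreal (T * B)" for \<kappa> T J I c A B
  proof -
    define Q where "Q = (\<Sum>l\<in>I. c l)"
    define E where "E = (\<Sum>l\<in>I. (c l)\<^sup>2)"
    define Y where "Y = A\<^sup>2 * E + Q\<^sup>2 * (A powr (2 - \<kappa>) * B + real J / T)"
    have Q0: "Q \<ge> 0" and E0: "E \<ge> 0" using c by (auto simp: Q_def E_def intro!: sum_nonneg)
    \<comment> \<open>Allows the truncation error, which comes multiplied by E, to be moved into the
      pole term with its factor Q^2.\<close>
    have EQ: "E \<le> Q\<^sup>2"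
    proof -
      have "E \<le> (\<Sum>l\<in>I. c l * Q)"
        unfolding E_def power2_eq_square
        by (intro sum_mono mult_left_mono c) (auto simp: Q_def intro!: member_le_sum fin c)
      thus ?thesis by (simp add: Q_def power2_eq_square sum_distrib_right)
    qed
    \<comment> \<open>Truncation error, chosen so that T * \<delta>^2 has the size J of the
      integrated square of the pole term.\<close>
    define \<delta> where "\<delta> = sqrt (real J / T)"
    have \<delta>: "\<delta> > 0" "\<delta>\<^sup>2 = real J / T" using J T by (auto simp: \<delta>_def)
    define V where "V = (\<lambda>t. \<integral>v. zeta_abs (t + v) \<partial>\<gamma>)"
    define V2 where "V2 = (\<lambda>t. \<integral>\<^sup>+v. ennreal (zeta_abs (t + v) powr \<kappa>) \<partial>\<gamma>)"
    define R where "R = (\<lambda>t. sqrt (real J) * exp (1/8) * sqrt (2 * pi) * exp (- t\<^sup>2 / 2))"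
    interpret N: prob_space \<gamma> by (rule prob_space_std_normal)
    have [measurable]: "V2 \<in> borel_measurable borel" unfolding V2_def by measurable
    obtain n where n: "n \<ge> 2 * J" "\<And>t. cmod (dirichlet_smooth n (real J) t) \<le> V t + R t + \<delta>"
      using dirichlet_smooth_bound[of "real J" \<delta> "2 * J"] J \<delta>(1) unfolding V_def R_def by auto
    define P where "P = (\<lambda>t. \<Sum>l\<in>I. of_real (c l) * iexp (- (real_of_int l / T) * t))"
    define w where "w = (\<lambda>t. exp (- t\<^sup>2 / (2 * T\<^sup>2)))"
    define F where "F = (\<lambda>t. (cmod (dirichlet_smooth n (real J) t * P t))\<^sup>2 * w t)"
    have F: "integrable lborel F" "T * sqrt (2 * pi) * exp (- 3) / (2 * real J) * resonance_sum T J I c \<le> integral\<^sup>L lborel F"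
      using resonance_sum_le_integral[OF T J n(1) fin c] unfolding F_def P_def w_def by auto
    have [measurable]: "P \<in> borel_measurable borel" "w \<in> borel_measurable borel" "R \<in> borel_measurable borel"
      unfolding P_def w_def R_def by measurable
    have w: "w t \<ge> 0" "w t \<le> 1" for t by (auto simp: w_def)
    have PQ: "cmod (P t) \<le> Q" for t
      unfolding P_def Q_def by (rule sum_norm_le) (use c in \<open>simp add: norm_mult\<close>)
    have PI: "integrable lborel (\<lambda>t. (cmod (P t))\<^sup>2 * w t)" "(\<integral>t. (cmod (P t))\<^sup>2 * w t \<partial>lborel) \<le> T * C5 * E"
    proof -
      show "integrable lborel (\<lambda>t. (cmod (P t))\<^sup>2 * w t)"
        unfolding P_def w_def by (rule gauss_quadratic_form(1)[OF T fin])
      have "(\<integral>t. (cmod (P t))\<^sup>2 * w t \<partial>lborel) = T * sqrt (2 * pi) * (\<Sum>l\<in>I. \<Sum>l'\<in>I. c l * c l' * exp (- (real_of_int (l - l'))\<^sup>2 / 2))"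
      proof -
        have "(T * (- (real_of_int l / T) - - (real_of_int l' / T)))\<^sup>2 = (real_of_int (l - l'))\<^sup>2" for l l'
        proof -
          have "T * (- (real_of_int l / T) - - (real_of_int l' / T)) = - real_of_int (l - l')" using T by (simp add: field_simps)
          thus ?thesis by (simp only: power2_minus)
        qed
        thus ?thesis unfolding P_def w_def gauss_quadratic_form(2)[OF T fin] by simp
      qed
      also have "\<dots> \<le> T * sqrt (2 * pi) * (C3 * E)"
        unfolding C3_def E_def using T by (intro mult_left_mono sum_gauss_shifts_le fin c) auto
      finally show "(\<integral>t. (cmod (P t))\<^sup>2 * w t \<partial>lborel) \<le> T * C5 * E" by (simp add: C5_def mult_ac)
    qed
    \<comment> \<open>The square of V + R + \<delta> is at most three times the sum of the squares.
      \<open>G1\<close> collects |zeta| <= A and the truncation error, \<open>G2\<close> the large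
      values of zeta, \<open>G3\<close> the pole.\<close>
    define G1 where "G1 = (\<lambda>t. ennreal (3 * (A\<^sup>2 + \<delta>\<^sup>2)) * ennreal ((cmod (P t))\<^sup>2 * w t))"
    define G2 where "G2 = (\<lambda>t. ennreal (3 * Q\<^sup>2 * A powr (2 - \<kappa>)) * (ennreal (w t) * V2 t))"
    define G3 where "G3 = (\<lambda>t. ennreal (3 * Q\<^sup>2) * ennreal ((R t)\<^sup>2))"
    have pw: "ennreal (F t) \<le> G1 t + G2 t + G3 t" for t
    proof -
      have V0: "V t \<ge> 0" and R0: "R t \<ge> 0" by (auto simp: V_def R_def)
      have "(cmod (dirichlet_smooth n (real J) t))\<^sup>2 \<le> (V t + R t + \<delta>)\<^sup>2"
        using n(2) by (intro power_mono) auto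
      also have "\<dots> \<le> 3 * ((V t)\<^sup>2 + (R t)\<^sup>2 + \<delta>\<^sup>2)"
        using zero_le_power2[of "V t - R t"] zero_le_power2[of "V t - \<delta>"] zero_le_power2[of "R t - \<delta>"]
        by (simp add: power2_eq_square algebra_simps)
      finally have D: "(cmod (dirichlet_smooth n (real J) t))\<^sup>2 \<le> 3 * ((V t)\<^sup>2 + (R t)\<^sup>2 + \<delta>\<^sup>2)" .
      define p where "p = (cmod (P t))\<^sup>2 * w t"
      have p0: "p \<ge> 0" using w by (simp add: p_def)
      have "(cmod (P t))\<^sup>2 \<le> Q\<^sup>2" using PQ by (intro power_mono) auto
      hence pQ: "p \<le> Q\<^sup>2 * w t" using w by (simp add: p_def mult_right_mono)
      hence pQ': "p \<le> Q\<^sup>2" using mult_left_mono[OF w(2)[of t], of "Q\<^sup>2"] by simp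
      have "F t = (cmod (dirichlet_smooth n (real J) t))\<^sup>2 * p"
        by (simp add: F_def p_def norm_mult power_mult_distrib)
      also have "\<dots> \<le> 3 * ((V t)\<^sup>2 + (R t)\<^sup>2 + \<delta>\<^sup>2) * p" using D p0 by (rule mult_right_mono)
      also have "\<dots> = 3 * p * (V t)\<^sup>2 + 3 * p * (R t)\<^sup>2 + 3 * p * \<delta>\<^sup>2" by (simp add: algebra_simps)
      finally have "ennreal (F t) \<le> ennreal (3 * p * (V t)\<^sup>2 + 3 * p * (R t)\<^sup>2 + 3 * p * \<delta>\<^sup>2)" by (rule ennreal_leI)
      also have "\<dots> = ennreal (3 * p) * ennreal ((V t)\<^sup>2) + ennreal (3 * p * (R t)\<^sup>2) + ennreal (3 * p * \<delta>\<^sup>2)"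
        using p0 by (simp add: ennreal_mult'[symmetric] ennreal_plus[symmetric] del: ennreal_plus)
      also have "\<dots> \<le> ennreal (3 * p) * (ennreal (A\<^sup>2) + ennreal (A powr (2 - \<kappa>)) * V2 t) + G3 t + ennreal (3 * p * \<delta>\<^sup>2)"
      proof (intro add_mono mult_left_mono order_refl)
        show "ennreal ((V t)\<^sup>2) \<le> ennreal (A\<^sup>2) + ennreal (A powr (2 - \<kappa>)) * V2 t"
          unfolding V_def V2_def by (rule zeta_smoothed_square_le[OF \<kappa> A])
        show "ennreal (3 * p * (R t)\<^sup>2) \<le> G3 t"
          unfolding G3_def ennreal_mult'[symmetric, of "(R t)\<^sup>2", simplified]
          using pQ' by (subst ennreal_mult'[symmetric]) (auto intro!: ennreal_leI mult_right_mono)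
      qed auto
      also have "\<dots> = (ennreal (3 * p) * ennreal (A\<^sup>2) + ennreal (3 * p * \<delta>\<^sup>2)) + ennreal (3 * p) * ennreal (A powr (2 - \<kappa>)) * V2 t + G3 t"
        by (simp add: distrib_left mult_ac add_ac)
      also have "ennreal (3 * p) * ennreal (A\<^sup>2) + ennreal (3 * p * \<delta>\<^sup>2) = G1 t"
        using p0 unfolding G1_def p_def[symmetric]
        by (simp add: ennreal_mult'[symmetric] ennreal_plus[symmetric] ring_distribs mult_ac del: ennreal_plus)
      also have "G1 t + ennreal (3 * p) * ennreal (A powr (2 - \<kappa>)) * V2 t + G3 t \<le> G1 t + G2 t + G3 t"
      proof (intro add_mono order_refl)
        have "3 * p * A powr (2 - \<kappa>) \<le> 3 * Q\<^sup>2 * A powr (2 - \<kappa>) * w t"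
          using mult_right_mono[OF pQ, of "3 * A powr (2 - \<kappa>)"] by (simp add: mult_ac)
        hence "ennreal (3 * p * A powr (2 - \<kappa>)) * V2 t \<le> ennreal (3 * Q\<^sup>2 * A powr (2 - \<kappa>) * w t) * V2 t"
          by (intro mult_right_mono ennreal_leI) auto
        thus "ennreal (3 * p) * ennreal (A powr (2 - \<kappa>)) * V2 t \<le> G2 t"
          using w(1)[of t] p0 unfolding G2_def by (simp add: ennreal_mult'[symmetric] ennreal_mult'' mult.assoc[symmetric])
      qed
      finally show ?thesis .
    qed
    have I1: "(\<integral>\<^sup>+t. G1 t \<partial>lborel) \<le> ennreal (3 * (A\<^sup>2 + \<delta>\<^sup>2) * (T * C5 * E))"
    proof -
      have "(\<integral>\<^sup>+t. G1 t \<partial>lborel) = ennreal (3 * (A\<^sup>2 + \<delta>\<^sup>2)) * (\<integral>\<^sup>+t. ennreal ((cmod (P t))\<^sup>2 * w t) \<partial>lborel)"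
        unfolding G1_def by (subst nn_integral_cmult) auto
      also have "(\<integral>\<^sup>+t. ennreal ((cmod (P t))\<^sup>2 * w t) \<partial>lborel) = ennreal (\<integral>t. (cmod (P t))\<^sup>2 * w t \<partial>lborel)"
        using w by (intro nn_integral_eq_integral PI) auto
      also have "ennreal (3 * (A\<^sup>2 + \<delta>\<^sup>2)) * \<dots> \<le> ennreal (3 * (A\<^sup>2 + \<delta>\<^sup>2)) * ennreal (T * C5 * E)"
        by (intro mult_left_mono ennreal_leI PI) auto
      also have "\<dots> = ennreal (3 * (A\<^sup>2 + \<delta>\<^sup>2) * (T * C5 * E))"
        by (rule ennreal_mult'[symmetric]) simp
      finally show ?thesis .
    qed
    have I2: "(\<integral>\<^sup>+t. G2 t \<partial>lborel) \<le> ennreal (3 * Q\<^sup>2 * A powr (2 - \<kappa>) * (T * B))"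
    proof -
      have "(\<integral>\<^sup>+t. G2 t \<partial>lborel) = ennreal (3 * Q\<^sup>2 * A powr (2 - \<kappa>)) * (\<integral>\<^sup>+t. ennreal (w t) * V2 t \<partial>lborel)"
        unfolding G2_def by (subst nn_integral_cmult) auto
      also have "\<dots> \<le> ennreal (3 * Q\<^sup>2 * A powr (2 - \<kappa>)) * ennreal (T * B)"
        using mom unfolding w_def V2_def by (intro mult_left_mono) auto
      also have "\<dots> = ennreal (3 * Q\<^sup>2 * A powr (2 - \<kappa>) * (T * B))"
        by (rule ennreal_mult'[symmetric]) simp
      finally show ?thesis .
    qed
    have I3: "(\<integral>\<^sup>+t. G3 t \<partial>lborel) \<le> ennreal (3 * Q\<^sup>2 * (C4 * real J))"
    proof -
      have "(\<integral>\<^sup>+t. G3 t \<partial>lborel) = ennreal (3 * Q\<^sup>2) * (\<integral>\<^sup>+t. ennreal ((R t)\<^sup>2) \<partial>lborel)"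
        unfolding G3_def by (subst nn_integral_cmult) auto
      also have "(\<integral>\<^sup>+t. ennreal ((R t)\<^sup>2) \<partial>lborel) \<le> (\<integral>\<^sup>+t. ennreal (real J * (exp (1/8) * sqrt (2 * pi))\<^sup>2 * exp (- t\<^sup>2 / (2 * 1\<^sup>2))) \<partial>lborel)"
      proof (intro nn_integral_mono ennreal_leI)
        fix t :: real
        have "exp (- t\<^sup>2 / 2) * exp (- t\<^sup>2 / 2) \<le> exp (- t\<^sup>2 / 2) * 1" by (intro mult_left_mono) auto
        hence "(exp (- t\<^sup>2 / 2))\<^sup>2 \<le> exp (- t\<^sup>2 / (2 * 1\<^sup>2))" by (simp add: power2_eq_square[of "exp _"])
        from mult_left_mono[OF this, of "real J * (exp (1/8) * sqrt (2 * pi))\<^sup>2"]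
        show "(R t)\<^sup>2 \<le> real J * (exp (1/8) * sqrt (2 * pi))\<^sup>2 * exp (- t\<^sup>2 / (2 * 1\<^sup>2))"
          by (simp add: R_def power_mult_distrib mult_ac)
      qed
      also have "\<dots> = ennreal (\<integral>t. real J * (exp (1/8) * sqrt (2 * pi))\<^sup>2 * exp (- t\<^sup>2 / (2 * 1\<^sup>2)) \<partial>lborel)"
        by (intro nn_integral_eq_integral integrable_mult_right integrable_gauss) auto
      also have "(\<integral>t. real J * (exp (1/8) * sqrt (2 * pi))\<^sup>2 * exp (- t\<^sup>2 / (2 * 1\<^sup>2)) \<partial>lborel) = C4 * real J"
        by (subst Bochner_Integration.integral_mult_right_zero, subst integral_gauss) (auto simp: C4_def)
      also have "ennreal (3 * Q\<^sup>2) * ennreal (C4 * real J) = ennreal (3 * Q\<^sup>2 * (C4 * real J))"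
        by (rule ennreal_mult'[symmetric]) simp
      finally show ?thesis by (simp add: mult_left_mono)
    qed
    have nn: "0 \<le> 3 * (A\<^sup>2 + \<delta>\<^sup>2) * (T * C5 * E)" "0 \<le> 3 * Q\<^sup>2 * A powr (2 - \<kappa>) * (T * B)" "0 \<le> 3 * Q\<^sup>2 * (C4 * real J)"
      using T C45 E0 B by auto
    have "ennreal (integral\<^sup>L lborel F) = (\<integral>\<^sup>+t. ennreal (F t) \<partial>lborel)"
      using w by (intro nn_integral_eq_integral[symmetric] F(1)) (auto simp: F_def)
    also have "\<dots> \<le> (\<integral>\<^sup>+t. G1 t + G2 t + G3 t \<partial>lborel)" by (intro nn_integral_mono pw)
    also have "\<dots> = (\<integral>\<^sup>+t. G1 t \<partial>lborel) + (\<integral>\<^sup>+t. G2 t \<partial>lborel) + (\<integral>\<^sup>+t. G3 t \<partial>lborel)"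
      by (subst nn_integral_add, simp add: G1_def G2_def, simp add: G3_def, subst nn_integral_add) (auto simp: G1_def G2_def)
    also have "\<dots> \<le> ennreal (3 * (A\<^sup>2 + \<delta>\<^sup>2) * (T * C5 * E)) + ennreal (3 * Q\<^sup>2 * A powr (2 - \<kappa>) * (T * B)) + ennreal (3 * Q\<^sup>2 * (C4 * real J))"
      by (intro add_mono I1 I2 I3)
    also have "\<dots> = ennreal (3 * (A\<^sup>2 + \<delta>\<^sup>2) * (T * C5 * E) + 3 * Q\<^sup>2 * A powr (2 - \<kappa>) * (T * B) + 3 * Q\<^sup>2 * (C4 * real J))"
      using nn by (simp add: ennreal_plus[symmetric] del: ennreal_plus)
    finally have "integral\<^sup>L lborel F \<le> 3 * (A\<^sup>2 + \<delta>\<^sup>2) * (T * C5 * E) + 3 * Q\<^sup>2 * A powr (2 - \<kappa>) * (T * B) + 3 * Q\<^sup>2 * (C4 * real J)"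
      using nn by (subst (asm) ennreal_le_iff) auto
    also have "\<dots> \<le> 3 * T * ((C4 + C5 + 1) * (A\<^sup>2 * E + Q\<^sup>2 * (A powr (2 - \<kappa>) * B + real J / T)))"
    proof -
      have "\<delta>\<^sup>2 * (T * C5 * E) \<le> \<delta>\<^sup>2 * (T * C5 * Q\<^sup>2)" using T C45 EQ by (intro mult_left_mono) auto
      also have "\<dots> = C5 * real J * Q\<^sup>2" using T \<delta>(2) by simp
      finally have 1: "\<delta>\<^sup>2 * (T * C5 * E) \<le> C5 * real J * Q\<^sup>2" .
      have 2: "0 \<le> (C4 + 1) * (T * (A\<^sup>2 * E))" "0 \<le> (C4 + C5) * (T * (Q\<^sup>2 * (A powr (2 - \<kappa>) * B)))" "0 \<le> Q\<^sup>2 * real J"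
        using C45 T E0 B by auto
      have "T * ((C4 + C5 + 1) * (A\<^sup>2 * E + Q\<^sup>2 * (A powr (2 - \<kappa>) * B + real J / T)))
        = (C4 + C5 + 1) * (T * (A\<^sup>2 * E) + T * (Q\<^sup>2 * (A powr (2 - \<kappa>) * B)) + Q\<^sup>2 * real J)"
        using T by (simp add: field_simps)
      also have "\<dots> = (A\<^sup>2 * (T * C5 * E) + C5 * real J * Q\<^sup>2 + Q\<^sup>2 * A powr (2 - \<kappa>) * (T * B) + Q\<^sup>2 * (C4 * real J))
         + (C4 + 1) * (T * (A\<^sup>2 * E)) + (C4 + C5) * (T * (Q\<^sup>2 * (A powr (2 - \<kappa>) * B))) + Q\<^sup>2 * real J"
        by (simp add: ring_distribs mult_ac)
      finally have 3: "A\<^sup>2 * (T * C5 * E) + \<delta>\<^sup>2 * (T * C5 * E) + Q\<^sup>2 * A powr (2 - \<kappa>) * (T * B) + Q\<^sup>2 * (C4 * real J)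
         \<le> T * ((C4 + C5 + 1) * (A\<^sup>2 * E + Q\<^sup>2 * (A powr (2 - \<kappa>) * B + real J / T)))"
        using 1 2 by linarith
      have "3 * (A\<^sup>2 + \<delta>\<^sup>2) * (T * C5 * E) + 3 * Q\<^sup>2 * A powr (2 - \<kappa>) * (T * B) + 3 * Q\<^sup>2 * (C4 * real J)
         = 3 * (A\<^sup>2 * (T * C5 * E) + \<delta>\<^sup>2 * (T * C5 * E) + Q\<^sup>2 * A powr (2 - \<kappa>) * (T * B) + Q\<^sup>2 * (C4 * real J))"
        by (simp only: ring_distribs mult.assoc)
      also have "\<dots> \<le> 3 * (T * ((C4 + C5 + 1) * (A\<^sup>2 * E + Q\<^sup>2 * (A powr (2 - \<kappa>) * B + real J / T))))"
        using 3 by (rule mult_left_mono) simp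
      finally show ?thesis by (simp only: mult.assoc)
    qed
    finally have "T * sqrt (2 * pi) * exp (- 3) / (2 * real J) * resonance_sum T J I c \<le> 3 * T * ((C4 + C5 + 1) * (A\<^sup>2 * E + Q\<^sup>2 * (A powr (2 - \<kappa>) * B + real J / T)))"
      using F(2) by linarith
    hence le: "T * sqrt (2 * pi) * exp (- 3) / (2 * real J) * resonance_sum T J I c \<le> 3 * T * ((C4 + C5 + 1) * Y)"
      by (simp only: Y_def)
    have "0 \<le> 2 * real J * exp 3 / (T * sqrt (2 * pi))" using T by simp
    note le' = mult_left_mono[OF le this]
    have "2 * real J * exp 3 / (T * sqrt (2 * pi)) * (T * sqrt (2 * pi) * exp (- 3) / (2 * real J) * resonance_sum T J I c) = resonance_sum T J I c"
      using T J by (simp add: exp_minus)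
    moreover have "2 * real J * exp 3 / (T * sqrt (2 * pi)) * (3 * T * ((C4 + C5 + 1) * Y)) = C0 * real J * Y"
      using T by (simp add: C0_def)
    ultimately have "resonance_sum T J I c \<le> C0 * real J * Y"
      using le' by simp
    hence "resonance_sum T J I c \<le> C0 * real J * (A\<^sup>2 * E + Q\<^sup>2 * (A powr (2 - \<kappa>) * B + real J / T))"
      by (simp only: Y_def)
    thus ?thesis by (simp add: E_def Q_def)
  qed
  show ?thesis using that[OF C0] main by blast
qed

subsection \<open>Counting near coincidences\<close>

lemma zeta_smoothed_moment:
  fixes \<kappa> b :: real
  assumes \<kappa>: "\<kappa> \<ge> 0"
    and mom: "\<forall>T\<ge>T0. T > 0 \<longrightarrow>
          (1 / T) * integral {0..T} (\<lambda>t. zeta_abs t powr \<kappa>) \<le> C * T powr b"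
  obtains C' T1 where "C' \<ge> 0" "T1 \<ge> 2"
    "\<And>T. T \<ge> T1 \<Longrightarrow> (\<integral>\<^sup>+t. ennreal (exp (- t\<^sup>2 / (2 * T\<^sup>2))) *
           (\<integral>\<^sup>+v. ennreal (zeta_abs (t + v) powr \<kappa>) \<partial>\<gamma>) \<partial>lborel)
         \<le> ennreal (T * (C' * T powr b))"
proof -
  define T1 where "T1 = max T0 2"
  have T1: "T1 \<ge> T0" "T1 \<ge> 2" by (auto simp: T1_def)
  have le: "integral {0..T} (\<lambda>t. zeta_abs t powr \<kappa>) \<le> \<bar>C\<bar> * T powr (1 + b)" if "T \<ge> T1" for T
  proof -
    have T: "T > 0" "T \<ge> T0" using that T1 by auto
    have "integral {0..T} (\<lambda>t. zeta_abs t powr \<kappa>) \<le> T * (C * T powr b)"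
      using mom T by (auto simp: field_simps)
    also have "\<dots> \<le> T * (\<bar>C\<bar> * T powr b)" using T by (intro mult_left_mono mult_right_mono) auto
    finally show ?thesis using T by (simp add: powr_add mult_ac)
  qed
  have "T1 > 0" using T1 by simp
  obtain C' where C': "C' \<ge> 0"
    "\<And>T. T \<ge> T1 \<Longrightarrow> (\<integral>\<^sup>+u. ennreal (exp (- u\<^sup>2 / (4 * T\<^sup>2)) * zeta_abs u powr \<kappa>) \<partial>lborel)
        \<le> ennreal (C' * T powr (1 + b))"
    using gauss_weighted_zeta_moment[OF \<kappa> le abs_ge_zero \<open>T1 > 0\<close>] by blast
  show ?thesis
  proof (rule that[of "sqrt 2 * C'" T1])
    fix T assume T: "T \<ge> T1"
    hence T2: "T \<ge> 2" using T1 by simp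
    hence "T\<^sup>2 \<ge> 2\<^sup>2" by (intro power_mono) auto
    hence TT: "T\<^sup>2 \<ge> 2" by simp
    have "(\<integral>\<^sup>+t. ennreal (exp (- t\<^sup>2 / (2 * T\<^sup>2))) *
           (\<integral>\<^sup>+v. ennreal (zeta_abs (t + v) powr \<kappa>) \<partial>\<gamma>) \<partial>lborel)
       \<le> ennreal (sqrt 2) * (\<integral>\<^sup>+u. ennreal (exp (- u\<^sup>2 / (4 * T\<^sup>2)) * zeta_abs u powr \<kappa>) \<partial>lborel)"
      by (rule gauss_smoothed_zeta_moment[OF _ _ TT, of "\<lambda>u. zeta_abs u powr \<kappa>"]) auto
    also have "\<dots> \<le> ennreal (sqrt 2) * ennreal (C' * T powr (1 + b))"
      by (intro mult_left_mono C'(2) T) auto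
    also have "\<dots> = ennreal (T * (sqrt 2 * C' * T powr b))"
      using T2 by (simp add: ennreal_mult'[symmetric] powr_add mult_ac)
    finally show "(\<integral>\<^sup>+t. ennreal (exp (- t\<^sup>2 / (2 * T\<^sup>2))) *
           (\<integral>\<^sup>+v. ennreal (zeta_abs (t + v) powr \<kappa>) \<partial>\<gamma>) \<partial>lborel)
         \<le> ennreal (T * (sqrt 2 * C' * T powr b))" .
  qed (use C' T1 in auto)
qed

text \<open>The constant is fixed before T, J, I, c and A, since all of these will vary with
  N.\<close>

lemma resonance_sum_moment_bound:
  fixes \<kappa> b :: real
  assumes \<kappa>: "\<kappa> > 2"
    and mom: "\<exists>C T0. \<forall>T\<ge>T0. T > 0 \<longrightarrow>
          (1 / T) * integral {0..T} (\<lambda>t. zeta_abs t powr \<kappa>) \<le> C * T powr b"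
  obtains C T1 where "C > 0" "T1 \<ge> 2"
    "\<And>T J I c A. \<lbrakk>T \<ge> T1; J \<ge> 1; finite I; \<And>l. c l \<ge> 0; A > 0\<rbrakk> \<Longrightarrow>
      resonance_sum T J I c \<le> C * real J * (A\<^sup>2 * (\<Sum>l\<in>I. (c l)\<^sup>2) + (\<Sum>l\<in>I. c l)\<^sup>2 * (A powr (2 - \<kappa>) * T powr b + real J / T))"
proof -
  obtain C0 where C0: "C0 > 0"
    "\<And>\<kappa> T J I c A B. \<lbrakk>\<kappa> > 2; T > 0; J \<ge> 1; finite I; \<And>l. c l \<ge> 0; A > 0; B \<ge> 0;
       (\<integral>\<^sup>+t. ennreal (exp (- t\<^sup>2 / (2 * T\<^sup>2))) *
           (\<integral>\<^sup>+v. ennreal (zeta_abs (t + v) powr \<kappa>) \<partial>\<gamma>) \<partial>lborel)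
         \<le> ennreal (T * B)\<rbrakk> \<Longrightarrow>
     resonance_sum T J I c \<le> C0 * real J * (A\<^sup>2 * (\<Sum>l\<in>I. (c l)\<^sup>2) + (\<Sum>l\<in>I. c l)\<^sup>2 * (A powr (2 - \<kappa>) * B + real J / T))"
    using resonance_sum_bound by blast
  from mom obtain C T0 where mm: "\<forall>T\<ge>T0. T > 0 \<longrightarrow>
          (1 / T) * integral {0..T} (\<lambda>t. zeta_abs t powr \<kappa>) \<le> C * T powr b" by blast
  have "\<kappa> \<ge> 0" using \<kappa> by simp
  obtain C' T1 where C': "C' \<ge> 0" "T1 \<ge> 2"
    "\<And>T. T \<ge> T1 \<Longrightarrow> (\<integral>\<^sup>+t. ennreal (exp (- t\<^sup>2 / (2 * T\<^sup>2))) *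
           (\<integral>\<^sup>+v. ennreal (zeta_abs (t + v) powr \<kappa>) \<partial>\<gamma>) \<partial>lborel)
         \<le> ennreal (T * (C' * T powr b))"
    using zeta_smoothed_moment[OF \<open>\<kappa> \<ge> 0\<close> mm] by blast
  show ?thesis
  proof (rule that[of "C0 * (C' + 1)" T1])
    fix T A :: real and J :: nat and I :: "int set" and c :: "int \<Rightarrow> real"
    assume *: "T \<ge> T1" "J \<ge> 1" "finite I" "\<And>l. c l \<ge> 0" "A > 0"
    hence T: "T > 0" using C' by simp
    define E where "E = A\<^sup>2 * (\<Sum>l\<in>I. (c l)\<^sup>2)"
    define Q where "Q = (\<Sum>l\<in>I. c l)\<^sup>2"
    have nn: "E \<ge> 0" "Q \<ge> 0" by (auto simp: E_def Q_def sum_nonneg)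
    have "resonance_sum T J I c \<le> C0 * real J * (E + Q * (A powr (2 - \<kappa>) * (C' * T powr b) + real J / T))"
      unfolding E_def Q_def by (rule C0(2)[OF \<kappa> T *(2-5) _ C'(3)[OF *(1)]]) (use C' in auto)
    also have "\<dots> \<le> C0 * real J * ((C' + 1) * (E + Q * (A powr (2 - \<kappa>) * T powr b + real J / T)))"
    proof (intro mult_left_mono)
      define r where "r = real J / T"
      have "r \<ge> 0" using T by (simp add: r_def)
      hence "0 \<le> C' * E" "0 \<le> C' * (Q * r)" "0 \<le> Q * (A powr (2 - \<kappa>) * T powr b)"
        using C' nn T by auto
      thus "E + Q * (A powr (2 - \<kappa>) * (C' * T powr b) + real J / T) \<le> (C' + 1) * (E + Q * (A powr (2 - \<kappa>) * T powr b + real J / T))"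
        unfolding r_def[symmetric] by (simp add: ring_distribs mult_ac)
    qed (use C0 in auto)
    finally show "resonance_sum T J I c \<le> C0 * (C' + 1) * real J * (A\<^sup>2 * (\<Sum>l\<in>I. (c l)\<^sup>2) + (\<Sum>l\<in>I. c l)\<^sup>2 * (A powr (2 - \<kappa>) * T powr b + real J / T))"
      unfolding E_def Q_def by (simp only: mult_ac)
  qed (use C0 C' in auto)
qed

text \<open>The resonance inequality is tested on J = 1 and a single cell with coefficient 1, where
  the sum equals 1. For m < 0 the right-hand side tends to C * A^2 as T grows, and A is chosen to
  make this 1/4. The conclusion later secures \<kappa> + 4m > 0 and monotonicity in J.\<close>

lemma zeta_moment_exponent_nonneg:
  fixes \<kappa> m :: real
  assumes \<kappa>: "\<kappa> > 2"
    and mom: "\<And>\<epsilon>. \<epsilon> > 0 \<Longrightarrow> \<exists>C T0. \<forall>T\<ge>T0. T > 0 \<longrightarrow>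
          (1 / T) * integral {0..T} (\<lambda>t. zeta_abs t powr \<kappa>) \<le> C * T powr (m + \<epsilon>)"
  shows "m \<ge> 0"
proof (rule ccontr)
  assume "\<not> m \<ge> 0"
  hence m: "m < 0" by simp
  have m2: "- m / 2 > 0" using m by simp
  obtain C T1 where C: "C > 0" "T1 \<ge> 2"
    "\<And>T J I c A. \<lbrakk>T \<ge> T1; J \<ge> 1; finite I; \<And>l. c l \<ge> 0; A > 0\<rbrakk> \<Longrightarrow>
      resonance_sum T J I c \<le> C * real J * (A\<^sup>2 * (\<Sum>l\<in>I. (c l)\<^sup>2) + (\<Sum>l\<in>I. c l)\<^sup>2 * (A powr (2 - \<kappa>) * T powr (m + - m / 2) + real J / T))"
    using resonance_sum_moment_bound[OF \<kappa> mom[OF m2]] by blast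
  define A where "A = sqrt (1 / (4 * C))"
  have A: "A > 0" "A\<^sup>2 = 1 / (4 * C)" using C by (auto simp: A_def)
  have "1 \<le> C * (1 / (4 * C) + (A powr (2 - \<kappa>) * T powr (m / 2) + 1 / T))" if "T \<ge> T1" for T
  proof -
    have "{1..<2 * 1::nat} \<times> {0::int} = {(1, 0)}" by auto
    hence "resonance_sum T 1 {0} (\<lambda>_. 1) = 1" unfolding resonance_sum_def by simp
    thus ?thesis using C(3)[OF that, of 1 "{0}" "\<lambda>_. 1" A] A by simp
  qed
  hence ev: "\<forall>\<^sub>F T in at_top. 1 \<le> C * (1 / (4 * C) + (A powr (2 - \<kappa>) * T powr (m / 2) + 1 / T))"
    by (auto simp: eventually_at_top_linorder)
  have "((\<lambda>T::real. C * (1 / (4 * C) + (A powr (2 - \<kappa>) * T powr (m / 2) + 1 / T))) \<longlongrightarrow> C * (1 / (4 * C) + (A powr (2 - \<kappa>) * 0 + 0))) at_top"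
    using m by (intro tendsto_intros tendsto_neg_powr filterlim_ident tendsto_divide_0[OF tendsto_const] filterlim_at_top_imp_at_infinity) auto
  from tendsto_lowerbound[OF this ev] show False using C by simp
qed

text \<open>The fibre sizes of h and g over the common values form two vectors: the mixed count is
  their inner product, the self-counts are their squared norms, and Cauchy-Schwarz applies.\<close>

lemma coincidence_card_le:
  fixes h :: "'a \<Rightarrow> 'c" and g :: "'b \<Rightarrow> 'c"
  assumes A: "finite A" and B: "finite B"
  shows "real (card {(a, b). a \<in> A \<and> b \<in> B \<and> h a = g b}) \<le>
     sqrt (real (card {(a, a'). a \<in> A \<and> a' \<in> A \<and> h a = h a'})) * sqrt (real (card {(b, b'). b \<in> B \<and> b' \<in> B \<and> g b = g b'}))"
proof -
  define V where "V = h ` A \<union> g ` B"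
  have V: "finite V" using A B by (simp add: V_def)
  define r where "r = (\<lambda>v. real (card {a\<in>A. h a = v}))"
  define s where "s = (\<lambda>v. real (card {b\<in>B. g b = v}))"
  have *: "real (card {(a, b). a \<in> X \<and> b \<in> Y \<and> f a = f' b}) = (\<Sum>v\<in>V. real (card {a\<in>X. f a = v}) * real (card {b\<in>Y. f' b = v}))"
    if "finite X" "finite Y" "f ` X \<subseteq> V" for X Y and f :: "'x \<Rightarrow> 'c" and f' :: "'y \<Rightarrow> 'c"
  proof -
    have "{(a, b). a \<in> X \<and> b \<in> Y \<and> f a = f' b} = (\<Union>v\<in>V. {a\<in>X. f a = v} \<times> {b\<in>Y. f' b = v})"
      using that by auto
    also have "card \<dots> = (\<Sum>v\<in>V. card ({a\<in>X. f a = v} \<times> {b\<in>Y. f' b = v}))"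
      using that by (intro card_UN_disjoint V) auto
    finally show ?thesis by (simp add: card_cartesian_product)
  qed
  have "(\<Sum>v\<in>V. r v * s v) \<le> \<bar>\<Sum>v\<in>V. r v * s v\<bar>" by simp
  also have "\<dots> \<le> sqrt (\<Sum>v\<in>V. (r v)\<^sup>2) * sqrt (\<Sum>v\<in>V. (s v)\<^sup>2)"
    using Cauchy_Schwarz_ineq_sum[of r s V] by (metis real_sqrt_abs real_sqrt_le_iff real_sqrt_mult)
  finally have "(\<Sum>v\<in>V. r v * s v) \<le> sqrt (\<Sum>v\<in>V. r v * r v) * sqrt (\<Sum>v\<in>V. s v * s v)" by (simp add: power2_eq_square)
  moreover have "real (card {(a, b). a \<in> A \<and> b \<in> B \<and> h a = g b}) = (\<Sum>v\<in>V. r v * s v)"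
    unfolding r_def s_def by (rule *) (use A B V_def in auto)
  moreover have "real (card {(a, a'). a \<in> A \<and> a' \<in> A \<and> h a = h a'}) = (\<Sum>v\<in>V. r v * r v)"
    unfolding r_def by (rule *) (use A V_def in auto)
  moreover have "real (card {(b, b'). b \<in> B \<and> b' \<in> B \<and> g b = g b'}) = (\<Sum>v\<in>V. s v * s v)"
    unfolding s_def by (rule *) (use B V_def in auto)
  ultimately show ?thesis by simp
qed

text \<open>Distance below 1 forces the floors to differ by -1, 0 or 1, whence the factor 3.
  Shifting the floor of g by e does not change its self-coincidences, and equal floors imply
  distance below 1.\<close>

lemma close_pairs_card_le:
  fixes f :: "'a \<Rightarrow> real" and g :: "'b \<Rightarrow> real"
  assumes A: "finite A" and B: "finite B"
  shows "real (card {(a, b). a \<in> A \<and> b \<in> B \<and> \<bar>f a - g b\<bar> < 1}) \<le>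
     3 * (sqrt (real (card {(a, a'). a \<in> A \<and> a' \<in> A \<and> \<bar>f a - f a'\<bar> < 1})) * sqrt (real (card {(b, b'). b \<in> B \<and> b' \<in> B \<and> \<bar>g b - g b'\<bar> < 1})))"
proof -
  define M where "M = sqrt (real (card {(a, a'). a \<in> A \<and> a' \<in> A \<and> \<bar>f a - f a'\<bar> < 1})) * sqrt (real (card {(b, b'). b \<in> B \<and> b' \<in> B \<and> \<bar>g b - g b'\<bar> < 1}))"
  define X where "X = (\<lambda>e::int. {(a, b). a \<in> A \<and> b \<in> B \<and> \<lfloor>f a\<rfloor> = \<lfloor>g b\<rfloor> + e})"
  have fl: "\<bar>x - y\<bar> < 1" if "\<lfloor>x\<rfloor> = \<lfloor>y\<rfloor>" for x y :: real using that by linarith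
  have finX: "finite (X e)" for e
    by (rule finite_subset[of _ "A \<times> B"]) (use A B in \<open>auto simp: X_def\<close>)
  have X: "real (card (X e)) \<le> M" for e
  proof -
    have "real (card (X e)) \<le> sqrt (real (card {(a, a'). a \<in> A \<and> a' \<in> A \<and> \<lfloor>f a\<rfloor> = \<lfloor>f a'\<rfloor>})) * sqrt (real (card {(b, b'). b \<in> B \<and> b' \<in> B \<and> \<lfloor>g b\<rfloor> + e = \<lfloor>g b'\<rfloor> + e}))"
      unfolding X_def by (rule coincidence_card_le[OF A B])
    also have "\<dots> \<le> M"
      unfolding M_def
    proof (intro mult_mono real_sqrt_le_mono of_nat_mono card_mono)
      show "finite {(a, a'). a \<in> A \<and> a' \<in> A \<and> \<bar>f a - f a'\<bar> < 1}"
        by (rule finite_subset[of _ "A \<times> A"]) (use A in auto)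
      show "finite {(b, b'). b \<in> B \<and> b' \<in> B \<and> \<bar>g b - g b'\<bar> < 1}"
        by (rule finite_subset[of _ "B \<times> B"]) (use B in auto)
    qed (auto intro: fl)
    finally show ?thesis .
  qed
  have "{(a, b). a \<in> A \<and> b \<in> B \<and> \<bar>f a - g b\<bar> < 1} \<subseteq> X (-1) \<union> X 0 \<union> X 1"
  proof (clarsimp simp: X_def)
    fix a b assume "\<bar>f a - g b\<bar> < 1" "\<lfloor>f a\<rfloor> \<noteq> \<lfloor>g b\<rfloor> + 1" "\<lfloor>f a\<rfloor> \<noteq> \<lfloor>g b\<rfloor>"
    thus "\<lfloor>f a\<rfloor> = \<lfloor>g b\<rfloor> - 1" by linarith
  qed
  hence "card {(a, b). a \<in> A \<and> b \<in> B \<and> \<bar>f a - g b\<bar> < 1} \<le> card (X (-1) \<union> X 0 \<union> X 1)"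
    by (intro card_mono) (use finX in auto)
  also have "\<dots> \<le> card (X (-1)) + card (X 0) + card (X 1)"
    by (meson add_mono card_Un_le le_trans order_refl)
  finally have "real (card {(a, b). a \<in> A \<and> b \<in> B \<and> \<bar>f a - g b\<bar> < 1}) \<le> real (card (X (-1))) + real (card (X 0)) + real (card (X 1))"
    by linarith
  thus ?thesis using X[of "-1"] X[of 0] X[of 1] unfolding M_def by linarith
qed

text \<open>On the logarithmic scale a near coincidence of two products becomes a condition on k and
  the cell index alone, up to rounding; T <= J * B makes the additive error 1 smaller than the cell
  width. Within a fixed pair of cells, Cauchy-Schwarz bounds the coincidences by 3 times the product
  of the coefficients.\<close>

lemma scaled_close_pairs_le_resonance:
  fixes d :: "'p \<Rightarrow> real" and J :: nat
  assumes S: "finite S" and d: "\<And>p. p \<in> S \<Longrightarrow> d p \<ge> B" and B: "B > 0" and T: "T > 0" "T \<le> real J * B" and J: "J \<ge> 1"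
  obtains I c where "finite I" "\<And>l. c l \<ge> 0"
    "(\<Sum>l\<in>I. (c l)\<^sup>2) \<le> real (card {(p, q). p \<in> S \<and> q \<in> S \<and> \<bar>d p - d q\<bar> < 1})"
    "(\<Sum>l\<in>I. c l) \<le> real (card S)"
    "real (card {(x, y). x \<in> {J..<2*J} \<times> S \<and> y \<in> {J..<2*J} \<times> S \<and> \<bar>real (fst x) * d (snd x) - real (fst y) * d (snd y)\<bar> < 1})
       \<le> 3 * resonance_sum T J I c"
proof -
  define cl where "cl = (\<lambda>p. \<lfloor>T * ln (d p)\<rfloor>)"
  define I where "I = cl ` S"
  define cell where "cell = (\<lambda>l. {p\<in>S. cl p = l})"
  define cp where "cp = (\<lambda>l. {(p, q). p \<in> cell l \<and> q \<in> cell l \<and> \<bar>d p - d q\<bar> < 1})"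
  \<comment> \<open>The square root matches Cauchy-Schwarz and keeps both sums under control: the
    squares add up to at most the number of close pairs, and a cell of size n has at most n^2 pairs,
    so the coefficients add up to at most \<open>card S\<close>.\<close>
  define c where "c = (\<lambda>l. sqrt (real (card (cp l))))"
  have I: "finite I" using S by (simp add: I_def)
  have fin_cell: "finite (cell l)" for l using S by (simp add: cell_def)
  have fin_cp: "finite (cp l)" for l
    by (rule finite_subset[of _ "cell l \<times> cell l"]) (use fin_cell in \<open>auto simp: cp_def\<close>)
  have c0: "c l \<ge> 0" for l by (simp add: c_def)
  have c2: "(\<Sum>l\<in>I. (c l)\<^sup>2) \<le> real (card {(p, q). p \<in> S \<and> q \<in> S \<and> \<bar>d p - d q\<bar> < 1})"
  proof -
    have "(\<Sum>l\<in>I. (c l)\<^sup>2) = real (\<Sum>l\<in>I. card (cp l))" by (simp add: c_def)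
    also have "(\<Sum>l\<in>I. card (cp l)) = card (\<Union>l\<in>I. cp l)"
      using I fin_cp by (intro card_UN_disjoint[symmetric]) (auto simp: cp_def cell_def)
    also have "\<dots> \<le> card {(p, q). p \<in> S \<and> q \<in> S \<and> \<bar>d p - d q\<bar> < 1}"
      by (intro card_mono finite_subset[of "{(p, q). p \<in> S \<and> q \<in> S \<and> \<bar>d p - d q\<bar> < 1}" "S \<times> S"]) (use S in \<open>auto simp: cp_def cell_def\<close>)
    finally show ?thesis by simp
  qed
  have c1: "(\<Sum>l\<in>I. c l) \<le> real (card S)"
  proof -
    have "c l \<le> real (card (cell l))" for l
    proof -
      have "card (cp l) \<le> card (cell l \<times> cell l)"
        by (intro card_mono) (use fin_cell in \<open>auto simp: cp_def\<close>)
      hence "real (card (cp l)) \<le> (real (card (cell l)))\<^sup>2"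
        by (simp add: card_cartesian_product power2_eq_square flip: of_nat_mult)
      thus ?thesis unfolding c_def by (rule real_le_lsqrt[rotated -1]) auto
    qed
    hence "(\<Sum>l\<in>I. c l) \<le> real (\<Sum>l\<in>I. card (cell l))" by (simp add: sum_mono)
    also have "(\<Sum>l\<in>I. card (cell l)) = card (\<Union>l\<in>I. cell l)"
      using I fin_cell by (intro card_UN_disjoint[symmetric]) (auto simp: cell_def)
    also have "(\<Union>l\<in>I. cell l) = S" by (auto simp: I_def cell_def)
    finally show ?thesis by simp
  qed
  define K where "K = {J..<2*J}"
  define N where "N = (\<lambda>u v. {(p, q). p \<in> cell (snd u) \<and> q \<in> cell (snd v) \<and> \<bar>real (fst u) * d p - real (fst v) * d q\<bar> < 1})"
  have fin_N: "finite (N u v)" for u v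
    by (rule finite_subset[of _ "cell (snd u) \<times> cell (snd v)"]) (use fin_cell in \<open>auto simp: N_def\<close>)
  have N: "real (card (N u v)) \<le> 3 * (if \<bar>T * ln (real (fst u)) + real_of_int (snd u) - T * ln (real (fst v)) - real_of_int (snd v)\<bar> \<le> 2
     then c (snd u) * c (snd v) else 0)" if uv: "u \<in> K \<times> I" "v \<in> K \<times> I" for u v
  proof (cases "N u v = {}")
    case True
    thus ?thesis using c0 by simp
  next
    case False
    have k: "real (fst u) \<ge> real J" "real (fst v) \<ge> real J" "real J \<ge> 1" using uv J by (auto simp: K_def)
    from False obtain p q where pq: "p \<in> cell (snd u)" "q \<in> cell (snd v)" "\<bar>real (fst u) * d p - real (fst v) * d q\<bar> < 1"
      by (auto simp: N_def)
    hence S': "p \<in> S" "q \<in> S" "\<lfloor>T * ln (d p)\<rfloor> = snd u" "\<lfloor>T * ln (d q)\<rfloor> = snd v" by (auto simp: cell_def cl_def)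
    have dp: "d p \<ge> B" "d q \<ge> B" using d S' by auto
    \<comment> \<open>ln (a / b) <= a / b - 1 <= 1 / b, and b >= J * B >= T.\<close>
    have ln_diff: "ln a - ln b \<le> 1 / T" if "a - b < 1" "b \<ge> real J * B" "a > 0" for a b
    proof -
      have JB: "real J * B > 0" using B k by simp
      have b: "b > 0" using that(2) JB by linarith
      have "ln a - ln b = ln (a / b)" using b that by (simp add: ln_div)
      also have "\<dots> \<le> a / b - 1" using b that by (intro ln_le_minus_one) auto
      also have "\<dots> = (a - b) / b" using b by (simp add: field_simps)
      also have "\<dots> \<le> 1 / b" using that b by (intro divide_right_mono) auto
      also have "\<dots> \<le> 1 / T" using T b that by (intro divide_left_mono) auto
      finally show ?thesis .
    qed
    have ge: "real (fst u) * d p \<ge> real J * B" "real (fst v) * d q \<ge> real J * B"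
      using k dp B by (auto intro!: mult_mono)
    have JB: "real J * B > 0" using B k by simp
    have lnm: "ln (real (fst u) * d p) = ln (real (fst u)) + ln (d p)" "ln (real (fst v) * d q) = ln (real (fst v)) + ln (d q)"
      using k dp B by (subst ln_mult; auto)+
    have "ln (real (fst u) * d p) - ln (real (fst v) * d q) \<le> 1 / T"
      by (rule ln_diff) (use pq ge JB in linarith)+
    hence 1: "T * (ln (real (fst u)) + ln (d p) - (ln (real (fst v)) + ln (d q))) \<le> 1"
      unfolding lnm using T by (simp add: field_simps)
    have "ln (real (fst v) * d q) - ln (real (fst u) * d p) \<le> 1 / T"
      by (rule ln_diff) (use pq ge JB in linarith)+
    hence 2: "T * (ln (real (fst v)) + ln (d q) - (ln (real (fst u)) + ln (d p))) \<le> 1"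
      unfolding lnm using T by (simp add: field_simps)
    have "T * ln (d p) - 1 < real_of_int (snd u)" "real_of_int (snd u) \<le> T * ln (d p)"
         "T * ln (d q) - 1 < real_of_int (snd v)" "real_of_int (snd v) \<le> T * ln (d q)"
      using S'(3,4) by linarith+
    hence cond: "\<bar>T * ln (real (fst u)) + real_of_int (snd u) - T * ln (real (fst v)) - real_of_int (snd v)\<bar> \<le> 2"
      using 1 2 by (simp add: ring_distribs abs_le_iff)
    \<comment> \<open>Scaling by k >= 1 only spreads a cell, so its self-coincidences are among
      those of the unscaled cell, uniformly in k.\<close>
    have sub: "real (card {(p, q). p \<in> cell l \<and> q \<in> cell l \<and> \<bar>real k * d p - real k * d q\<bar> < 1}) \<le> real (card (cp l))" if "k \<ge> 1" for k l
    proof (intro of_nat_mono card_mono fin_cp)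
      show "{(p, q). p \<in> cell l \<and> q \<in> cell l \<and> \<bar>real k * d p - real k * d q\<bar> < 1} \<subseteq> cp l"
      proof (clarsimp simp: cp_def)
        fix p q assume *: "\<bar>real k * d p - real k * d q\<bar> < 1"
        have "\<bar>d p - d q\<bar> \<le> real k * \<bar>d p - d q\<bar>"
          using mult_right_mono[of 1 "real k" "\<bar>d p - d q\<bar>"] that by simp
        also have "\<dots> = \<bar>real k * d p - real k * d q\<bar>" by (simp add: right_diff_distrib[symmetric] abs_mult)
        also note *
        finally show "\<bar>d p - d q\<bar> < 1" .
      qed
    qed
    have "real (card (N u v)) \<le> 3 * (sqrt (real (card {(p, q). p \<in> cell (snd u) \<and> q \<in> cell (snd u) \<and> \<bar>real (fst u) * d p - real (fst u) * d q\<bar> < 1}))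
        * sqrt (real (card {(p, q). p \<in> cell (snd v) \<and> q \<in> cell (snd v) \<and> \<bar>real (fst v) * d p - real (fst v) * d q\<bar> < 1})))"
      unfolding N_def by (rule close_pairs_card_le[OF fin_cell fin_cell])
    also have "\<dots> \<le> 3 * (c (snd u) * c (snd v))"
      unfolding c_def using k by (intro mult_left_mono mult_mono real_sqrt_le_mono sub) auto
    finally show ?thesis using cond by simp
  qed
  have "{(x, y). x \<in> K \<times> S \<and> y \<in> K \<times> S \<and> \<bar>real (fst x) * d (snd x) - real (fst y) * d (snd y)\<bar> < 1}
      \<subseteq> (\<Union>u\<in>K \<times> I. \<Union>v\<in>K \<times> I. (\<lambda>(p, q). ((fst u, p), (fst v, q))) ` N u v)"
  proof (clarify)
    fix k p k' q assume *: "k \<in> K" "p \<in> S" "k' \<in> K" "q \<in> S" "\<bar>real (fst (k, p)) * d (snd (k, p)) - real (fst (k', q)) * d (snd (k', q))\<bar> < 1"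
    have "(p, q) \<in> N (k, cl p) (k', cl q)" using * by (auto simp: N_def cell_def)
    moreover have "(k, cl p) \<in> K \<times> I" "(k', cl q) \<in> K \<times> I" using * by (auto simp: I_def)
    ultimately show "((k, p), (k', q)) \<in> (\<Union>u\<in>K \<times> I. \<Union>v\<in>K \<times> I. (\<lambda>(p, q). ((fst u, p), (fst v, q))) ` N u v)"
      by force
  qed
  hence "card {(x, y). x \<in> K \<times> S \<and> y \<in> K \<times> S \<and> \<bar>real (fst x) * d (snd x) - real (fst y) * d (snd y)\<bar> < 1}
      \<le> card (\<Union>u\<in>K \<times> I. \<Union>v\<in>K \<times> I. (\<lambda>(p, q). ((fst u, p), (fst v, q))) ` N u v)"
    by (rule card_mono[rotated]) (use I fin_N K_def in auto)
  also have "\<dots> \<le> (\<Sum>u\<in>K \<times> I. card (\<Union>v\<in>K \<times> I. (\<lambda>(p, q). ((fst u, p), (fst v, q))) ` N u v))"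
    by (rule card_UN_le) (use I K_def in auto)
  also have "\<dots> \<le> (\<Sum>u\<in>K \<times> I. \<Sum>v\<in>K \<times> I. card (N u v))"
    by (intro sum_mono order_trans[OF card_UN_le] card_image_le fin_N) (use I K_def in auto)
  finally have "real (card {(x, y). x \<in> K \<times> S \<and> y \<in> K \<times> S \<and> \<bar>real (fst x) * d (snd x) - real (fst y) * d (snd y)\<bar> < 1})
    \<le> (\<Sum>u\<in>K \<times> I. \<Sum>v\<in>K \<times> I. real (card (N u v)))"
    by (simp flip: of_nat_sum)
  also have "\<dots> \<le> (\<Sum>u\<in>K \<times> I. \<Sum>v\<in>K \<times> I. 3 * (if \<bar>T * ln (real (fst u)) + real_of_int (snd u) - T * ln (real (fst v)) - real_of_int (snd v)\<bar> \<le> 2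
     then c (snd u) * c (snd v) else 0))"
    by (intro sum_mono N)
  also have "\<dots> = 3 * resonance_sum T J I c"
    unfolding resonance_sum_def K_def by (simp only: sum_distrib_left)
  finally show ?thesis using that[of I c] I c0 c1 c2 by (simp add: K_def)
qed

subsection \<open>Detecting small gaps by trigonometric polynomials\<close>

lemma dist_int_le: "dist_int y \<le> \<bar>y - real_of_int k\<bar>"
  unfolding dist_int_def by (rule cInf_lower) (auto intro!: bdd_belowI[of _ 0])

lemma dist_int_le_half: "dist_int y \<le> 1 / 2"
  using dist_int_le[of y "round y"] of_int_round_abs_le[of y] by (simp add: abs_minus_commute)

text \<open>A crude slope suffices because pi / 3 > 1. It follows from sin x >= x - x^3/6 and x <=
  2.\<close>

lemma sin_ge_third:
  assumes "0 \<le> x" "x \<le> pi / 2"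
  shows "sin x \<ge> x / 3"
proof -
  have "\<bar>sin x - (\<Sum>m<3. sin_coeff m * x ^ m)\<bar> \<le> inverse (fact 3) * \<bar>x\<bar> ^ 3"
    by (rule Maclaurin_sin_bound)
  hence "\<bar>sin x - x\<bar> \<le> x ^ 3 / 6"
    using assms by (simp add: eval_nat_numeral sin_coeff_def)
  hence "sin x \<ge> x - x ^ 3 / 6" by linarith
  moreover have "x * (x * x) \<le> x * (2 * 2)"
    using assms pi_less_4 by (intro mult_left_mono mult_mono) auto
  ultimately show ?thesis by (simp add: eval_nat_numeral)
qed

lemma cmod_one_minus_iexp_ge: "cmod (1 - iexp (2 * pi * y)) \<ge> 2 * dist_int y"
proof -
  define z where "z = y - real_of_int (round y)"
  have z: "\<bar>z\<bar> \<le> 1 / 2" "dist_int y \<le> \<bar>z\<bar>"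
    using of_int_round_abs_le[of y] dist_int_le[of y "round y"] by (auto simp: z_def abs_minus_commute)
  have "iexp (2 * pi * y) = iexp (2 * pi * z) * exp (2 * of_int (round y) * of_real pi * \<i>)"
    unfolding exp_add[symmetric] z_def by (simp add: algebra_simps)
  also have "exp (2 * of_int (round y) * of_real pi * \<i>) = 1"
    using exp_integer_2pi[of "of_int (round y)"] by (simp add: mult_ac)
  finally have e: "iexp (2 * pi * y) = iexp (2 * pi * z)" by simp
  have "cmod (1 - iexp (2 * pi * z)) = 2 * \<bar>sin (pi * z)\<bar>"
    using dist_exp_i_1[of "2 * pi * z"] by (simp add: norm_minus_commute mult_ac)
  also have "\<bar>sin (pi * z)\<bar> = sin (pi * \<bar>z\<bar>)"
  proof -
    have "sin (pi * \<bar>z\<bar>) \<ge> 0" using z by (intro sin_ge_zero) (auto simp: mult_le_cancel_left2)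
    thus ?thesis by (cases "z \<ge> 0") auto
  qed
  also have "sin (pi * \<bar>z\<bar>) \<ge> pi * \<bar>z\<bar> / 3"
    using z by (intro sin_ge_third) auto
  hence "2 * sin (pi * \<bar>z\<bar>) \<ge> 2 * \<bar>z\<bar>"
    using mult_right_mono[of 3 pi "\<bar>z\<bar>"] pi_gt3 by linarith
  finally show ?thesis using z e by simp
qed

section \<open>Coefficients of squares and powers of trigonometric sums\<close>

lemma norm_square_sum_unit_circle:
  fixes c :: "nat \<Rightarrow> complex"
  assumes z: "cmod z = 1"
  shows "(cmod (\<Sum>k<n. c k * z ^ k))\<^sup>2 = (\<Sum>k<n. (cmod (c k))\<^sup>2) + 2 * Re (\<Sum>k<n. \<Sum>l<k. c k * cnj (c l) * z ^ (k - l))"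
proof (induction n)
  case (Suc n)
  have zz: "z ^ n * cnj (z ^ l) = z ^ (n - l)" if "l < n" for l
  proof -
    have "z ^ n = z ^ (n - l) * z ^ l" using that by (simp add: power_add[symmetric])
    hence "z ^ n * cnj (z ^ l) = z ^ (n - l) * (z ^ l * cnj (z ^ l))" by simp
    also have "z ^ l * cnj (z ^ l) = of_real ((cmod (z ^ l))\<^sup>2)" by (rule complex_norm_square[symmetric])
    finally show ?thesis using z by (simp add: norm_power)
  qed
  define S where "S = (\<Sum>k<n. c k * z ^ k)"
  have "(cmod (S + c n * z ^ n))\<^sup>2 = (cmod S)\<^sup>2 + (cmod (c n * z ^ n))\<^sup>2 + 2 * Re (c n * z ^ n * cnj S)"
  proof -
    have "(cmod (u + v))\<^sup>2 = (cmod u)\<^sup>2 + (cmod v)\<^sup>2 + 2 * Re (v * cnj u)" for u v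
      unfolding cmod_power2 by (simp add: power2_eq_square algebra_simps)
    thus ?thesis .
  qed
  also have "(cmod (c n * z ^ n))\<^sup>2 = (cmod (c n))\<^sup>2" using z by (simp add: norm_mult norm_power)
  also have "c n * z ^ n * cnj S = (\<Sum>l<n. c n * cnj (c l) * (z ^ n * cnj (z ^ l)))"
    by (simp add: S_def cnj_sum sum_distrib_left mult_ac)
  also have "\<dots> = (\<Sum>l<n. c n * cnj (c l) * z ^ (n - l))"
    by (intro sum.cong refl) (use zz in auto)
  finally show ?case
    using Suc by (simp add: S_def algebra_simps)
qed simp

text \<open>\<open>b h\<close> is the h-th autocorrelation of c. Among index pairs with a fixed
  difference each coordinate determines the pair, so after |uv| <= (|u|^2 + |v|^2)/2 both halves are
  at most the diagonal sum.\<close>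

lemma norm_square_trig_sum:
  fixes c :: "nat \<Rightarrow> complex"
  obtains b where "\<And>h. cmod (b h) \<le> (\<Sum>k<n. (cmod (c k))\<^sup>2)"
    "\<And>z. cmod z = 1 \<Longrightarrow> (cmod (\<Sum>k<n. c k * z ^ k))\<^sup>2 = (\<Sum>k<n. (cmod (c k))\<^sup>2) + 2 * Re (\<Sum>h\<in>{1..<n}. b h * z ^ h)"
proof -
  define W where "W = Sigma {..<n} (\<lambda>k. {..<k})"
  define Wh where "Wh = (\<lambda>h. {x \<in> W. fst x - snd x = h})"
  define b where "b = (\<lambda>h. \<Sum>x\<in>Wh h. c (fst x) * cnj (c (snd x)))"
  have fW: "finite W" by (simp add: W_def)
  hence fWh: "finite (Wh h)" for h by (simp add: Wh_def)
  have b: "cmod (b h) \<le> (\<Sum>k<n. (cmod (c k))\<^sup>2)" for h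
  proof -
    have 1: "(\<Sum>x\<in>Wh h. (cmod (c (f x)))\<^sup>2) \<le> (\<Sum>k<n. (cmod (c k))\<^sup>2)" if "inj_on f (Wh h)" "f ` Wh h \<subseteq> {..<n}" for f :: "nat \<times> nat \<Rightarrow> nat"
    proof -
      have "(\<Sum>x\<in>Wh h. (cmod (c (f x)))\<^sup>2) = (\<Sum>k\<in>f ` Wh h. (cmod (c k))\<^sup>2)" using that(1) by (simp add: sum.reindex)
      also have "\<dots> \<le> (\<Sum>k<n. (cmod (c k))\<^sup>2)" using that(2) by (intro sum_mono2) auto
      finally show ?thesis .
    qed
    have "cmod (b h) \<le> (\<Sum>x\<in>Wh h. ((cmod (c (fst x)))\<^sup>2 + (cmod (c (snd x)))\<^sup>2) / 2)"
      unfolding b_def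
    proof (rule sum_norm_le)
      fix x
      show "cmod (c (fst x) * cnj (c (snd x))) \<le> ((cmod (c (fst x)))\<^sup>2 + (cmod (c (snd x)))\<^sup>2) / 2"
        using sum_squares_bound[of "cmod (c (fst x))" "cmod (c (snd x))"] by (simp add: norm_mult)
    qed
    also have "\<dots> = ((\<Sum>x\<in>Wh h. (cmod (c (fst x)))\<^sup>2) + (\<Sum>x\<in>Wh h. (cmod (c (snd x)))\<^sup>2)) / 2"
      by (simp add: sum.distrib sum_divide_distrib[symmetric])
    also have "(\<Sum>x\<in>Wh h. (cmod (c (fst x)))\<^sup>2) \<le> (\<Sum>k<n. (cmod (c k))\<^sup>2)"
      by (rule 1) (auto simp: Wh_def W_def inj_on_def)
    also have "(\<Sum>x\<in>Wh h. (cmod (c (snd x)))\<^sup>2) \<le> (\<Sum>k<n. (cmod (c k))\<^sup>2)"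
      by (rule 1) (auto simp: Wh_def W_def inj_on_def)
    finally show ?thesis by simp
  qed
  have "(cmod (\<Sum>k<n. c k * z ^ k))\<^sup>2 = (\<Sum>k<n. (cmod (c k))\<^sup>2) + 2 * Re (\<Sum>h\<in>{1..<n}. b h * z ^ h)" if z: "cmod z = 1" for z
  proof -
    have "(\<Sum>k<n. \<Sum>l<k. c k * cnj (c l) * z ^ (k - l)) = (\<Sum>x\<in>W. c (fst x) * cnj (c (snd x)) * z ^ (fst x - snd x))"
      unfolding W_def by (subst sum.Sigma) (auto simp: case_prod_beta)
    also have "\<dots> = (\<Sum>h\<in>{1..<n}. \<Sum>x\<in>{x \<in> W. fst x - snd x = h}. c (fst x) * cnj (c (snd x)) * z ^ (fst x - snd x))"
      by (rule sum.group[symmetric, OF fW]) (auto simp: W_def)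
    also have "\<dots> = (\<Sum>h\<in>{1..<n}. b h * z ^ h)"
      by (intro sum.cong refl) (auto simp: b_def Wh_def sum_distrib_right)
    finally show ?thesis by (simp add: norm_square_sum_unit_circle[OF z])
  qed
  with b that show ?thesis by blast
qed

text \<open>Nothing is recorded about the individual coefficients: the detector only evaluates the
  polynomial at 1 and at points away from 1.\<close>

lemma geometric_power_coeffs:
  fixes H r :: nat
  obtains c :: "nat \<Rightarrow> complex" where "\<And>z. (\<Sum>k<r * H + 1. c k * z ^ k) = (\<Sum>j<H. z ^ j) ^ r"
proof -
  define p :: "complex poly" where "p = (\<Sum>j<H. monom 1 j) ^ r"
  have "degree (\<Sum>j<H. monom 1 j :: complex poly) \<le> H"
    by (intro degree_sum_le) (auto intro: order_trans[OF degree_monom_le])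
  hence "degree p \<le> H * r"
    unfolding p_def by (rule order_trans[OF degree_power_le mult_right_mono]) simp
  hence deg: "{..degree p} \<subseteq> {..<r * H + 1}" by (auto simp: mult.commute)
  have "(\<Sum>k<r * H + 1. coeff p k * z ^ k) = (\<Sum>j<H. z ^ j) ^ r" for z
  proof -
    have "(\<Sum>k<r * H + 1. coeff p k * z ^ k) = (\<Sum>k\<le>degree p. coeff p k * z ^ k)"
      by (rule sum.mono_neutral_right[OF _ deg]) (auto simp: not_le intro!: coeff_eq_0)
    also have "\<dots> = poly p z" by (simp add: poly_altdef)
    also have "\<dots> = (\<Sum>j<H. z ^ j) ^ r" by (simp add: p_def poly_sum poly_monom)
    finally show ?thesis .
  qed
  with that show ?thesis by blast
qed

text \<open>A power of the Fejer kernel, normalised to mean 1: it is tiny away from the integers,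
  so its nonconstant part must be close to \<open>- 1\<close> there.\<close>

lemma fejer_power_detector:
  fixes H r :: nat
  assumes H: "H \<ge> 1"
  obtains b :: "nat \<Rightarrow> complex" where "\<And>h. cmod (b h) \<le> 1"
    "\<And>y \<eta>. \<lbrakk>\<eta> > 0; dist_int y \<ge> \<eta>\<rbrakk> \<Longrightarrow>
      1 + 2 * Re (\<Sum>h\<in>{1..<r * H + 1}. b h * iexp (2 * pi * real h * y)) \<le> real (r * H + 1) * (1 / (\<eta> * real H)) ^ (2 * r)"
proof -
  define n where "n = r * H + 1"
  obtain c :: "nat \<Rightarrow> complex" where c: "\<And>z. (\<Sum>k<n. c k * z ^ k) = (\<Sum>j<H. z ^ j) ^ r"
    using geometric_power_coeffs[where H=H and r=r] unfolding n_def by metis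
  define a0 where "a0 = (\<Sum>k<n. (cmod (c k))\<^sup>2)"
  \<comment> \<open>Lower bound for the mean: the value H^r at z = 1 is a sum of n coefficients, and
    Cauchy-Schwarz loses the factor n that appears in the conclusion. The large power 2r compensates
    for it later.\<close>
  have a0: "real H ^ (2 * r) \<le> real n * a0"
  proof -
    have "real H ^ r = cmod (\<Sum>k<n. c k * 1 ^ k)" unfolding c by (simp add: norm_power)
    also have "\<dots> \<le> (\<Sum>k<n. cmod (c k) * 1)" by (rule sum_norm_le) simp
    finally have "(real H ^ r)\<^sup>2 \<le> (\<Sum>k<n. cmod (c k) * 1)\<^sup>2" by (intro power_mono) auto
    also have "\<dots> \<le> (\<Sum>k<n. (cmod (c k))\<^sup>2) * (\<Sum>k<n. 1\<^sup>2)" by (rule Cauchy_Schwarz_ineq_sum)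
    finally show ?thesis by (simp add: a0_def power_mult[symmetric] mult.commute)
  qed
  have a0': "a0 > 0"
  proof -
    have "0 < real n * a0" using a0 H by (intro less_le_trans[OF _ a0]) auto
    thus ?thesis by (simp add: zero_less_mult_iff)
  qed
  obtain b where b: "\<And>h. cmod (b h) \<le> a0"
    "\<And>z. cmod z = 1 \<Longrightarrow> (cmod (\<Sum>k<n. c k * z ^ k))\<^sup>2 = a0 + 2 * Re (\<Sum>h\<in>{1..<n}. b h * z ^ h)"
    using norm_square_trig_sum[of c n, folded a0_def] by blast
  have ub: "1 + 2 * Re (\<Sum>h\<in>{1..<n}. (b h / of_real a0) * iexp (2 * pi * real h * y)) \<le> real n * (1 / (\<eta> * real H)) ^ (2 * r)"
    if \<eta>: "\<eta> > 0" and y: "dist_int y \<ge> \<eta>" for y \<eta>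
  proof -
    define z where "z = iexp (2 * pi * y)"
    have z1: "cmod z = 1" by (simp add: z_def)
    have zh: "iexp (2 * pi * real h * y) = z ^ h" for h
      by (simp add: z_def exp_of_nat_mult[symmetric] mult_ac)
    have d: "cmod (1 - z) \<ge> 2 * \<eta>" using cmod_one_minus_iexp_ge[of y] y by (simp add: z_def)
    hence "z \<noteq> 1" using \<eta> by auto
    hence "cmod (\<Sum>j<H. z ^ j) = cmod (1 - z ^ H) / cmod (1 - z)"
      by (simp add: sum_gp_strict norm_divide)
    also have "\<dots> \<le> 2 / (2 * \<eta>)"
    proof (rule frac_le)
      show "cmod (1 - z ^ H) \<le> 2" using norm_triangle_ineq4[of 1 "z ^ H"] z1 by (simp add: norm_power)
    qed (use d \<eta> in auto)
    finally have "cmod (\<Sum>j<H. z ^ j) \<le> 1 / \<eta>" by simp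
    hence "(cmod (\<Sum>j<H. z ^ j)) ^ (2 * r) \<le> (1 / \<eta>) ^ (2 * r)" by (intro power_mono) auto
    hence "(cmod (\<Sum>k<n. c k * z ^ k))\<^sup>2 \<le> (1 / \<eta>) ^ (2 * r)"
      unfolding c by (simp add: norm_power power_mult[symmetric] mult.commute)
    hence "a0 + 2 * Re (\<Sum>h\<in>{1..<n}. b h * z ^ h) \<le> (1 / \<eta>) ^ (2 * r)"
      using b(2)[OF z1] by simp
    hence "(a0 + 2 * Re (\<Sum>h\<in>{1..<n}. b h * z ^ h)) / a0 \<le> (1 / \<eta>) ^ (2 * r) / a0"
      using a0' by (intro divide_right_mono) auto
    also have "\<dots> \<le> (1 / \<eta>) ^ (2 * r) * (real n / real H ^ (2 * r))"
    proof -
      have "1 / a0 \<le> real n / real H ^ (2 * r)" using a0 a0' H by (simp add: field_simps)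
      hence "(1 / \<eta>) ^ (2 * r) * (1 / a0) \<le> (1 / \<eta>) ^ (2 * r) * (real n / real H ^ (2 * r))"
        using \<eta> by (intro mult_left_mono) auto
      thus ?thesis by simp
    qed
    also have "\<dots> = real n * (1 / (\<eta> * real H)) ^ (2 * r)" by (simp add: power_divide power_mult_distrib)
    also have "(a0 + 2 * Re (\<Sum>h\<in>{1..<n}. b h * z ^ h)) / a0 = 1 + 2 * Re (\<Sum>h\<in>{1..<n}. (b h / of_real a0) * z ^ h)"
    proof -
      have "(\<Sum>h\<in>{1..<n}. (b h / of_real a0) * z ^ h) = (\<Sum>h\<in>{1..<n}. b h * z ^ h) / of_real a0"
        by (simp add: sum_divide_distrib)
      thus ?thesis using a0' by (simp add: add_divide_distrib Re_divide_of_real)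
    qed
    finally show ?thesis unfolding zh .
  qed
  show ?thesis
    by (rule that[of "\<lambda>h. b h / of_real a0"]) (use b(1) a0' ub in \<open>auto simp: norm_divide n_def\<close>)
qed

lemma delta_min_le:
  assumes "i \<in> {1..N}" "j \<in> {1..N}" "i \<noteq> j"
  shows "delta_min x \<alpha> N \<le> dist_int (\<alpha> * (x i - x j))"
  unfolding delta_min_def
proof (rule Min_le)
  have "{dist_int (\<alpha> * x m - \<alpha> * x n) |m n. m \<in> {1..N} \<and> n \<in> {1..N} \<and> m \<noteq> n} \<subseteq> (\<lambda>(m, n). dist_int (\<alpha> * x m - \<alpha> * x n)) ` ({1..N} \<times> {1..N})"
    by auto
  thus "finite {dist_int (\<alpha> * x m - \<alpha> * x n) |m n. m \<in> {1..N} \<and> n \<in> {1..N} \<and> m \<noteq> n}"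
    by (rule finite_subset) auto
  show "dist_int (\<alpha> * (x i - x j)) \<in> {dist_int (\<alpha> * x m - \<alpha> * x n) |m n. m \<in> {1..N} \<and> n \<in> {1..N} \<and> m \<noteq> n}"
    using assms by (auto simp: right_diff_distrib)
qed

section \<open>Second moments over dyadic blocks\<close>

lemma norm_sum_square_le:
  fixes f :: "'a \<Rightarrow> complex"
  shows "(cmod (\<Sum>i\<in>I. f i))\<^sup>2 \<le> real (card I) * (\<Sum>i\<in>I. (cmod (f i))\<^sup>2)"
proof -
  have "cmod (\<Sum>i\<in>I. f i) \<le> (\<Sum>i\<in>I. 1 * cmod (f i))" by (rule sum_norm_le) simp
  hence "(cmod (\<Sum>i\<in>I. f i))\<^sup>2 \<le> (\<Sum>i\<in>I. 1 * cmod (f i))\<^sup>2" by (intro power_mono) auto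
  also have "\<dots> \<le> (\<Sum>i\<in>I. 1\<^sup>2) * (\<Sum>i\<in>I. (cmod (f i))\<^sup>2)" by (rule Cauchy_Schwarz_ineq_sum)
  finally show ?thesis by simp
qed

definition near_count :: "nat \<Rightarrow> 'p set \<Rightarrow> ('p \<Rightarrow> real) \<Rightarrow> nat" where
  "near_count J S d = card {(x, y). x \<in> {J..<2*J} \<times> S \<and> y \<in> {J..<2*J} \<times> S \<and> \<bar>real (fst x) * d (snd x) - real (fst y) * d (snd y)\<bar> < 1}"

text \<open>Pairs at distance at least 1 have kernel at most exp (-2 pi^2 \<sigma>^2), hence at most
  exp (-\<sigma>^2). The others are merely counted, as |b| <= 1 bounds their contribution by
  1.\<close>

lemma dyadic_block_integral_le:
  fixes d :: "'p \<Rightarrow> real" and b :: "nat \<Rightarrow> complex" and J :: nat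
  assumes S: "finite S" and b: "\<And>h. cmod (b h) \<le> 1" and \<sigma>: "\<sigma> > 0"
  defines "F \<equiv> \<lambda>t. (cmod (\<Sum>x\<in>{J..<2*J} \<times> S. b (fst x) * iexp (2 * pi * real (fst x) * d (snd x) * t)))\<^sup>2 * exp (- t\<^sup>2 / (2 * \<sigma>\<^sup>2))"
  shows "integrable lborel F"
    "integral\<^sup>L lborel F \<le> \<sigma> * sqrt (2 * pi) * (real (near_count J S d) + (real J * real (card S))\<^sup>2 * exp (- \<sigma>\<^sup>2))"
proof -
  define \<Omega> where "\<Omega> = {J..<2*J} \<times> S"
  define \<theta> where "\<theta> = (\<lambda>x. 2 * pi * real (fst x) * d (snd x))"
  have fin: "finite \<Omega>" using S by (simp add: \<Omega>_def)
  have F: "F = (\<lambda>t. (cmod (\<Sum>x\<in>\<Omega>. b (fst x) * iexp (\<theta> x * t)))\<^sup>2 * exp (- t\<^sup>2 / (2 * \<sigma>\<^sup>2)))"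
    by (simp add: F_def \<Omega>_def \<theta>_def)
  show "integrable lborel F" unfolding F by (rule gauss_quadratic_form(1)[OF \<sigma> fin])
  define near where "near = (\<lambda>x y. \<bar>real (fst x) * d (snd x) - real (fst y) * d (snd y)\<bar> < 1)"
  have "integral\<^sup>L lborel F = \<sigma> * sqrt (2 * pi) * (\<Sum>x\<in>\<Omega>. \<Sum>y\<in>\<Omega>. Re (b (fst x) * cnj (b (fst y))) * exp (- (\<sigma> * (\<theta> x - \<theta> y))\<^sup>2 / 2))"
    unfolding F by (rule gauss_quadratic_form(2)[OF \<sigma> fin])
  also have "\<dots> \<le> \<sigma> * sqrt (2 * pi) * (\<Sum>x\<in>\<Omega>. \<Sum>y\<in>\<Omega>. of_bool (near x y) + exp (- \<sigma>\<^sup>2))"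
  proof (intro mult_left_mono sum_mono)
    fix x y
    define \<Delta> where "\<Delta> = real (fst x) * d (snd x) - real (fst y) * d (snd y)"
    have \<theta>: "\<theta> x - \<theta> y = 2 * pi * \<Delta>" by (simp add: \<theta>_def \<Delta>_def algebra_simps)
    have "Re (b (fst x) * cnj (b (fst y))) \<le> cmod (b (fst x)) * cmod (b (fst y))"
      using complex_Re_le_cmod[of "b (fst x) * cnj (b (fst y))"] by (simp add: norm_mult)
    also have "\<dots> \<le> 1 * 1" using b by (intro mult_mono) auto
    finally have re: "Re (b (fst x) * cnj (b (fst y))) \<le> 1" by simp
    hence 1: "Re (b (fst x) * cnj (b (fst y))) * exp (- (\<sigma> * (\<theta> x - \<theta> y))\<^sup>2 / 2) \<le> exp (- (\<sigma> * (\<theta> x - \<theta> y))\<^sup>2 / 2)"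
      by (metis exp_ge_zero mult_left_le mult.commute)
    also have "\<dots> \<le> of_bool (near x y) + exp (- \<sigma>\<^sup>2)"
    proof (cases "near x y")
      case False
      hence "1 \<le> \<bar>\<Delta>\<bar>" by (simp add: near_def \<Delta>_def)
      hence "1 \<le> \<Delta>\<^sup>2" by (simp add: abs_le_square_iff[of 1 \<Delta>, simplified])
      moreover have "(3::real) * 3 \<le> pi * pi" using pi_gt3 by (intro mult_mono) auto
      ultimately have "1 * 1 \<le> (pi * pi * 2) * \<Delta>\<^sup>2" by (intro mult_mono) auto
      hence "\<sigma>\<^sup>2 * 1 \<le> \<sigma>\<^sup>2 * ((pi * pi * 2) * \<Delta>\<^sup>2)" by (intro mult_left_mono) auto
      also have "\<dots> = (\<sigma> * (\<theta> x - \<theta> y))\<^sup>2 / 2" unfolding \<theta> by (simp add: power2_eq_square)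
      finally show ?thesis using False by simp
    qed (auto intro!: add_increasing2)
    finally show "Re (b (fst x) * cnj (b (fst y))) * exp (- (\<sigma> * (\<theta> x - \<theta> y))\<^sup>2 / 2) \<le> of_bool (near x y) + exp (- \<sigma>\<^sup>2)" .
  qed (use \<sigma> in auto)
  also have "(\<Sum>x\<in>\<Omega>. \<Sum>y\<in>\<Omega>. of_bool (near x y) + exp (- \<sigma>\<^sup>2)) = real (near_count J S d) + (real J * real (card S))\<^sup>2 * exp (- \<sigma>\<^sup>2)"
  proof -
    have "(\<Sum>x\<in>\<Omega>. \<Sum>y\<in>\<Omega>. of_bool (near x y)) = (\<Sum>z\<in>\<Omega> \<times> \<Omega>. of_bool (near (fst z) (snd z)))"
      by (simp add: sum.cartesian_product case_prod_beta)
    also have "\<dots> = real (card {z \<in> \<Omega> \<times> \<Omega>. near (fst z) (snd z)})"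
      using fin by (simp add: of_bool_def sum.If_cases Int_def conj_commute)
    also have "{z \<in> \<Omega> \<times> \<Omega>. near (fst z) (snd z)} = {(x, y). x \<in> {J..<2*J} \<times> S \<and> y \<in> {J..<2*J} \<times> S \<and> \<bar>real (fst x) * d (snd x) - real (fst y) * d (snd y)\<bar> < 1}"
      by (auto simp: \<Omega>_def near_def)
    finally have "(\<Sum>x\<in>\<Omega>. \<Sum>y\<in>\<Omega>. of_bool (near x y)) = real (near_count J S d)"
      by (simp add: near_count_def)
    moreover have "(\<Sum>x\<in>\<Omega>. \<Sum>y\<in>\<Omega>. exp (- \<sigma>\<^sup>2)) = (real J * real (card S))\<^sup>2 * exp (- \<sigma>\<^sup>2)"
      by (simp add: \<Omega>_def card_cartesian_product power2_eq_square)
    ultimately show ?thesis by (simp add: sum.distrib)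
  qed
  finally show "integral\<^sup>L lborel F \<le> \<sigma> * sqrt (2 * pi) * (real (near_count J S d) + (real J * real (card S))\<^sup>2 * exp (- \<sigma>\<^sup>2))" .
qed

text \<open>Chebyshev on [-\<sigma>, \<sigma>], where the Gaussian weight is at least exp (-1). The
  frequencies are cut into L dyadic blocks because coincidences are counted inside one block;
  Cauchy-Schwarz over the blocks costs the factor L.\<close>

lemma large_values_measure_le:
  fixes d :: "'p \<Rightarrow> real" and b :: "nat \<Rightarrow> complex" and L :: nat
  assumes S: "finite S" and b: "\<And>h. cmod (b h) \<le> 1" and \<sigma>: "\<sigma> > 0" and \<tau>: "\<tau> > 0"
  defines "F \<equiv> \<lambda>t. \<Sum>x\<in>{1..<2 ^ L} \<times> S. b (fst x) * iexp (2 * pi * real (fst x) * d (snd x) * t)"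
  defines "X \<equiv> {t. t \<in> {-\<sigma>..\<sigma>} \<and> \<tau> \<le> cmod (F t)}"
  shows "X \<in> sets lborel" "emeasure lborel X < \<infinity>"
    "measure lborel X \<le> exp 1 * 3 / \<tau>\<^sup>2 * \<sigma> * real L * (\<Sum>j<L. real (near_count (2 ^ j) S d) + (2 ^ j * real (card S))\<^sup>2 * exp (- \<sigma>\<^sup>2))"
proof -
  define w where "w = (\<lambda>t. exp (- t\<^sup>2 / (2 * \<sigma>\<^sup>2)))"
  define Fj where "Fj = (\<lambda>j t. \<Sum>x\<in>{2^j..<2*2^j} \<times> S. b (fst x) * iexp (2 * pi * real (fst x) * d (snd x) * t))"
  have [measurable]: "F \<in> borel_measurable borel" unfolding F_def by measurable
  show X: "X \<in> sets lborel" unfolding X_def by measurable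
  have "emeasure lborel X \<le> emeasure lborel {-\<sigma>..\<sigma>}" by (rule emeasure_mono) (auto simp: X_def)
  also have "\<dots> < \<infinity>" using \<sigma> by (simp add: emeasure_lborel_Icc)
  finally show Xf: "emeasure lborel X < \<infinity>" .
  have FF: "F t = (\<Sum>j<L. Fj j t)" for t
  proof -
    have "{1..<2 ^ L} \<times> S = (\<Union>j<L. {2^j..<2*2^j::nat} \<times> S)"
    proof (induction L)
      case (Suc L)
      have "{1..<2 ^ Suc L::nat} = {1..<2 ^ L} \<union> {2^L..<2*2^L}" by auto
      thus ?case using Suc by (simp add: lessThan_Suc Sigma_Un_distrib1 Un_commute)
    qed auto
    moreover have "({2^i..<2*2^i::nat} \<times> S) \<inter> ({2^j..<2*2^j} \<times> S) = {}" if "i < j" for i j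
    proof -
      have "(2::nat) ^ Suc i \<le> 2 ^ j" using that by (intro power_increasing) auto
      thus ?thesis by auto
    qed
    hence "({2^i..<2*2^i::nat} \<times> S) \<inter> ({2^j..<2*2^j} \<times> S) = {}" if "i \<noteq> j" for i j
      using that by (metis inf_commute linorder_neqE_nat)
    ultimately show ?thesis
      unfolding F_def Fj_def using S by (simp add: sum.UNION_disjoint)
  qed
  have int: "integrable lborel (\<lambda>t. (cmod (Fj j t))\<^sup>2 * w t)"
    "integral\<^sup>L lborel (\<lambda>t. (cmod (Fj j t))\<^sup>2 * w t) \<le> \<sigma> * sqrt (2 * pi) * (real (near_count (2 ^ j) S d) + (2 ^ j * real (card S))\<^sup>2 * exp (- \<sigma>\<^sup>2))" for j
    using dyadic_block_integral_le[OF S b \<sigma>, where J="2 ^ j" and d=d] by (auto simp: Fj_def w_def)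
  have pw: "indicator X t * \<tau>\<^sup>2 \<le> exp 1 * real L * (\<Sum>j<L. (cmod (Fj j t))\<^sup>2 * w t)" for t
  proof (cases "t \<in> X")
    case True
    hence t: "\<bar>t\<bar> \<le> \<sigma>" "\<tau> \<le> cmod (F t)" by (auto simp: X_def)
    have "\<tau>\<^sup>2 \<le> (cmod (F t))\<^sup>2" using t \<tau> by (intro power_mono) auto
    also have "\<dots> \<le> real L * (\<Sum>j<L. (cmod (Fj j t))\<^sup>2)"
      unfolding FF using norm_sum_square_le[of "\<lambda>j. Fj j t" "{..<L}"] by simp
    finally have 1: "\<tau>\<^sup>2 \<le> real L * (\<Sum>j<L. (cmod (Fj j t))\<^sup>2)" .
    have "t\<^sup>2 \<le> \<sigma>\<^sup>2" using t(1) \<sigma> by (metis abs_le_square_iff abs_of_pos)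
    hence "t\<^sup>2 \<le> 2 * \<sigma>\<^sup>2" using zero_le_power2[of \<sigma>] by linarith
    hence "- 1 \<le> - t\<^sup>2 / (2 * \<sigma>\<^sup>2)" using \<sigma> by (simp add: field_simps)
    hence "exp (- 1) \<le> w t" by (simp add: w_def)
    hence "1 \<le> exp 1 * w t" by (simp add: exp_minus field_simps)
    from mult_mono[OF 1 this] have "\<tau>\<^sup>2 \<le> (real L * (\<Sum>j<L. (cmod (Fj j t))\<^sup>2)) * (exp 1 * w t)"
      by (simp add: sum_nonneg)
    also have "\<dots> = exp 1 * real L * (\<Sum>j<L. (cmod (Fj j t))\<^sup>2 * w t)" by (simp add: sum_distrib_left mult_ac)
    finally show ?thesis using True by simp
  next
    case False
    thus ?thesis by (auto simp: w_def intro!: mult_nonneg_nonneg sum_nonneg)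
  qed
  have "integrable lborel (\<lambda>t. indicator X t * \<tau>\<^sup>2)"
    using X Xf by (intro integrable_mult_left integrable_real_indicator) auto
  moreover have "integrable lborel (\<lambda>t. exp 1 * real L * (\<Sum>j<L. (cmod (Fj j t))\<^sup>2 * w t))"
    by (intro integrable_mult_right Bochner_Integration.integrable_sum int)
  ultimately have "(\<integral>t. indicator X t * \<tau>\<^sup>2 \<partial>lborel) \<le> (\<integral>t. exp 1 * real L * (\<Sum>j<L. (cmod (Fj j t))\<^sup>2 * w t) \<partial>lborel)"
    using pw by (intro integral_mono) auto
  also have "(\<integral>t. exp 1 * real L * (\<Sum>j<L. (cmod (Fj j t))\<^sup>2 * w t) \<partial>lborel) = exp 1 * real L * (\<Sum>j<L. \<integral>t. (cmod (Fj j t))\<^sup>2 * w t \<partial>lborel)"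
    unfolding integral_mult_right_zero using int by (subst Bochner_Integration.integral_sum) auto
  also have "\<dots> \<le> exp 1 * real L * (\<Sum>j<L. \<sigma> * sqrt (2 * pi) * (real (near_count (2 ^ j) S d) + (2 ^ j * real (card S))\<^sup>2 * exp (- \<sigma>\<^sup>2)))"
    by (intro mult_left_mono sum_mono int) auto
  also have "\<dots> = sqrt (2 * pi) * (exp 1 * \<sigma> * real L * (\<Sum>j<L. real (near_count (2 ^ j) S d) + (2 ^ j * real (card S))\<^sup>2 * exp (- \<sigma>\<^sup>2)))"
    by (simp add: sum_distrib_left mult_ac)
  also have "\<dots> \<le> 3 * (exp 1 * \<sigma> * real L * (\<Sum>j<L. real (near_count (2 ^ j) S d) + (2 ^ j * real (card S))\<^sup>2 * exp (- \<sigma>\<^sup>2)))"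
  proof (rule mult_right_mono)
    show "sqrt (2 * pi) \<le> 3" using pi_less_4 by (intro real_le_lsqrt) auto
  qed (use \<sigma> in \<open>auto intro!: mult_nonneg_nonneg sum_nonneg\<close>)
  finally have "measure lborel X * \<tau>\<^sup>2 \<le> 3 * (exp 1 * \<sigma> * real L * (\<Sum>j<L. real (near_count (2 ^ j) S d) + (2 ^ j * real (card S))\<^sup>2 * exp (- \<sigma>\<^sup>2)))"
    by simp
  thus "measure lborel X \<le> exp 1 * 3 / \<tau>\<^sup>2 * \<sigma> * real L * (\<Sum>j<L. real (near_count (2 ^ j) S d) + (2 ^ j * real (card S))\<^sup>2 * exp (- \<sigma>\<^sup>2))"
    using \<tau> by (simp add: field_simps)
qed

subsection \<open>Additive energy and far pairs\<close>

text \<open>Regroup (x a - x b) - (x c - x d) as (x a + x d) - (x b + x c); this rearrangement of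
  indices is injective.\<close>

lemma close_differences_le_energy:
  assumes W: "W \<subseteq> {1..N} \<times> {1..N}"
  shows "card {(p, q). p \<in> W \<and> q \<in> W \<and> \<bar>(x (fst p) - x (snd p)) - (x (fst q) - x (snd q))\<bar> < 1} \<le> add_energy x N"
  unfolding add_energy_def
proof (rule card_inj_on_le[where f = "\<lambda>(p, q). (fst p, snd q, snd p, fst q)"])
  show "inj_on (\<lambda>(p, q). (fst p, snd q, snd p, fst q)) {(p, q). p \<in> W \<and> q \<in> W \<and> \<bar>(x (fst p) - x (snd p)) - (x (fst q) - x (snd q))\<bar> < 1}"
    by (auto simp: inj_on_def)
  show "(\<lambda>(p, q). (fst p, snd q, snd p, fst q)) ` {(p, q). p \<in> W \<and> q \<in> W \<and> \<bar>(x (fst p) - x (snd p)) - (x (fst q) - x (snd q))\<bar> < 1} \<subseteq>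
     {(n1, n2, n3, n4). n1 \<in> {1..N} \<and> n2 \<in> {1..N} \<and> n3 \<in> {1..N} \<and> n4 \<in> {1..N} \<and> \<bar>x n1 + x n2 - x n3 - x n4\<bar> < 1}"
  proof (rule image_subsetI)
    fix z assume "z \<in> {(p, q). p \<in> W \<and> q \<in> W \<and> \<bar>(x (fst p) - x (snd p)) - (x (fst q) - x (snd q))\<bar> < 1}"
    then obtain p q where z: "z = (p, q)" "p \<in> W" "q \<in> W" "\<bar>(x (fst p) - x (snd p)) - (x (fst q) - x (snd q))\<bar> < 1" by blast
    have "p \<in> {1..N} \<times> {1..N}" "q \<in> {1..N} \<times> {1..N}" using z W by blast+
    moreover have "(x (fst p) - x (snd p)) - (x (fst q) - x (snd q)) = x (fst p) + x (snd q) - x (snd p) - x (fst q)" by simp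
    ultimately show "(\<lambda>(p, q). (fst p, snd q, snd p, fst q)) z \<in> {(n1, n2, n3, n4). n1 \<in> {1..N} \<and> n2 \<in> {1..N} \<and> n3 \<in> {1..N} \<and> n4 \<in> {1..N} \<and> \<bar>x n1 + x n2 - x n3 - x n4\<bar> < 1}"
      using z by (simp add: mem_Times_iff)
  qed
  show "finite {(n1, n2, n3, n4). n1 \<in> {1..N} \<and> n2 \<in> {1..N} \<and> n3 \<in> {1..N} \<and> n4 \<in> {1..N} \<and> \<bar>x n1 + x n2 - x n3 - x n4\<bar> < 1}"
    by (rule finite_subset[of _ "{1..N} \<times> {1..N} \<times> {1..N} \<times> {1..N}"]) auto
qed

definition far_pairs :: "(nat \<Rightarrow> real) \<Rightarrow> nat \<Rightarrow> real \<Rightarrow> (nat \<times> nat) set" where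
  "far_pairs x N B = {p \<in> {1..N} \<times> {1..N}. snd p < fst p \<and> x (fst p) - x (snd p) \<ge> B}"

text \<open>Differences in (0, B) have at most B + 1 different floors, and two pairs with the same
  floor are counted by the energy. Cauchy-Schwarz over the floors then shows that an energy near N^2
  forbids many small differences.\<close>

lemma near_pairs_card_le:
  fixes N :: nat
  assumes inc: "\<And>i j. 1 \<le> i \<Longrightarrow> i < j \<Longrightarrow> x i < x j" and B: "B \<ge> 0"
  defines "P \<equiv> {p \<in> {1..N} \<times> {1..N}. snd p < fst p \<and> x (fst p) - x (snd p) < B}"
  shows "(real (card P))\<^sup>2 \<le> (B + 1) * real (add_energy x N)"
proof -
  define f where "f = (\<lambda>p. \<lfloor>x (fst p) - x (snd p)\<rfloor>)"
  define V where "V = {0..\<lfloor>B\<rfloor>}"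
  have fP: "finite P" unfolding P_def by (rule finite_subset[of _ "{1..N} \<times> {1..N}"]) auto
  have img: "f ` P \<subseteq> V"
  proof
    fix v assume "v \<in> f ` P"
    then obtain p where p: "p \<in> P" "v = f p" by blast
    hence "0 < x (fst p) - x (snd p)" "x (fst p) - x (snd p) < B" using inc[of "snd p" "fst p"] by (auto simp: P_def)
    hence "0 \<le> f p" "f p \<le> \<lfloor>B\<rfloor>" unfolding f_def by (simp, intro floor_mono, simp)
    thus "v \<in> V" using p by (simp add: V_def)
  qed
  have "card P = (\<Sum>v\<in>V. card {p \<in> P. f p = v})"
    using sum.group[OF fP _ img, of "\<lambda>_. 1::nat"] by (simp add: V_def)
  hence "real (card P) = (\<Sum>v\<in>V. 1 * real (card {p \<in> P. f p = v}))" by simp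
  hence "(real (card P))\<^sup>2 \<le> (\<Sum>v\<in>V. 1\<^sup>2) * (\<Sum>v\<in>V. (real (card {p \<in> P. f p = v}))\<^sup>2)"
    using Cauchy_Schwarz_ineq_sum[of "\<lambda>_. 1" "\<lambda>v. real (card {p \<in> P. f p = v})" V] by simp
  also have "(\<Sum>v\<in>V. 1\<^sup>2) \<le> B + 1"
    using B by (simp add: V_def)
  also have "(\<Sum>v\<in>V. (real (card {p \<in> P. f p = v}))\<^sup>2) = real (\<Sum>v\<in>V. card ({p \<in> P. f p = v} \<times> {p \<in> P. f p = v}))"
    by (simp add: card_cartesian_product power2_eq_square)
  also have "(\<Sum>v\<in>V. card ({p \<in> P. f p = v} \<times> {p \<in> P. f p = v})) = card (\<Union>v\<in>V. {p \<in> P. f p = v} \<times> {p \<in> P. f p = v})"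
    using fP by (intro card_UN_disjoint[symmetric]) (auto simp: V_def)
  also have "\<dots> \<le> card {(p, q). p \<in> P \<and> q \<in> P \<and> \<bar>(x (fst p) - x (snd p)) - (x (fst q) - x (snd q))\<bar> < 1}"
  proof (rule card_mono)
    show "finite {(p, q). p \<in> P \<and> q \<in> P \<and> \<bar>(x (fst p) - x (snd p)) - (x (fst q) - x (snd q))\<bar> < 1}"
      by (rule finite_subset[of _ "P \<times> P"]) (use fP in auto)
    have fl: "\<bar>a - b\<bar> < 1" if "\<lfloor>a\<rfloor> = \<lfloor>b\<rfloor>" for a b :: real using that by linarith
    show "(\<Union>v\<in>V. {p \<in> P. f p = v} \<times> {p \<in> P. f p = v}) \<subseteq> {(p, q). p \<in> P \<and> q \<in> P \<and> \<bar>(x (fst p) - x (snd p)) - (x (fst q) - x (snd q))\<bar> < 1}"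
      unfolding f_def by (auto intro!: fl)
  qed
  also have "\<dots> \<le> add_energy x N" by (rule close_differences_le_energy) (auto simp: P_def)
  finally show ?thesis using B by (simp add: mult_left_mono mult_right_mono sum_nonneg)
qed

lemma card_ordered_pairs: "card {p \<in> {1..N} \<times> {1..N}. snd p < fst p} = N * (N - 1) div 2" for N :: nat
proof -
  have "{p \<in> {1..N} \<times> {1..N}. snd p < fst p} = (\<lambda>(a, b). (a, b)) ` (Sigma {1..N} (\<lambda>a. {1..<a}))" by force
  also have "card \<dots> = (\<Sum>a=1..N. a - 1)" by (subst card_image) (auto simp: inj_on_def)
  finally have "card {p \<in> {1..N} \<times> {1..N}. snd p < fst p} = (\<Sum>a=1..N. a - 1)" .
  moreover have "2 * (\<Sum>a=1..N. a - 1) = N * (N - 1)"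
  proof (induction N)
    case (Suc n)
    thus ?case by (cases n) (auto simp: algebra_simps)
  qed simp
  ultimately show ?thesis by simp
qed

text \<open>The hypothesis leaves at most N^2/8 small differences, and N(N-1)/2 >= 3N^2/8 for N >=
  4.\<close>

lemma far_pairs_card_ge:
  assumes inc: "\<And>i j. 1 \<le> i \<Longrightarrow> i < j \<Longrightarrow> x i < x j" and B: "B \<ge> 0" and N: "N \<ge> 4"
    and en: "(B + 1) * real (add_energy x N) \<le> (real N ^ 2 / 8)\<^sup>2"
  shows "real (card (far_pairs x N B)) \<ge> real N ^ 2 / 4"
proof -
  define P where "P = {p \<in> {1..N} \<times> {1..N}. snd p < fst p \<and> x (fst p) - x (snd p) < B}"
  have fin: "finite P" "finite (far_pairs x N B)"
    unfolding P_def far_pairs_def by (rule finite_subset[of _ "{1..N} \<times> {1..N}"]; auto)+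
  have "{p \<in> {1..N} \<times> {1..N}. snd p < fst p} = P \<union> far_pairs x N B" by (auto simp: P_def far_pairs_def)
  hence "card {p \<in> {1..N} \<times> {1..N}. snd p < fst p} \<le> card P + card (far_pairs x N B)"
    by (metis card_Un_le)
  hence "N * (N - 1) div 2 \<le> card P + card (far_pairs x N B)" by (simp only: card_ordered_pairs)
  moreover have "real (N * (N - 1) div 2) = real N * (real N - 1) / 2"
  proof -
    have "even (N * (N - 1))" by (cases N) auto
    thus ?thesis using N by (simp add: real_of_nat_div of_nat_diff)
  qed
  ultimately have 1: "real N * (real N - 1) / 2 \<le> real (card P) + real (card (far_pairs x N B))"
    by (metis of_nat_add of_nat_mono)
  have "(real (card P))\<^sup>2 \<le> (real N ^ 2 / 8)\<^sup>2"
    using near_pairs_card_le[where x = x and B = B and N = N, OF inc B] en unfolding P_def by linarith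
  hence 2: "real (card P) \<le> real N ^ 2 / 8" by (rule power2_le_imp_le) auto
  have "4 * real N \<le> real N * real N" using N by (intro mult_right_mono) auto
  thus ?thesis using 1 2 by (simp add: power2_eq_square field_simps)
qed

text \<open>\<open>par\<close> states that the large-value term stays below N^(4-\<epsilon>). The
  bound is uniform in J, S and d because for each N all dyadic J up to about N^(\<theta>+\<epsilon>)
  are needed at once.\<close>

lemma near_count_bound:
  fixes \<kappa> m \<theta> \<epsilon> R Ce :: real
  assumes \<kappa>: "\<kappa> > 2" and m: "m \<ge> 0"
    and mom: "\<exists>C T0. \<forall>T\<ge>T0. T > 0 \<longrightarrow>
          (1 / T) * integral {0..T} (\<lambda>t. zeta_abs t powr \<kappa>) \<le> C * T powr (m + \<epsilon>)"
    and \<epsilon>: "\<epsilon> > 0" and \<theta>: "\<theta> > 0" "\<theta> + 5 * \<epsilon> < 2" and R: "R \<ge> 1" and Ce: "Ce \<ge> 0"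
    and par: "(\<theta> + \<epsilon>) * (1 + 2 * (m + \<epsilon>)) + \<epsilon> * (m + \<epsilon>) - (\<kappa> - 2) * ((2 - 4 * \<epsilon> - \<theta>) / 2) + \<epsilon> \<le> 0"
  obtains C' where "C' > 0"
    "\<forall>\<^sub>F N in sequentially. \<forall>J S (d :: 'p \<Rightarrow> real). J \<ge> 1 \<longrightarrow> real J \<le> R * real N powr (\<theta> + \<epsilon>) \<longrightarrow>
       finite S \<longrightarrow> real (card S) \<le> real N ^ 2 \<longrightarrow> (\<forall>p\<in>S. d p \<ge> real N powr (2 - 3 * \<epsilon>)) \<longrightarrow>
       real (card {(p, q). p \<in> S \<and> q \<in> S \<and> \<bar>d p - d q\<bar> < 1}) \<le> Ce * real N powr (2 + \<epsilon>) \<longrightarrow>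
       real (near_count J S d) \<le> C' * real N powr (4 - \<epsilon>)"
proof -
  obtain C T1 where C: "C > 0" "T1 \<ge> 2"
    "\<And>T J I c A. \<lbrakk>T \<ge> T1; J \<ge> 1; finite I; \<And>l. c l \<ge> 0; A > 0\<rbrakk> \<Longrightarrow>
      resonance_sum T J I c \<le> C * real J * (A\<^sup>2 * (\<Sum>l\<in>I. (c l)\<^sup>2) + (\<Sum>l\<in>I. c l)\<^sup>2 * (A powr (2 - \<kappa>) * T powr (m + \<epsilon>) + real J / T))"
    using resonance_sum_moment_bound[OF \<kappa> mom] by blast
  \<comment> \<open>Chosen so that J * A^2 times the energy is of order N^(4-2\<epsilon>) when J
    reaches N^(\<theta>+\<epsilon>).\<close>
  define a where "a = (2 - 4 * \<epsilon> - \<theta>) / 2"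
  \<comment> \<open>Exponent of J in the large-value term: 1 from the prefactor and 2 * (m +
    \<epsilon>) from T, which is quadratic in J.\<close>
  define e where "e = 1 + 2 * (m + \<epsilon>)"
  define C' where "C' = 3 * C * (R * Ce + R powr e + 1)"
  have C'0: "C' > 0" using C R Ce by (auto simp: C'_def intro!: mult_pos_pos add_nonneg_pos)
  have ev1: "\<forall>\<^sub>F N in sequentially. real N powr \<epsilon> \<ge> T1"
    using filterlim_compose[OF real_powr_at_top[OF \<epsilon>] filterlim_real_sequentially] by (simp add: filterlim_at_top)
  have "2 - \<theta> - 5 * \<epsilon> > 0" using \<theta> by simp
  from filterlim_compose[OF real_powr_at_top[OF this] filterlim_real_sequentially]
  have ev2: "\<forall>\<^sub>F N in sequentially. real N powr (2 - \<theta> - 5 * \<epsilon>) \<ge> R" by (simp add: filterlim_at_top)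
  have "\<forall>\<^sub>F N in sequentially. \<forall>J S (d :: 'p \<Rightarrow> real). J \<ge> 1 \<longrightarrow> real J \<le> R * real N powr (\<theta> + \<epsilon>) \<longrightarrow>
       finite S \<longrightarrow> real (card S) \<le> real N ^ 2 \<longrightarrow> (\<forall>p\<in>S. d p \<ge> real N powr (2 - 3 * \<epsilon>)) \<longrightarrow>
       real (card {(p, q). p \<in> S \<and> q \<in> S \<and> \<bar>d p - d q\<bar> < 1}) \<le> Ce * real N powr (2 + \<epsilon>) \<longrightarrow>
       real (near_count J S d) \<le> C' * real N powr (4 - \<epsilon>)"
    using ev1 ev2 eventually_ge_at_top[of 1]
  proof (eventually_elim, intro allI impI)
    fix N J :: nat and S :: "'p set" and d :: "'p \<Rightarrow> real"
    assume NT: "T1 \<le> real N powr \<epsilon>" and NR: "R \<le> real N powr (2 - \<theta> - 5 * \<epsilon>)" and N1: "1 \<le> N" and J: "1 \<le> J"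
      and JR: "real J \<le> R * real N powr (\<theta> + \<epsilon>)" and S: "finite S" "real (card S) \<le> real N ^ 2" and d: "\<forall>p\<in>S. real N powr (2 - 3 * \<epsilon>) \<le> d p"
      and cl: "real (card {(p, q). p \<in> S \<and> q \<in> S \<and> \<bar>d p - d q\<bar> < 1}) \<le> Ce * real N powr (2 + \<epsilon>)"
    define n where "n = real N"
    have n: "n \<ge> 1" using N1 by (simp add: n_def)
    define T where "T = (real J)\<^sup>2 * n powr \<epsilon>"
    define B where "B = n powr (2 - 3 * \<epsilon>)"
    define A where "A = n powr a"
    have pos: "T > 0" "B > 0" "A > 0" using J n by (auto simp: T_def B_def A_def)
    have "(real J)\<^sup>2 \<ge> 1" using J by (simp add: one_le_power)
    hence "1 * n powr \<epsilon> \<le> T" unfolding T_def by (intro mult_right_mono) auto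
    hence TT: "T \<ge> T1" using NT by (simp add: n_def)
    \<comment> \<open>The removal of small differences enters here: J * N^\<epsilon> <=
      N^(2-3\<epsilon>), where \<theta> + 5\<epsilon> < 2 leaves room for the constant R.\<close>
    have TJB: "T \<le> real J * B"
    proof -
      have "real J * n powr \<epsilon> \<le> (R * n powr (\<theta> + \<epsilon>)) * n powr \<epsilon>"
        using JR by (intro mult_right_mono) (auto simp: n_def)
      also have "\<dots> \<le> (n powr (2 - \<theta> - 5 * \<epsilon>) * n powr (\<theta> + \<epsilon>)) * n powr \<epsilon>"
        using NR by (intro mult_right_mono) (auto simp: n_def)
      also have "\<dots> = B" unfolding B_def powr_add[symmetric] by (simp add: algebra_simps)
      finally have "real J * (real J * n powr \<epsilon>) \<le> real J * B" by (intro mult_left_mono) auto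
      thus ?thesis by (simp add: T_def power2_eq_square mult_ac)
    qed
    obtain I c where Ic: "finite I" "\<And>l. c l \<ge> 0"
      "(\<Sum>l\<in>I. (c l)\<^sup>2) \<le> real (card {(p, q). p \<in> S \<and> q \<in> S \<and> \<bar>d p - d q\<bar> < 1})"
      "(\<Sum>l\<in>I. c l) \<le> real (card S)"
      "real (near_count J S d) \<le> 3 * resonance_sum T J I c"
      using scaled_close_pairs_le_resonance[of S B d T J] S d pos TJB J unfolding near_count_def B_def n_def by blast
    have Q0: "(\<Sum>l\<in>I. c l) \<ge> 0" using Ic by (intro sum_nonneg) auto
    have n4: "n ^ 4 = n powr 4" using n by (simp add: powr_numeral)
    have "(\<Sum>l\<in>I. c l)\<^sup>2 \<le> (n ^ 2)\<^sup>2"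
      unfolding n_def by (intro power_mono order_trans[OF Ic(4) S(2)] Q0)
    hence Q: "(\<Sum>l\<in>I. c l)\<^sup>2 \<le> n powr 4" using n4 by (simp add: power_mult[symmetric])
    have E: "(\<Sum>l\<in>I. (c l)\<^sup>2) \<le> Ce * n powr (2 + \<epsilon>)" using Ic(3) cl by (simp add: n_def)
    have "resonance_sum T J I c \<le> C * real J * (A\<^sup>2 * (\<Sum>l\<in>I. (c l)\<^sup>2) + (\<Sum>l\<in>I. c l)\<^sup>2 * (A powr (2 - \<kappa>) * T powr (m + \<epsilon>) + real J / T))"
      by (rule C(3)[OF TT J Ic(1) Ic(2) pos(3)])
    also have "\<dots> \<le> C * real J * (A\<^sup>2 * (Ce * n powr (2 + \<epsilon>)) + n powr 4 * (A powr (2 - \<kappa>) * T powr (m + \<epsilon>) + real J / T))"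
      using C pos by (intro mult_left_mono add_mono mult_right_mono E Q) auto
    also have "\<dots> = C * (real J * (A\<^sup>2 * (Ce * n powr (2 + \<epsilon>))) + real J * (n powr 4 * (A powr (2 - \<kappa>) * T powr (m + \<epsilon>))) + real J * (n powr 4 * (real J / T)))"
      by (simp add: ring_distribs)
    also have "\<dots> \<le> C * (R * Ce * n powr (4 - \<epsilon>) + R powr e * n powr (4 - \<epsilon>) + n powr (4 - \<epsilon>))"
    proof (intro mult_left_mono add_mono)
      have A2: "A\<^sup>2 = n powr (2 - 4 * \<epsilon> - \<theta>)"
        unfolding A_def power2_eq_square powr_add[symmetric] by (simp add: a_def)
      have "real J * (A\<^sup>2 * (Ce * n powr (2 + \<epsilon>))) \<le> (R * n powr (\<theta> + \<epsilon>)) * (A\<^sup>2 * (Ce * n powr (2 + \<epsilon>)))"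
        using JR Ce by (intro mult_right_mono) (auto simp: n_def)
      also have "\<dots> = R * Ce * (n powr (\<theta> + \<epsilon>) * n powr (2 - 4 * \<epsilon> - \<theta>) * n powr (2 + \<epsilon>))" unfolding A2 by (simp only: mult_ac)
      also have "\<dots> = R * Ce * n powr (4 - 2 * \<epsilon>)" unfolding powr_add[symmetric] by (simp add: algebra_simps)
      also have "\<dots> \<le> R * Ce * n powr (4 - \<epsilon>)" using n R Ce \<epsilon> by (intro mult_left_mono powr_mono) auto
      finally show "real J * (A\<^sup>2 * (Ce * n powr (2 + \<epsilon>))) \<le> R * Ce * n powr (4 - \<epsilon>)" .
    next
      have Tm: "T powr (m + \<epsilon>) = real J powr (2 * (m + \<epsilon>)) * n powr (\<epsilon> * (m + \<epsilon>))"
      proof -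
        have "(real J)\<^sup>2 = real J powr 2" using J by simp
        hence "T = real J powr 2 * n powr \<epsilon>" by (simp only: T_def)
        thus ?thesis by (simp only: powr_mult powr_powr)
      qed
      have e0: "e \<ge> 0" using m \<epsilon> by (simp add: e_def)
      have "real J * (n powr 4 * (A powr (2 - \<kappa>) * T powr (m + \<epsilon>))) = (real J powr 1 * real J powr (2 * (m + \<epsilon>))) * (n powr 4 * n powr (a * (2 - \<kappa>)) * n powr (\<epsilon> * (m + \<epsilon>)))"
        using J by (simp add: Tm A_def powr_powr mult_ac)
      also have "\<dots> = real J powr e * n powr (4 + a * (2 - \<kappa>) + \<epsilon> * (m + \<epsilon>))"
        unfolding powr_add[symmetric] e_def ..
      also have "real J powr e \<le> (R * n powr (\<theta> + \<epsilon>)) powr e"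
        using JR J e0 by (intro powr_mono2) (auto simp: n_def)
      also have "(R * n powr (\<theta> + \<epsilon>)) powr e = R powr e * n powr ((\<theta> + \<epsilon>) * e)"
        using R by (simp add: powr_mult powr_powr)
      also have "R powr e * n powr ((\<theta> + \<epsilon>) * e) * n powr (4 + a * (2 - \<kappa>) + \<epsilon> * (m + \<epsilon>)) = R powr e * n powr ((\<theta> + \<epsilon>) * e + (4 + a * (2 - \<kappa>) + \<epsilon> * (m + \<epsilon>)))"
        by (simp only: powr_add mult_ac)
      also have "\<dots> \<le> R powr e * n powr (4 - \<epsilon>)"
      proof (intro mult_left_mono powr_mono n)
        have "a * (2 - \<kappa>) = - ((\<kappa> - 2) * ((2 - 4 * \<epsilon> - \<theta>) / 2))" by (simp add: a_def field_simps)
        thus "(\<theta> + \<epsilon>) * e + (4 + a * (2 - \<kappa>) + \<epsilon> * (m + \<epsilon>)) \<le> 4 - \<epsilon>" using par unfolding e_def by linarith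
      qed auto
      finally show "real J * (n powr 4 * (A powr (2 - \<kappa>) * T powr (m + \<epsilon>))) \<le> R powr e * n powr (4 - \<epsilon>)"
        by (simp add: mult_right_mono)
    next
      \<comment> \<open>The quadratic T cancels J^2 exactly and leaves the saving
        N^(-\<epsilon>).\<close>
      have "real J * (n powr 4 * (real J / T)) = n powr 4 / n powr \<epsilon>" using J n by (simp add: T_def power2_eq_square)
      thus "real J * (n powr 4 * (real J / T)) \<le> n powr (4 - \<epsilon>)" by (simp add: powr_diff)
    qed (use C in auto)
    also have "\<dots> = C' / 3 * n powr (4 - \<epsilon>)" by (simp add: C'_def ring_distribs)
    finally show "real (near_count J S d) \<le> C' * real N powr (4 - \<epsilon>)" using Ic(5) by (simp add: n_def)
  qed
  with C'0 that show ?thesis by blast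
qed

subsection \<open>Small gaps along powers of two\<close>

text \<open>At \<epsilon> = 0 twice the left-hand side of the last inequality is \<theta> *
  (\<kappa> + 4m) - (2\<kappa> - 4), which is negative; by continuity it stays so for small
  \<epsilon>.\<close>

lemma exponent_parameter:
  fixes \<kappa> m \<theta> :: real
  assumes \<kappa>: "\<kappa> > 2" and m: "m \<ge> 0" and \<theta>: "\<theta> > 0" "\<theta> < (2 * \<kappa> - 4) / (\<kappa> + 4 * m)"
  obtains \<epsilon> where "\<epsilon> > 0" "\<theta> + 5 * \<epsilon> < 2"
    "(\<theta> + \<epsilon>) * (1 + 2 * (m + \<epsilon>)) + \<epsilon> * (m + \<epsilon>) - (\<kappa> - 2) * ((2 - 4 * \<epsilon> - \<theta>) / 2) + \<epsilon> \<le> 0"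
proof -
  have km: "\<kappa> + 4 * m > 0" using \<kappa> m by simp
  hence t: "\<theta> * (\<kappa> + 4 * m) < 2 * \<kappa> - 4" using \<theta>(2) by (simp add: field_simps)
  have "\<theta> * \<kappa> \<le> \<theta> * (\<kappa> + 4 * m)" using \<theta> m by (intro mult_left_mono) auto
  hence "\<theta> * \<kappa> < 2 * \<kappa>" using t by linarith
  hence \<theta>2: "\<theta> < 2" using \<kappa> by simp
  define g where "g = (\<lambda>\<epsilon>. (\<theta> + \<epsilon>) * (1 + 2 * (m + \<epsilon>)) + \<epsilon> * (m + \<epsilon>) - (\<kappa> - 2) * ((2 - 4 * \<epsilon> - \<theta>) / 2) + \<epsilon>)"
  have "(g \<longlongrightarrow> g 0) (at_right 0)" unfolding g_def by (auto intro!: tendsto_eq_intros)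
  moreover have "g 0 < 0" using t by (simp add: g_def field_simps)
  ultimately have "\<forall>\<^sub>F \<epsilon> in at_right 0. g \<epsilon> < 0" by (rule order_tendstoD)
  moreover have "((\<lambda>\<epsilon>. \<theta> + 5 * \<epsilon>) \<longlongrightarrow> \<theta>) (at_right 0)" by (auto intro!: tendsto_eq_intros)
  hence "\<forall>\<^sub>F \<epsilon> in at_right 0. \<theta> + 5 * \<epsilon> < 2" using \<theta>2 by (rule order_tendstoD)
  ultimately have "\<forall>\<^sub>F \<epsilon> in at_right 0. \<epsilon> > 0 \<and> \<theta> + 5 * \<epsilon> < 2 \<and> g \<epsilon> < 0"
    using eventually_at_right_less[of "0::real"] by eventually_elim auto
  then obtain \<epsilon> where "\<epsilon> > 0" "\<theta> + 5 * \<epsilon> < 2" "g \<epsilon> < 0"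
    using eventually_happens'[OF trivial_limit_at_right_real] by blast
  thus ?thesis using that[of \<epsilon>] by (simp add: g_def)
qed

section \<open>Exceptional sets for N a power of two\<close>

lemma dyadic_scale_bounds:
  fixes s :: real
  assumes s: "s \<ge> 0"
  defines "H \<equiv> \<lambda>i. 2 ^ nat \<lceil>s * real i\<rceil> :: nat"
  shows "real (2 ^ i) powr s \<le> real (H i)" "real (H i) \<le> 2 * real (2 ^ i) powr s" "real (nat \<lceil>s * real i\<rceil>) \<le> s * real i + 1"
proof -
  have h: "s * real i \<le> real (nat \<lceil>s * real i\<rceil>)" "real (nat \<lceil>s * real i\<rceil>) \<le> s * real i + 1"
    using s by (auto simp: of_nat_nat)
  have N: "real (2 ^ i) powr s = 2 powr (s * real i)"
    by (simp add: powr_realpow[symmetric] powr_powr mult.commute)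
  have H: "real (H i) = 2 powr real (nat \<lceil>s * real i\<rceil>)" by (simp add: H_def powr_realpow)
  show "real (2 ^ i) powr s \<le> real (H i)" unfolding N H using h by (intro powr_mono) auto
  have "2 powr real (nat \<lceil>s * real i\<rceil>) \<le> 2 powr (s * real i + 1)" using h by (intro powr_mono) auto
  thus "real (H i) \<le> 2 * real (2 ^ i) powr s" unfolding N H by (simp add: powr_add)
  show "real (nat \<lceil>s * real i\<rceil>) \<le> s * real i + 1" by (rule h)
qed

lemma delta_min_attained_bound:
  fixes \<alpha> \<eta> :: real
  assumes "\<not> delta_min x \<alpha> N < \<eta>" "p \<in> far_pairs x N B"
  shows "dist_int (\<alpha> * (x (fst p) - x (snd p))) \<ge> \<eta>"
  using assms delta_min_le[of "fst p" N "snd p" x \<alpha>] by (force simp: far_pairs_def)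

text \<open>If all distances are at least \<eta>, the detector makes the real part of the
  nonconstant sum at most -1/4 for every far pair. All these have the same sign, so F has modulus at
  least N^2/16. The size conditions are premises of the last clause only, so that a set X exists for
  every N and can be chosen for all i.\<close>

lemma exceptional_set:
  fixes x :: "nat \<Rightarrow> real" and N H r L :: nat and \<eta> \<sigma> B :: real
  assumes H: "H \<ge> 1" and L: "r * H + 1 \<le> 2 ^ L" and \<eta>: "\<eta> > 0" and \<sigma>: "\<sigma> > 0" and N: "N \<ge> 1"
  obtains X where "X \<in> sets lborel" "emeasure lborel X < \<infinity>"
    "measure lborel X \<le> 768 * exp 1 / real N ^ 4 * \<sigma> * real L *
       (\<Sum>j<L. real (near_count (2 ^ j) (far_pairs x N B) (\<lambda>p. x (fst p) - x (snd p))) + (2 ^ j * real (card (far_pairs x N B)))\<^sup>2 * exp (- \<sigma>\<^sup>2))"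
    "\<And>\<alpha>. \<lbrakk>real (r * H + 1) * (1 / (\<eta> * real H)) ^ (2 * r) \<le> 1 / 2; real (card (far_pairs x N B)) \<ge> real N ^ 2 / 4;
       \<bar>\<alpha>\<bar> \<le> \<sigma>; \<alpha> \<notin> X\<rbrakk> \<Longrightarrow> delta_min x \<alpha> N < \<eta>"
proof -
  define S where "S = far_pairs x N B"
  define d where "d = (\<lambda>p. x (fst p) - x (snd p))"
  have fS: "finite S" unfolding S_def far_pairs_def by (rule finite_subset[of _ "{1..N} \<times> {1..N}"]) auto
  define n where "n = r * H + 1"
  obtain b :: "nat \<Rightarrow> complex" where b: "\<And>h. cmod (b h) \<le> 1"
    "\<And>y \<eta>. \<lbrakk>\<eta> > 0; dist_int y \<ge> \<eta>\<rbrakk> \<Longrightarrow>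
      1 + 2 * Re (\<Sum>h\<in>{1..<r * H + 1}. b h * iexp (2 * pi * real h * y)) \<le> real (r * H + 1) * (1 / (\<eta> * real H)) ^ (2 * r)"
    using fejer_power_detector[OF H, of r] by blast
  \<comment> \<open>Padding with zeros up to 2^L makes the frequency range a union of full dyadic
    blocks.\<close>
  define b' where "b' = (\<lambda>h. if h < n then b h else 0)"
  have b': "cmod (b' h) \<le> 1" for h using b(1) by (simp add: b'_def)
  define \<tau> where "\<tau> = real N ^ 2 / 16"
  have \<tau>: "\<tau> > 0" using N by (simp add: \<tau>_def)
  define F where "F = (\<lambda>t. \<Sum>x\<in>{1..<2 ^ L} \<times> S. b' (fst x) * iexp (2 * pi * real (fst x) * d (snd x) * t))"
  define X where "X = {t. t \<in> {-\<sigma>..\<sigma>} \<and> \<tau> \<le> cmod (F t)}"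
  have Xm: "X \<in> sets lborel" "emeasure lborel X < \<infinity>"
    "measure lborel X \<le> exp 1 * 3 / \<tau>\<^sup>2 * \<sigma> * real L * (\<Sum>j<L. real (near_count (2 ^ j) S d) + (2 ^ j * real (card S))\<^sup>2 * exp (- \<sigma>\<^sup>2))"
    using large_values_measure_le[where d=d and L=L and b=b', OF fS b' \<sigma> \<tau>] unfolding X_def F_def by blast+
  \<comment> \<open>768 = 3 * 16^2: the constant of the Chebyshev bound and the squared denominator
    of the threshold.\<close>
  have \<tau>2: "exp 1 * 3 / \<tau>\<^sup>2 = 768 * exp 1 / real N ^ 4"
    by (simp add: \<tau>_def power_divide power_mult[symmetric])
  have "delta_min x \<alpha> N < \<eta>" if small: "real n * (1 / (\<eta> * real H)) ^ (2 * r) \<le> 1 / 2" and card: "real (card S) \<ge> real N ^ 2 / 4"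
    and \<alpha>: "\<bar>\<alpha>\<bar> \<le> \<sigma>" "\<alpha> \<notin> X" for \<alpha>
  proof (rule ccontr)
    assume not: "\<not> delta_min x \<alpha> N < \<eta>"
    have inner: "(\<Sum>h\<in>{1..<2 ^ L}. b' h * iexp (2 * pi * real h * d p * \<alpha>)) = (\<Sum>h\<in>{1..<n}. b h * iexp (2 * pi * real h * (\<alpha> * d p)))" for p
    proof -
      have "(\<Sum>h\<in>{1..<2 ^ L}. b' h * iexp (2 * pi * real h * d p * \<alpha>)) = (\<Sum>h\<in>{1..<n}. b' h * iexp (2 * pi * real h * d p * \<alpha>))"
        using L by (intro sum.mono_neutral_right) (auto simp: b'_def n_def)
      also have "\<dots> = (\<Sum>h\<in>{1..<n}. b h * iexp (2 * pi * real h * (\<alpha> * d p)))"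
        by (intro sum.cong) (auto simp: b'_def mult_ac)
      finally show ?thesis .
    qed
    have Re_le: "Re (\<Sum>h\<in>{1..<n}. b h * iexp (2 * pi * real h * (\<alpha> * d p))) \<le> - 1 / 4" if "p \<in> S" for p
    proof -
      have "dist_int (\<alpha> * d p) \<ge> \<eta>" unfolding d_def using delta_min_attained_bound[OF not] that by (simp add: S_def)
      from b(2)[OF \<eta> this] small show ?thesis unfolding n_def by linarith
    qed
    have "F \<alpha> = (\<Sum>p\<in>S. \<Sum>h\<in>{1..<2 ^ L}. b' h * iexp (2 * pi * real h * d p * \<alpha>))"
      unfolding F_def by (subst sum.swap, subst sum.cartesian_product) (simp add: case_prod_beta)
    hence "Re (F \<alpha>) = (\<Sum>p\<in>S. Re (\<Sum>h\<in>{1..<n}. b h * iexp (2 * pi * real h * (\<alpha> * d p))))"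
      unfolding inner by (simp only: Re_sum)
    also have "\<dots> \<le> (\<Sum>p\<in>S. - 1 / 4)" by (intro sum_mono Re_le)
    finally have "Re (F \<alpha>) \<le> - (real (card S) / 4)" by simp
    hence "\<tau> \<le> cmod (F \<alpha>)" using abs_Re_le_cmod[of "F \<alpha>"] card unfolding \<tau>_def by linarith
    thus False using \<alpha> by (auto simp: X_def)
  qed
  with Xm show ?thesis using that[of X] unfolding \<tau>2 S_def d_def n_def by blast
qed

text \<open>With N = 2^i the second moment is N^(4-\<epsilon>), the squared threshold N^4/256 and
  the window N^(\<epsilon>/4), so the exceptional measure is of order i^2 * 2^(-3\<epsilon>i/4).
  This is summable over i, which is why only powers of two are treated here.\<close>

lemma dyadic_delta_min_AE:
  fixes x :: "nat \<Rightarrow> real" and \<kappa> m \<theta> :: real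
  assumes inc: "\<And>i j. 1 \<le> i \<Longrightarrow> i < j \<Longrightarrow> x i < x j"
    and energy: "\<And>\<epsilon>. \<epsilon> > 0 \<Longrightarrow> \<exists>C. \<forall>N\<ge>1. real (add_energy x N) \<le> C * real N powr (2 + \<epsilon>)"
    and \<kappa>: "\<kappa> > 2"
    and moment: "\<And>\<epsilon>. \<epsilon> > 0 \<Longrightarrow> \<exists>C T0. \<forall>T\<ge>T0. T > 0 \<longrightarrow>
          (1 / T) * integral {0..T} (\<lambda>t. zeta_abs t powr \<kappa>) \<le> C * T powr (m + \<epsilon>)"
    and \<theta>: "\<theta> > 0" "\<theta> < (2 * \<kappa> - 4) / (\<kappa> + 4 * m)"
  shows "AE \<alpha> in lborel. \<forall>\<^sub>F i in sequentially. delta_min x \<alpha> (2 ^ i) < real (2 ^ i) powr (- \<theta>)"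
proof -
  have m: "m \<ge> 0" by (rule zeta_moment_exponent_nonneg[OF \<kappa> moment])
  obtain \<epsilon> where \<epsilon>: "\<epsilon> > 0" "\<theta> + 5 * \<epsilon> < 2"
    "(\<theta> + \<epsilon>) * (1 + 2 * (m + \<epsilon>)) + \<epsilon> * (m + \<epsilon>) - (\<kappa> - 2) * ((2 - 4 * \<epsilon> - \<theta>) / 2) + \<epsilon> \<le> 0"
    using exponent_parameter[OF \<kappa> m \<theta>] by blast
  obtain Ce0 where "\<forall>N\<ge>1. real (add_energy x N) \<le> Ce0 * real N powr (2 + \<epsilon>)" using energy[OF \<epsilon>(1)] by blast
  define Ce where "Ce = \<bar>Ce0\<bar>"
  have Ce: "Ce \<ge> 0" "\<And>N. N \<ge> 1 \<Longrightarrow> real (add_energy x N) \<le> Ce * real N powr (2 + \<epsilon>)"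
  proof -
    fix N :: nat assume "N \<ge> 1"
    hence "real (add_energy x N) \<le> Ce0 * real N powr (2 + \<epsilon>)" using \<open>\<forall>N\<ge>1. _ N\<close> by blast
    also have "\<dots> \<le> Ce * real N powr (2 + \<epsilon>)" unfolding Ce_def by (intro mult_right_mono) auto
    finally show "real (add_energy x N) \<le> Ce * real N powr (2 + \<epsilon>)" .
  qed (simp add: Ce_def)
  \<comment> \<open>The kernel length H must exceed 1/\<eta> = N^\<theta> by a factor N^\<epsilon>
    for the kernel to be small at distance \<eta>.\<close>
  define s where "s = \<theta> + \<epsilon>"
  have s: "s > 0" "s \<le> 2" using \<theta> \<epsilon> by (auto simp: s_def)
  \<comment> \<open>Then (N^(-\<epsilon>))^(2r) <= N^(-4), which beats the factor r * H + 1 = O(N^2)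
    in the detector.\<close>
  define r where "r = nat \<lceil>2 / \<epsilon>\<rceil>"
  have "2 / \<epsilon> \<le> real r" unfolding r_def by linarith
  hence r: "2 \<le> real r * \<epsilon>" using \<epsilon>(1) by (simp add: field_simps)
  define h where "h = (\<lambda>i. nat \<lceil>s * real i\<rceil>)"
  define H where "H = (\<lambda>i. 2 ^ h i :: nat)"
  have H: "real (2 ^ i) powr s \<le> real (H i)" "real (H i) \<le> 2 * real (2 ^ i) powr s" "real (h i) \<le> s * real i + 1" for i
    using dyadic_scale_bounds[of s i] s unfolding H_def h_def by auto
  \<comment> \<open>The summand r + 1 covers the r-fold extension of the frequency range by the
    power of the kernel, since 2^(r+1) > r + 1.\<close>
  define L where "L = (\<lambda>i. h i + (r + 1))"
  define R where "R = 2 ^ (r + 1) * (2 :: real)"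
  have R: "R \<ge> 1" unfolding R_def by (simp add: one_le_power mult_ge1_I)
  have H1: "H i \<ge> 1" for i by (simp add: H_def)
  have "r + 1 < 2 ^ (r + 1)" by (rule less_exp)
  have nL: "r * H i + 1 \<le> 2 ^ L i" for i
  proof -
    have "r * H i + 1 \<le> (r + 1) * H i" using H1[of i] by simp
    also have "\<dots> \<le> 2 ^ (r + 1) * H i" using \<open>r + 1 < 2 ^ (r + 1)\<close> by (intro mult_right_mono) auto
    finally show ?thesis by (simp add: L_def H_def power_add mult_ac)
  qed
  have jR: "real (2 ^ j) \<le> R * real (2 ^ i) powr s" if "j < L i" for i j
  proof -
    have "real (2 ^ j) \<le> 2 ^ L i" using that by (simp add: power_increasing)
    also have "\<dots> = 2 ^ (r + 1) * real (H i)" by (simp add: L_def H_def power_add)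
    also have "\<dots> \<le> 2 ^ (r + 1) * (2 * real (2 ^ i) powr s)" using H by (intro mult_left_mono) auto
    finally show ?thesis by (simp add: R_def)
  qed
  \<comment> \<open>The window grows, so each fixed \<alpha> is eventually inside and exp
    (-\<sigma>^2) beats every power of N, yet it uses up only N^(\<epsilon>/4) of the saving
    N^\<epsilon>.\<close>
  define \<sigma> where "\<sigma> = (\<lambda>i. real (2 ^ i) powr (\<epsilon> / 4))"
  define B where "B = (\<lambda>i. real (2 ^ i) powr (2 - 3 * \<epsilon>))"
  define \<eta> where "\<eta> = (\<lambda>i. real (2 ^ i) powr (- \<theta>))"
  define S where "S = (\<lambda>i. far_pairs x (2 ^ i) (B i))"
  define d where "d = (\<lambda>p. x (fst p) - x (snd p))"
  have "\<exists>X. X \<in> sets lborel \<and> emeasure lborel X < \<infinity> \<and>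
     measure lborel X \<le> 768 * exp 1 / real (2 ^ i) ^ 4 * \<sigma> i * real (L i) *
       (\<Sum>j<L i. real (near_count (2 ^ j) (S i) d) + (2 ^ j * real (card (S i)))\<^sup>2 * exp (- (\<sigma> i)\<^sup>2)) \<and>
     (real (r * H i + 1) * (1 / (\<eta> i * real (H i))) ^ (2 * r) \<le> 1 / 2 \<longrightarrow> real (card (S i)) \<ge> real (2 ^ i) ^ 2 / 4 \<longrightarrow>
       (\<forall>\<alpha>. \<bar>\<alpha>\<bar> \<le> \<sigma> i \<longrightarrow> \<alpha> \<notin> X \<longrightarrow> delta_min x \<alpha> (2 ^ i) < \<eta> i))" for i
  proof -
    have pos: "\<eta> i > 0" "\<sigma> i > 0" "(2::nat) ^ i \<ge> 1" by (auto simp: \<eta>_def \<sigma>_def)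
    show ?thesis
      unfolding S_def d_def
      by (rule exceptional_set[OF H1[of i] nL[of i] pos, of x "B i"], intro exI conjI impI allI)
         (assumption | blast)+
  qed
  hence "\<forall>i. \<exists>X. X \<in> sets lborel \<and> emeasure lborel X < \<infinity> \<and>
     measure lborel X \<le> 768 * exp 1 / real (2 ^ i) ^ 4 * \<sigma> i * real (L i) *
       (\<Sum>j<L i. real (near_count (2 ^ j) (S i) d) + (2 ^ j * real (card (S i)))\<^sup>2 * exp (- (\<sigma> i)\<^sup>2)) \<and>
     (real (r * H i + 1) * (1 / (\<eta> i * real (H i))) ^ (2 * r) \<le> 1 / 2 \<longrightarrow> real (card (S i)) \<ge> real (2 ^ i) ^ 2 / 4 \<longrightarrow>
       (\<forall>\<alpha>. \<bar>\<alpha>\<bar> \<le> \<sigma> i \<longrightarrow> \<alpha> \<notin> X \<longrightarrow> delta_min x \<alpha> (2 ^ i) < \<eta> i))" by (rule allI)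
  from choice[OF this] obtain X where X: "\<And>i. X i \<in> sets lborel" "\<And>i. emeasure lborel (X i) < \<infinity>"
     "\<And>i. measure lborel (X i) \<le> 768 * exp 1 / real (2 ^ i) ^ 4 * \<sigma> i * real (L i) *
       (\<Sum>j<L i. real (near_count (2 ^ j) (S i) d) + (2 ^ j * real (card (S i)))\<^sup>2 * exp (- (\<sigma> i)\<^sup>2))"
     "\<And>i \<alpha>. \<lbrakk>real (r * H i + 1) * (1 / (\<eta> i * real (H i))) ^ (2 * r) \<le> 1 / 2; real (card (S i)) \<ge> real (2 ^ i) ^ 2 / 4;
       \<bar>\<alpha>\<bar> \<le> \<sigma> i; \<alpha> \<notin> X i\<rbrakk> \<Longrightarrow> delta_min x \<alpha> (2 ^ i) < \<eta> i"
    by blast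
  obtain C' where C': "C' > 0"
    "\<forall>\<^sub>F N in sequentially. \<forall>J S (d :: nat \<times> nat \<Rightarrow> real). J \<ge> 1 \<longrightarrow> real J \<le> R * real N powr (\<theta> + \<epsilon>) \<longrightarrow>
       finite S \<longrightarrow> real (card S) \<le> real N ^ 2 \<longrightarrow> (\<forall>p\<in>S. d p \<ge> real N powr (2 - 3 * \<epsilon>)) \<longrightarrow>
       real (card {(p, q). p \<in> S \<and> q \<in> S \<and> \<bar>d p - d q\<bar> < 1}) \<le> Ce * real N powr (2 + \<epsilon>) \<longrightarrow>
       real (near_count J S d) \<le> C' * real N powr (4 - \<epsilon>)"
    using near_count_bound[OF \<kappa> m moment[OF \<epsilon>(1)] \<epsilon>(1) \<theta>(1) \<epsilon>(2) R Ce(1) \<epsilon>(3)] by blast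
  have pow2: "filterlim (\<lambda>i. 2 ^ i :: nat) sequentially sequentially"
    by (rule filterlim_at_top_mono[OF filterlim_ident]) (auto intro!: always_eventually less_imp_le less_exp)
  have pow2r: "filterlim (\<lambda>i. real (2 ^ i)) at_top sequentially"
    by (rule filterlim_compose[OF filterlim_real_sequentially pow2])
  have fS: "finite (S i)" for i unfolding S_def far_pairs_def by (rule finite_subset[of _ "{1..2 ^ i} \<times> {1..2 ^ i}"]) auto
  have cS: "real (card (S i)) \<le> real (2 ^ i) ^ 2" for i
  proof -
    have "card (S i) \<le> card ({1..2 ^ i :: nat} \<times> {1..2 ^ i :: nat})"
      unfolding S_def far_pairs_def by (intro card_mono) auto
    thus ?thesis by (simp add: card_cartesian_product power2_eq_square flip: of_nat_mult of_nat_power)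
  qed
  have evC: "\<forall>\<^sub>F i in sequentially. \<forall>j<L i. real (near_count (2 ^ j) (S i) d) \<le> C' * real (2 ^ i) powr (4 - \<epsilon>)"
    using eventually_compose_filterlim[OF C'(2) pow2]
  proof eventually_elim
    case (elim i)
    show ?case
    proof (intro allI impI)
      fix j assume j: "j < L i"
      have "card {(p, q). p \<in> S i \<and> q \<in> S i \<and> \<bar>d p - d q\<bar> < 1} \<le> add_energy x (2 ^ i)"
        unfolding d_def by (rule close_differences_le_energy) (auto simp: S_def far_pairs_def)
      hence "real (card {(p, q). p \<in> S i \<and> q \<in> S i \<and> \<bar>d p - d q\<bar> < 1}) \<le> Ce * real (2 ^ i) powr (2 + \<epsilon>)"
        using Ce(2)[of "2 ^ i"] by (meson of_nat_mono order_trans one_le_numeral one_le_power)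
      moreover have "\<forall>p\<in>S i. real (2 ^ i) powr (2 - 3 * \<epsilon>) \<le> d p" by (simp add: S_def far_pairs_def d_def B_def)
      ultimately show "real (near_count (2 ^ j) (S i) d) \<le> C' * real (2 ^ i) powr (4 - \<epsilon>)"
        using elim[rule_format, of "2 ^ j" "S i" d] jR[OF j] fS[of i] cS[of i] by (simp add: s_def)
    qed
  qed
  have evT: "\<forall>\<^sub>F i in sequentially. \<forall>j<L i. (2 ^ j * real (card (S i)))\<^sup>2 * exp (- (\<sigma> i)\<^sup>2) \<le> real (2 ^ i) powr (4 - \<epsilon>)"
  proof -
    \<comment> \<open>The power 8 comes from the square of 2^j * card S <= R * N^2 * N^2.\<close>
    have "((\<lambda>n::real. R\<^sup>2 * n ^ 8 * exp (- (n powr (\<epsilon> / 2)))) \<longlongrightarrow> 0) at_top"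
      using \<epsilon>(1) by real_asymp
    from order_tendstoD(2)[OF filterlim_compose[OF this pow2r], of 1]
    have "\<forall>\<^sub>F i in sequentially. R\<^sup>2 * real (2 ^ i) ^ 8 * exp (- (real (2 ^ i) powr (\<epsilon> / 2))) < 1" by simp
    thus ?thesis
    proof eventually_elim
      case (elim i)
      define n where "n = real (2 ^ i)"
      have n: "n \<ge> 1" by (simp add: n_def)
      have \<sigma>2: "(\<sigma> i)\<^sup>2 = n powr (\<epsilon> / 2)"
        unfolding \<sigma>_def n_def power2_eq_square powr_add[symmetric] by simp
      show ?case
      proof (intro allI impI)
        fix j assume j: "j < L i"
        have "real (2 ^ j) \<le> R * n powr s" using jR[OF j] by (simp add: n_def)
        also have "\<dots> \<le> R * n powr 2" using s n R by (intro mult_left_mono powr_mono) auto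
        finally have "2 ^ j \<le> R * n ^ 2" using n by (simp add: powr_numeral)
        hence "2 ^ j * real (card (S i)) \<le> (R * n ^ 2) * n ^ 2"
          using cS[of i] R by (intro mult_mono) (auto simp: n_def)
        hence "(2 ^ j * real (card (S i)))\<^sup>2 \<le> ((R * n ^ 2) * n ^ 2)\<^sup>2" by (intro power_mono) auto
        also have "\<dots> = R\<^sup>2 * n ^ 8" by (simp add: power_mult_distrib power_mult[symmetric] power_add[symmetric])
        finally have "(2 ^ j * real (card (S i)))\<^sup>2 * exp (- (\<sigma> i)\<^sup>2) \<le> R\<^sup>2 * n ^ 8 * exp (- (n powr (\<epsilon> / 2)))"
          unfolding \<sigma>2 by (intro mult_right_mono) auto
        also have "\<dots> \<le> n powr 0" using elim n by (simp add: n_def)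
        also have "\<dots> \<le> n powr (4 - \<epsilon>)" using n \<epsilon> \<theta> by (intro powr_mono) auto
        finally show "(2 ^ j * real (card (S i)))\<^sup>2 * exp (- (\<sigma> i)\<^sup>2) \<le> real (2 ^ i) powr (4 - \<epsilon>)" by (simp add: n_def)
      qed
    qed
  qed
  have evS: "\<forall>\<^sub>F i in sequentially. real (card (S i)) \<ge> real (2 ^ i) ^ 2 / 4"
  proof -
    \<comment> \<open>B times the energy is about N^(4-2\<epsilon>), so N^(2\<epsilon>) absorbs the
      constants; 128 = 2 * 64, with 2 from B + 1 <= 2B and 64 = 8^2.\<close>
    have "\<forall>\<^sub>F i in sequentially. real (2 ^ i) powr (2 * \<epsilon>) \<ge> 128 * Ce"
      using filterlim_compose[OF real_powr_at_top[of "2 * \<epsilon>"] pow2r] \<epsilon>(1) by (simp add: filterlim_at_top)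
    moreover have "\<forall>\<^sub>F i in sequentially. real (2 ^ i) \<ge> 4"
      using pow2r by (simp add: filterlim_at_top)
    ultimately show ?thesis
    proof eventually_elim
      case (elim i)
      define n where "n = real (2 ^ i)"
      have n: "n \<ge> 1" by (simp add: n_def)
      have B1: "1 \<le> B i" unfolding B_def using \<epsilon> \<theta> by (intro ge_one_powr_ge_zero) auto
      have "(B i + 1) * real (add_energy x (2 ^ i)) \<le> (2 * B i) * (Ce * n powr (2 + \<epsilon>))"
        using B1 Ce(2)[of "2 ^ i"] by (intro mult_mono) (auto simp: n_def)
      also have "\<dots> = 2 * Ce * (n powr (2 - 3 * \<epsilon>) * n powr (2 + \<epsilon>))" by (simp add: B_def n_def)
      also have "\<dots> = 2 * Ce * (n powr 4 / n powr (2 * \<epsilon>))"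
        unfolding powr_add[symmetric] powr_diff[symmetric] by simp
      also have "\<dots> \<le> n powr 4 / 64"
      proof -
        have "2 * Ce * n powr 4 * 64 \<le> n powr (2 * \<epsilon>) * n powr 4"
          using mult_right_mono[OF elim(1), of "n powr 4"] by (simp add: n_def)
        thus ?thesis using n by (simp add: field_simps)
      qed
      also have "\<dots> = (n ^ 2 / 8)\<^sup>2" using n by (simp add: power_divide power_mult[symmetric] powr_numeral)
      finally have "(B i + 1) * real (add_energy x (2 ^ i)) \<le> (real (2 ^ i) ^ 2 / 8)\<^sup>2" by (simp add: n_def)
      moreover have "(2::nat) ^ i \<ge> 4" using elim(2) by (simp flip: of_nat_power)
      ultimately show ?case unfolding S_def using B1 by (intro far_pairs_card_ge inc) auto
    qed
  qed
  have evD: "\<forall>\<^sub>F i in sequentially. real (r * H i + 1) * (1 / (\<eta> i * real (H i))) ^ (2 * r) \<le> 1 / 2"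
  proof -
    have "\<forall>\<^sub>F i in sequentially. real (2 ^ i) \<ge> 4 * (real r + 1)"
      using pow2r by (simp add: filterlim_at_top)
    thus ?thesis
    proof eventually_elim
      case (elim i)
      define n where "n = real (2 ^ i)"
      have n: "n \<ge> 1" by (simp add: n_def)
      have "n powr \<epsilon> = \<eta> i * n powr s" unfolding \<eta>_def n_def powr_add[symmetric] by (simp add: s_def)
      also have "\<dots> \<le> \<eta> i * real (H i)" using H(1)[of i] by (intro mult_left_mono) (auto simp: n_def \<eta>_def)
      finally have "1 / (\<eta> i * real (H i)) \<le> 1 / n powr \<epsilon>" using n by (intro divide_left_mono mult_pos_pos) (auto simp: \<eta>_def H_def)
      hence "1 / (\<eta> i * real (H i)) \<le> n powr (- \<epsilon>)" by (simp add: powr_minus_divide)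
      hence "(1 / (\<eta> i * real (H i))) ^ (2 * r) \<le> (n powr (- \<epsilon>)) ^ (2 * r)" by (intro power_mono) (auto simp: \<eta>_def)
      also have "\<dots> = n powr (- (2 * (real r * \<epsilon>)))" using n by (simp add: powr_realpow[symmetric] powr_powr mult_ac)
      also have "\<dots> \<le> n powr (- 4)" using n r by (intro powr_mono) linarith+
      finally have 1: "(1 / (\<eta> i * real (H i))) ^ (2 * r) \<le> n powr (- 4)" .
      have "1 \<le> real (H i)" using H1[of i] by simp
      hence "real (r * H i + 1) \<le> (real r + 1) * real (H i)" by (simp add: algebra_simps)
      also have "\<dots> \<le> (real r + 1) * (2 * n powr 2)"
      proof (intro mult_left_mono)
        have "n powr s \<le> n powr 2" using n s by (intro powr_mono) auto
        thus "real (H i) \<le> 2 * n powr 2" using H(2)[of i] by (simp add: n_def)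
      qed auto
      finally have 2: "real (r * H i + 1) \<le> (real r + 1) * (2 * n powr 2)" .
      have "real (r * H i + 1) * (1 / (\<eta> i * real (H i))) ^ (2 * r) \<le> ((real r + 1) * (2 * n powr 2)) * n powr (- 4)"
        using 1 2 by (intro mult_mono) (auto simp: \<eta>_def)
      also have "\<dots> = 2 * (real r + 1) * (n powr 2 * n powr (- 4))" by simp
      also have "n powr 2 * n powr (- 4) = n powr (- 2)" unfolding powr_add[symmetric] by simp
      also have "n powr (- 2) \<le> n powr (- 1)" using n by (intro powr_mono) auto
      also have "n powr (- 1) = 1 / n" using n by (simp add: powr_minus_divide)
      also have "2 * (real r + 1) * (1 / n) \<le> 1 / 2" using elim n by (simp add: n_def field_simps)
      finally show ?case by (simp add: mult_left_mono)
    qed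
  qed
  define K where "K = 768 * exp 1 * (C' + 1)"
  have evM: "\<forall>\<^sub>F i in sequentially. norm (measure lborel (X i)) \<le> K * ((2 * real i + (real r + 2))\<^sup>2 * 2 powr (- (3 * \<epsilon> / 4) * real i))"
    using evC evT
  proof eventually_elim
    case (elim i)
    define n where "n = real (2 ^ i)"
    have n: "n \<ge> 1" by (simp add: n_def)
    have "(\<Sum>j<L i. real (near_count (2 ^ j) (S i) d) + (2 ^ j * real (card (S i)))\<^sup>2 * exp (- (\<sigma> i)\<^sup>2))
      \<le> (\<Sum>j<L i. (C' + 1) * n powr (4 - \<epsilon>))"
      using elim by (intro sum_mono) (auto simp: n_def ring_distribs intro!: add_mono)
    also have "\<dots> = real (L i) * ((C' + 1) * n powr (4 - \<epsilon>))" by simp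
    finally have sum: "(\<Sum>j<L i. real (near_count (2 ^ j) (S i) d) + (2 ^ j * real (card (S i)))\<^sup>2 * exp (- (\<sigma> i)\<^sup>2)) \<le> real (L i) * ((C' + 1) * n powr (4 - \<epsilon>))" .
    have "measure lborel (X i) \<le> 768 * exp 1 / n ^ 4 * \<sigma> i * real (L i) * (real (L i) * ((C' + 1) * n powr (4 - \<epsilon>)))"
      by (rule order_trans[OF X(3)], unfold n_def[symmetric], rule mult_left_mono[OF sum]) (auto simp: n_def \<sigma>_def)
    also have "\<dots> = K * ((real (L i))\<^sup>2 * (n powr (\<epsilon> / 4) * n powr (4 - \<epsilon>) / n powr 4))"
    proof -
      have "\<sigma> i = n powr (\<epsilon> / 4)" by (simp add: \<sigma>_def n_def)
      thus ?thesis using n by (simp add: K_def power2_eq_square powr_numeral)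
    qed
    also have "n powr (\<epsilon> / 4) * n powr (4 - \<epsilon>) / n powr 4 = n powr (- (3 * \<epsilon> / 4))"
      unfolding powr_add[symmetric] powr_diff[symmetric] by simp
    also have "\<dots> = 2 powr (- (3 * \<epsilon> / 4) * real i)"
      by (simp add: n_def powr_realpow[symmetric] powr_powr mult.commute)
    also have "K * ((real (L i))\<^sup>2 * 2 powr (- (3 * \<epsilon> / 4) * real i)) \<le> K * ((2 * real i + (real r + 2))\<^sup>2 * 2 powr (- (3 * \<epsilon> / 4) * real i))"
    proof (intro mult_left_mono mult_right_mono power_mono)
      have "s * real i \<le> 2 * real i" using s by (intro mult_right_mono) auto
      thus "real (L i) \<le> 2 * real i + (real r + 2)" using H(3)[of i] by (simp add: L_def)
    qed (use C' in \<open>auto simp: K_def\<close>)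
    finally show ?case by simp
  qed
  have "summable (\<lambda>i. K * ((2 * real i + (real r + 2))\<^sup>2 * 2 powr (- (3 * \<epsilon> / 4) * real i)))"
  proof (intro summable_mult)
    define \<rho> where "\<rho> = real r + 2"
    have "(\<lambda>i. (2 * real i + \<rho>)\<^sup>2 * 2 powr (- (3 * \<epsilon> / 4) * real i)) \<in> O(\<lambda>i. 1 / real i ^ 2)"
      using \<epsilon>(1) by real_asymp
    moreover have "summable (\<lambda>i. norm (1 / real i ^ 2))"
      using inverse_power_summable[of 2, where 'a=real] by (simp add: field_simps)
    ultimately show "summable (\<lambda>i. (2 * real i + (real r + 2))\<^sup>2 * 2 powr (- (3 * \<epsilon> / 4) * real i))"
      unfolding \<rho>_def by (rule summable_comparison_test_bigo[rotated])
  qed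
  hence "summable (\<lambda>i. measure lborel (X i))" by (rule summable_comparison_test_ev[OF evM])
  hence "AE \<alpha> in lborel. \<forall>\<^sub>F i in sequentially. \<alpha> \<in> space lborel - X i"
    using X(1,2) by (intro borel_cantelli_AE1) auto
  thus ?thesis
  proof eventually_elim
    case (elim \<alpha>)
    have "filterlim \<sigma> at_top sequentially"
      unfolding \<sigma>_def using \<epsilon>(1) by (intro filterlim_compose[OF real_powr_at_top pow2r]) auto
    hence "\<forall>\<^sub>F i in sequentially. \<bar>\<alpha>\<bar> \<le> \<sigma> i" by (simp add: filterlim_at_top)
    with elim evS evD show ?case
    proof eventually_elim
      case (elim i)
      thus ?case using X(4)[of i \<alpha>] by (simp add: \<eta>_def)
    qed
  qed
qed

subsection \<open>From powers of two to all N\<close>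

text \<open>N >= 2 makes the smaller set of distances nonempty, so that both minima are
  attained.\<close>

lemma delta_min_antimono:
  assumes "2 \<le> N" "N \<le> M"
  shows "delta_min x \<alpha> M \<le> delta_min x \<alpha> N"
  unfolding delta_min_def
proof (rule Min_antimono)
  show "{dist_int (\<alpha> * x m - \<alpha> * x n) |m n. m \<in> {1..N} \<and> n \<in> {1..N} \<and> m \<noteq> n} \<subseteq> {dist_int (\<alpha> * x m - \<alpha> * x n) |m n. m \<in> {1..M} \<and> n \<in> {1..M} \<and> m \<noteq> n}"
    using assms by fastforce
  have "\<exists>m n. m \<in> {1..N} \<and> n \<in> {1..N} \<and> m \<noteq> n"
    using assms by (intro exI[of _ 1] exI[of _ 2]) auto
  thus "{dist_int (\<alpha> * x m - \<alpha> * x n) |m n. m \<in> {1..N} \<and> n \<in> {1..N} \<and> m \<noteq> n} \<noteq> {}"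
    by blast
  have "{dist_int (\<alpha> * x m - \<alpha> * x n) |m n. m \<in> {1..M} \<and> n \<in> {1..M} \<and> m \<noteq> n} \<subseteq> (\<lambda>(m, n). dist_int (\<alpha> * x m - \<alpha> * x n)) ` ({1..M} \<times> {1..M})"
    by auto
  thus "finite {dist_int (\<alpha> * x m - \<alpha> * x n) |m n. m \<in> {1..M} \<and> n \<in> {1..M} \<and> m \<noteq> n}"
    by (rule finite_subset) auto
qed

lemma delta_min_le_half:
  assumes "2 \<le> N"
  shows "delta_min x \<alpha> N \<le> 1 / 2"
  using delta_min_le[of 1 N 2 x \<alpha>] dist_int_le_half[of "\<alpha> * (x 1 - x 2)"] assms by simp

text \<open>Comparison with the largest power of two not exceeding N; monotonicity costs the factor
  2^\<theta>.\<close>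

lemma delta_min_le_of_dyadic:
  assumes dy: "\<forall>\<^sub>F i in sequentially. delta_min x \<alpha> (2 ^ i) < real (2 ^ i) powr (- \<theta>)" and \<theta>: "\<theta> > 0"
  shows "\<forall>\<^sub>F N in sequentially. delta_min x \<alpha> N < 2 powr \<theta> * real N powr (- \<theta>)"
proof -
  from dy obtain i0 where i0: "\<And>i. i \<ge> i0 \<Longrightarrow> delta_min x \<alpha> (2 ^ i) < real (2 ^ i) powr (- \<theta>)"
    by (auto simp: eventually_at_top_linorder)
  have "delta_min x \<alpha> N < 2 powr \<theta> * real N powr (- \<theta>)" if N: "N \<ge> 2 ^ Suc i0" for N
  proof -
    have "(2::nat) ^ Suc i0 \<ge> 2 ^ Suc 0" by (intro power_increasing) auto
    from le_trans[OF this N] have N2: "N \<ge> 2" by simp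
    obtain i where i: "2 ^ i \<le> N" "N < 2 ^ (i + 1)"
      using ex_power_ivl1[of 2 N] N2 by auto
    have "2 ^ Suc i0 < (2::nat) ^ (i + 1)" using N i by linarith
    hence ii: "i0 < i" by (simp add: power_strict_increasing_iff flip: power_Suc)
    have "(2::nat) ^ i \<ge> 2 ^ 1" using ii by (intro power_increasing) auto
    hence "delta_min x \<alpha> N \<le> delta_min x \<alpha> (2 ^ i)" using i by (intro delta_min_antimono) auto
    also have "\<dots> < real (2 ^ i) powr (- \<theta>)" using ii by (intro i0) simp
    also have "\<dots> \<le> (real N / 2) powr (- \<theta>)"
    proof (rule powr_mono2')
      have "real N < real (2 ^ (i + 1))" using i(2) by (rule of_nat_less_iff[THEN iffD2])
      thus "real N / 2 \<le> real (2 ^ i)" by simp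
    qed (use N2 \<theta> in auto)
    also have "\<dots> = 2 powr \<theta> * real N powr (- \<theta>)"
      using N2 by (simp add: powr_divide powr_minus_divide)
    finally show ?thesis .
  qed
  thus ?thesis by (auto simp: eventually_at_top_linorder)
qed

text \<open>A single f has to serve although every \<theta> < E comes with its own starting point.
  It is therefore read off from \<delta> itself, as the amount by which the decay exponent falls
  short of E. The hypothesis asks only for some \<theta>' above each \<theta>, so a countable family
  of exponents can supply it.\<close>

lemma vanishing_exponent_correction:
  fixes \<delta> :: "nat \<Rightarrow> real" and E :: real
  assumes main: "\<And>\<theta>. 0 < \<theta> \<Longrightarrow> \<theta> < E \<Longrightarrow> \<exists>\<theta>'>\<theta>. \<theta>' < E \<and> (\<forall>\<^sub>F N in sequentially. \<delta> N < 2 powr \<theta>' * real N powr (- \<theta>'))"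
    and E: "E > 0"
  shows "\<exists>f :: nat \<Rightarrow> real. f \<longlonglongrightarrow> 0 \<and> (\<forall>\<^sub>F N in sequentially. \<delta> N < 1 / real N powr (E - f N))"
proof -
  \<comment> \<open>The summand 1/N makes the final inequality strict. Nonpositive values of
    \<delta> satisfy it at once and are set apart because the logarithm describes only positive
    ones.\<close>
  define f where "f = (\<lambda>N. if \<delta> N \<le> 0 then 0 else max 0 (E + ln (\<delta> N) / ln (real N)) + 1 / real N)"
  have f0: "f N \<ge> 0" for N by (simp add: f_def)
  have small: "\<forall>\<^sub>F N in sequentially. f N < \<zeta>" if \<zeta>: "\<zeta> > 0" for \<zeta>
  proof -
    define \<theta> where "\<theta> = max (E / 2) (E - \<zeta> / 4)"
    have "0 < \<theta>" "\<theta> < E" using E \<zeta> by (auto simp: \<theta>_def)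
    from main[OF this] obtain \<theta>' where \<theta>': "\<theta>' > \<theta>" "\<theta>' < E" "\<forall>\<^sub>F N in sequentially. \<delta> N < 2 powr \<theta>' * real N powr (- \<theta>')" by blast
    have \<theta>\<zeta>: "E - \<theta>' < \<zeta> / 4" "\<theta>' > 0" using \<theta>' E by (auto simp: \<theta>_def)
    have "(\<lambda>N::nat. \<theta>' * ln 2 / ln (real N)) \<longlonglongrightarrow> 0"
      by real_asymp
    hence "\<forall>\<^sub>F N in sequentially. \<theta>' * ln 2 / ln (real N) < \<zeta> / 4" using \<zeta> by (intro order_tendstoD(2)[of _ 0]) auto
    moreover have "(\<lambda>N::nat. 1 / real N) \<longlonglongrightarrow> 0" by real_asymp
    hence "\<forall>\<^sub>F N in sequentially. 1 / real N < \<zeta> / 4" using \<zeta> by (intro order_tendstoD(2)[of _ 0]) auto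
    ultimately show ?thesis
      using \<theta>'(3) eventually_ge_at_top[of 2]
    proof eventually_elim
      case (elim N)
      show "f N < \<zeta>"
      proof (cases "\<delta> N \<le> 0")
        case True
        thus ?thesis using \<zeta> by (simp add: f_def)
      next
        case False
        have lnN: "ln (real N) > 0" using elim by simp
        have "ln (\<delta> N) < ln (2 powr \<theta>' * real N powr (- \<theta>'))" using elim False by (subst ln_less_cancel_iff) auto
        also have "\<dots> = \<theta>' * ln 2 - \<theta>' * ln (real N)" using elim by (simp add: ln_mult ln_powr)
        finally have "ln (\<delta> N) / ln (real N) < (\<theta>' * ln 2 - \<theta>' * ln (real N)) / ln (real N)"
          using lnN by (intro divide_strict_right_mono) auto
        also have "\<dots> = \<theta>' * ln 2 / ln (real N) - \<theta>'" using lnN by (simp add: diff_divide_distrib)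
        finally have "E + ln (\<delta> N) / ln (real N) < \<zeta> / 2" using elim \<theta>\<zeta> by linarith
        hence "max 0 (E + ln (\<delta> N) / ln (real N)) < \<zeta> / 2"
          unfolding max_less_iff_conj using \<zeta> by (intro conjI) auto
        thus ?thesis using False elim \<zeta> by (simp add: f_def)
      qed
    qed
  qed
  have "f \<longlonglongrightarrow> 0"
  proof (rule order_tendstoI)
    fix a :: real assume "a < 0"
    hence "a < f N" for N using f0[of N] by linarith
    thus "\<forall>\<^sub>F N in sequentially. a < f N" by (intro always_eventually allI)
  qed (rule small)
  moreover have "\<forall>\<^sub>F N in sequentially. \<delta> N < 1 / real N powr (E - f N)"
    using eventually_ge_at_top[of 2]
  proof eventually_elim
    case (elim N)
    have eq: "1 / real N powr (E - f N) = real N powr (f N - E)"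
      by (simp add: powr_minus_divide[symmetric])
    show ?case
    proof (cases "\<delta> N \<le> 0")
      case True
      moreover have "real N powr (f N - E) > 0" using elim by simp
      ultimately show ?thesis unfolding eq by linarith
    next
      case False
      have "f N \<ge> E + ln (\<delta> N) / ln (real N) + 1 / real N" using False by (simp add: f_def)
      moreover have "1 / real N > 0" using elim by simp
      ultimately have "ln (\<delta> N) / ln (real N) < f N - E" by linarith
      hence "real N powr (ln (\<delta> N) / ln (real N)) < real N powr (f N - E)" using elim by (intro powr_less_mono) auto
      moreover have "real N powr (ln (\<delta> N) / ln (real N)) = \<delta> N" using False elim by (simp add: powr_def)
      ultimately show ?thesis unfolding eq by simp
    qed
  qed
  ultimately show ?thesis by blast
qed

theorem theorem4:
  fixes x :: "nat \<Rightarrow> real" and c \<kappa> m :: real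
  assumes pos: "\<And>n. n \<ge> 1 \<Longrightarrow> x n > 0"
    and c_pos: "c > 0"
    and gap: "\<And>n. n \<ge> 1 \<Longrightarrow> x (Suc n) - x n \<ge> c"
    and energy: "\<And>\<epsilon>. \<epsilon> > 0 \<Longrightarrow>
        \<exists>C. \<forall>N\<ge>1. real (add_energy x N) \<le> C * real N powr (2 + \<epsilon>)"
    and kappa: "\<kappa> \<ge> 2"
    and moment: "\<And>\<epsilon>. \<epsilon> > 0 \<Longrightarrow>
        \<exists>C T0. \<forall>T\<ge>T0. T > 0 \<longrightarrow>
          (1 / T) * integral {0..T} (\<lambda>t. norm (riemann_zeta (Complex (1/2) t)) powr \<kappa>)
            \<le> C * T powr (m + \<epsilon>)"
  shows "AE \<alpha> in lborel. \<exists>f :: nat \<Rightarrow> real. f \<longlonglongrightarrow> 0 \<and>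
           (\<forall>\<^sub>F N in sequentially.
              delta_min x \<alpha> N < 1 / real N powr ((2 * \<kappa> - 4) / (\<kappa> + 4 * m) - f N))"
proof -
  define E where "E = (2 * \<kappa> - 4) / (\<kappa> + 4 * m)"
  show ?thesis
  \<comment> \<open>E <= 0 occurs for \<kappa> = 2 and for \<kappa> + 4m <= 0, where a zero
    denominator makes E = 0. Then 1/2 < 1 <= N^(-E) suffices with f = 0.\<close>
  proof (cases "E \<le> 0")
    case True
    have "\<forall>\<^sub>F N in sequentially. delta_min x \<alpha> N < 1 / real N powr (E - 0)" for \<alpha>
      using eventually_ge_at_top[of 2]
    proof eventually_elim
      case (elim N)
      have "real N powr E \<le> real N powr 0" using True elim by (intro powr_mono) auto
      hence "1 \<le> 1 / real N powr E" using elim by simp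
      thus ?case using delta_min_le_half[OF elim, of x \<alpha>] by simp
    qed
    hence "\<exists>f :: nat \<Rightarrow> real. f \<longlonglongrightarrow> 0 \<and> (\<forall>\<^sub>F N in sequentially. delta_min x \<alpha> N < 1 / real N powr (E - f N))" for \<alpha>
      by (intro exI[of _ "\<lambda>_. 0"]) auto
    thus ?thesis unfolding E_def by simp
  next
    case False
    hence E: "E > 0" by simp
    have \<kappa>: "\<kappa> > 2"
    proof (rule ccontr)
      assume "\<not> \<kappa> > 2"
      hence "\<kappa> = 2" using kappa by simp
      thus False using E by (simp add: E_def)
    qed
    have inc: "x i < x j" if "1 \<le> i" "i < j" for i j
      using that(2)
    proof (induction j rule: less_induct)
      case (less j)
      then obtain k where k: "j = Suc k" "i \<le> k" by (cases j) auto
      have "x k < x (Suc k)" using gap[of k] c_pos that(1) k(2) by simp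
      moreover have "x i \<le> x k" using less.IH[of k] k by (cases "i = k") auto
      ultimately show ?case using k by simp
    qed
    \<comment> \<open>Exponents increasing to E: only countably many null sets are discarded, so one
      set of \<alpha> of full measure serves all of them.\<close>
    define \<theta> where "\<theta> = (\<lambda>q::nat. E - E / (real q + 2))"
    have \<theta>: "0 < \<theta> q" "\<theta> q < E" for q using E by (auto simp: \<theta>_def field_simps intro!: add_pos_nonneg mult_nonneg_nonneg)
    have "AE \<alpha> in lborel. \<forall>q. \<forall>\<^sub>F i in sequentially. delta_min x \<alpha> (2 ^ i) < real (2 ^ i) powr (- \<theta> q)"
      unfolding AE_all_countable
      using dyadic_delta_min_AE[OF inc energy \<kappa> moment] \<theta> unfolding E_def by blast
    thus ?thesis
    proof eventually_elim
      case (elim \<alpha>)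
      show ?case unfolding E_def[symmetric]
      proof (rule vanishing_exponent_correction[OF _ E])
        fix t assume t: "0 < t" "t < E"
        have "(\<lambda>q::nat. E - E / (real q + 2)) \<longlonglongrightarrow> E" by real_asymp
        hence "\<forall>\<^sub>F q in sequentially. t < \<theta> q" unfolding \<theta>_def using t(2) by (rule order_tendstoD(1))
        then obtain q where "t < \<theta> q" by (auto simp: eventually_at_top_linorder)
        thus "\<exists>\<theta>'>t. \<theta>' < E \<and> (\<forall>\<^sub>F N in sequentially. delta_min x \<alpha> N < 2 powr \<theta>' * real N powr (- \<theta>'))"
          using \<theta>[of q] delta_min_le_of_dyadic[OF elim[rule_format, of q]] by blast
      qed
    qed
  qed
qed

end
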